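(* For every integer $n\ge 6$, \[\mathcal{G}(n,n-3)=\{K_{2,n-2},\ K_{1,n-1}+e,\ K_{n/2,n/2}+e,\ K_2\nabla (n-2)K_1,\ K_1\nabla K_{\frac{n-1}{2},\frac{n-1}{2}},\ K_{\frac{n}{3},\frac{n}{3},\frac{n}{3}}\},\] where equality is up to isomorphism and a graph in the list on the right is included only when its parameters are integers (that is, $K_{n/2,n/2}+e$ only for $n$ even, $K_1\nabla K_{\frac{n-1}{2},\frac{n-1}{2}}$ only for $n$ odd, $K_{\frac{n}{3},\frac{n}{3},\frac{n}{3}}$ only for $3\mid n$).
   Context: All graphs are finite and simple. For a connected graph $G$ with vertices $v_1,\dots,v_n$, $d_G(v_i,v_j)$ is the length of a shortest path between $v_i$ and $v_j$; the distance matrix is $\mathcal{D}(G)=(d_G(v_i,v_j))_{i,j}$; the transmission of $v_i$ is $Tr(v_i)=\sum_{j=1}^n d_G(v_i,v_j)$; the distance Laplacian matrix is $\mathcal{D}^L(G)=\mathrm{diag}(Tr(v_1),\dots,Tr(v_n))-\mathcal{D}(G)$, with eigenvalues $\partial^L_1\ge\partial^L_2\ge\cdots\ge\partial^L_n=0$. $m(\partial^L_1)$ denotes the multiplicity of the largest eigenvalue $\partial^L_1$. $\mathcal{G}(n,k)$ is the set of connected graphs on $n$ vertices with $m(\partial^L_1)=k$. $K_{a_1,\dots,a_k}$ is the complete $k$-partite graph with parts of sizes $a_1,\dots,a_k$; $mG$ is the disjoint union of $m$ copies of $G$; $G_1\nabla G_2$ is the join, obtained from the disjoint union of $G_1$ and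 $G_2$ by joining every vertex of $G_1$ to every vertex of $G_2$. $K_{n/2,n/2}+e$ and $K_{1,n-1}+e$ are the graphs obtained from $K_{n/2,n/2}$ and $K_{1,n-1}$, respectively, by adding one edge $e$ between two non-adjacent vertices. *)

theory Defs
  imports
    "Graph_Theory.Graph_Theory"
    "Jordan_Normal_Form.Spectral_Radius"
begin

text \<open>A finite simple graph is a \<^locale>\<open>pair_graph\<close>: an edge \<open>uv\<close> is represented by the two arcs
  \<open>(u, v)\<close> and \<open>(v, u)\<close>.\<close>

definition iso_graph :: "'a pair_pre_digraph \<Rightarrow> 'b pair_pre_digraph \<Rightarrow> bool"
    (infix "\<simeq>\<^sub>G" 50) where
  "G \<simeq>\<^sub>G H \<longleftrightarrow> digraph_iso (with_proj G) (with_proj H)"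

section \<open>Distance Laplacian\<close>

text \<open>With unit weights the cost of a walk is its length, so this is the length of a shortest path.
  Only meaningful if \<open>u\<close> and \<open>v\<close> are connected by a walk: otherwise the infimum is \<open>\<infinity>\<close>,
  which is sent to 0.\<close>

definition graph_dist :: "'a pair_pre_digraph \<Rightarrow> 'a \<Rightarrow> 'a \<Rightarrow> real" where
  "graph_dist G u v = real_of_ereal (wf_digraph.\<mu> (with_proj G) (\<lambda>_. 1) u v)"

definition transmission :: "'a pair_pre_digraph \<Rightarrow> 'a \<Rightarrow> real" where
  "transmission G u = (\<Sum>v\<in>pverts G. graph_dist G u v)"

text \<open>In the matrices, \<open>vs\<close> is an enumeration without repetition of the vertices of \<open>G\<close>.\<close>

definition distance_matrix :: "'a pair_pre_digraph \<Rightarrow> 'a list \<Rightarrow> real mat" where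
  "distance_matrix G vs =
     mat (length vs) (length vs) (\<lambda>(i, j). graph_dist G (vs ! i) (vs ! j))"

definition distance_laplacian :: "'a pair_pre_digraph \<Rightarrow> 'a list \<Rightarrow> real mat" where
  "distance_laplacian G vs =
     mat_diag (length vs) (\<lambda>i. transmission G (vs ! i)) - distance_matrix G vs"

definition max_eigenvalue_mult :: "real mat \<Rightarrow> nat" where
  "max_eigenvalue_mult A = order (Max (spectrum A)) (char_poly A)"

text \<open>The multiplicity does not depend on the enumeration \<open>vs\<close>, since two enumerations give
  permutation-similar matrices; an enumeration exists because \<open>G\<close> is finite.\<close>

definition graphs_with_mult :: "nat \<Rightarrow> nat \<Rightarrow> 'a pair_pre_digraph set" where
  "graphs_with_mult n k =
     {G. pair_graph G \<and> Digraph_Component.connected (with_proj G) \<and> card (pverts G) = n \<and>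
         (\<forall>vs. distinct vs \<and> set vs = pverts G \<longrightarrow>
            max_eigenvalue_mult (distance_laplacian G vs) = k)}"

section \<open>Graph constructions\<close>

definition complete_graph :: "nat \<Rightarrow> nat pair_pre_digraph" where
  "complete_graph n =
     \<lparr>pverts = {..<n}, parcs = {(u, v). u < n \<and> v < n \<and> u \<noteq> v}\<rparr>"

text \<open>The vertex \<open>(i, j)\<close> is the \<open>j\<close>-th vertex of the \<open>i\<close>-th part.\<close>

definition complete_multipartite :: "nat list \<Rightarrow> (nat \<times> nat) pair_pre_digraph" where
  "complete_multipartite as =
     (let V = {(i, j). i < length as \<and> j < as ! i}
      in \<lparr>pverts = V, parcs = {(u, v). u \<in> V \<and> v \<in> V \<and> fst u \<noteq> fst v}\<rparr>)"

definition copies :: "nat \<Rightarrow> 'a pair_pre_digraph \<Rightarrow> (nat \<times> 'a) pair_pre_digraph" where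
  "copies m G =
     \<lparr>pverts = {..<m} \<times> pverts G,
      parcs = {((i, u), (j, v)) | i j u v. i < m \<and> i = j \<and> (u, v) \<in> parcs G}\<rparr>"

definition join_graph ::
    "'a pair_pre_digraph \<Rightarrow> 'b pair_pre_digraph \<Rightarrow> ('a + 'b) pair_pre_digraph"
    (infixr "\<nabla>" 65) where
  "G \<nabla> H =
     \<lparr>pverts = pverts G <+> pverts H,
      parcs = map_prod Inl Inl ` parcs G \<union> map_prod Inr Inr ` parcs H
        \<union> (Inl ` pverts G) \<times> (Inr ` pverts H) \<union> (Inr ` pverts H) \<times> (Inl ` pverts G)\<rparr>"

definition add_edge :: "'a pair_pre_digraph \<Rightarrow> 'a \<Rightarrow> 'a \<Rightarrow> 'a pair_pre_digraph" where
  "add_edge G u v = G\<lparr>parcs := parcs G \<union> {(u, v), (v, u)}\<rparr>"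

text \<open>All graphs \<open>G + e\<close> with \<open>e\<close> joining two non-adjacent vertices of \<open>G\<close>.\<close>

definition plus_edge :: "'a pair_pre_digraph \<Rightarrow> 'a pair_pre_digraph set" where
  "plus_edge G =
     {add_edge G u v | u v. u \<in> pverts G \<and> v \<in> pverts G \<and> u \<noteq> v \<and> (u, v) \<notin> parcs G}"

end

theory Submission
  imports Defs
begin

text \<open>Suppose that the largest eigenvalue \<open>\<lambda>\<close> of \<open>D\<^sup>L\<close> has multiplicity \<open>n - 3\<close>. Then
  \<open>\<lambda> I - D\<^sup>L\<close> is positive semidefinite of rank three and has the all-ones vector as an
  eigenvector. Splitting off that direction leaves the Gram matrix of vectors \<open>y v\<close> that span the
  plane, have sum zero and satisfy \<open>\<langle>y u, y v\<rangle> = d u v - c\<close> for \<open>u \<noteq> v\<close>, where \<open>c = \<lambda> / n\<close>. For a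
  fixed vertex \<open>u\<close> the cross products \<open>x v\<close> of \<open>y u\<close> and \<open>y v\<close> obey
  \<open>|y u|\<^sup>2 (d v w - c) = (d u v - c) (d u w - c) + x v x w\<close>, so the products \<open>x v x w\<close> over the
  neighbours of \<open>u\<close> take two values only. If all \<open>y v\<close> were distinct, this would bound the degrees by
  three; degree three forces two opposite vectors, and degree at most two a shortest path that is too
  long, both of which are impossible for \<open>n \<ge> 6\<close>. Hence two of the vectors coincide, and seen
  from such a vertex the identity above together with the zero sum leaves only the six families.
  Conversely, each of these graphs has diameter two, and \<open>\<lambda> I - D\<^sup>L\<close> is an explicit positive
  combination of the squares of three orthogonal eigenvectors.\<close>

section \<open>Distance functions with a planar Gram matrix\<close>

text \<open>The diagonal of the Gram matrix is not prescribed, because |y u|^2 depends on the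
  transmission of u. Hence \<open>gram\<close> speaks of distinct vertices only, and reasoning at a
  single vertex has to cope with an unknown positive \<open>ip u u\<close>. Two coinciding vectors
  remove this obstacle: their common squared length is then an off-diagonal entry. It turns out to
  be 2 - c, and everything seen from such a vertex becomes explicit in c. This is what makes the
  search for a coincidence worthwhile. Dimension two enters through the scalar cross product: seen
  from u, a vertex is described by its distance and one real number, and these numbers sum to zero.
  The bound six is sharp. The five-cycle has multiplicity two, its vectors are pairwise distinct,
  and it belongs to none of the families.\<close>

locale planar_metric =
  fixes V :: "'a set" and d :: "'a \<Rightarrow> 'a \<Rightarrow> nat" and c :: real and f g :: "'a \<Rightarrow> real"
  assumes finite_V: "finite V" and card_V: "6 \<le> card V"
    and dist_eq_0: "\<And>u v. u \<in> V \<Longrightarrow> v \<in> V \<Longrightarrow> d u v = 0 \<longleftrightarrow> u = v"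
    and dist_commute: "\<And>u v. u \<in> V \<Longrightarrow> v \<in> V \<Longrightarrow> d u v = d v u"
    and dist_triangle: "\<And>u v w. u \<in> V \<Longrightarrow> v \<in> V \<Longrightarrow> w \<in> V \<Longrightarrow> d u w \<le> d u v + d v w"
    and dist_step: "\<And>u v. u \<in> V \<Longrightarrow> v \<in> V \<Longrightarrow> u \<noteq> v \<Longrightarrow> \<exists>w\<in>V. d u w = 1 \<and> d u v = d w v + 1"
    and gram: "\<And>u v. u \<in> V \<Longrightarrow> v \<in> V \<Longrightarrow> u \<noteq> v \<Longrightarrow> f u * f v + g u * g v = real (d u v) - c"
    and sum_f: "(\<Sum>v\<in>V. f v) = 0" and sum_g: "(\<Sum>v\<in>V. g v) = 0"
    and spanning: "\<exists>u\<in>V. \<exists>v\<in>V. f u * g v - g u * f v \<noteq> 0"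
begin

definition ip :: "'a \<Rightarrow> 'a \<Rightarrow> real" where "ip u v = f u * f v + g u * g v"

definition cr :: "'a \<Rightarrow> 'a \<Rightarrow> real" where "cr u v = f u * g v - g u * f v"

definition nbrs :: "'a \<Rightarrow> 'a set" where "nbrs u = {v \<in> V. d u v = 1}"

lemma ip_dist: "u \<in> V \<Longrightarrow> v \<in> V \<Longrightarrow> u \<noteq> v \<Longrightarrow> ip u v = real (d u v) - c"
  by (simp add: ip_def gram)

text \<open>The vector y u and its rotation by a right angle form an orthogonal basis of the plane,
  in which y v has the coordinates \<open>ip u v\<close> and \<open>cr u v\<close> up to the factor
  |y u|^2. This identity and \<open>ip_cr\<close> compute the inner and the cross product of y v and
  y w in that basis.\<close>

lemma ip_ip_cr: "ip u u * ip v w = ip u v * ip u w + cr u v * cr u w"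
  by (simp add: ip_def cr_def algebra_simps)

lemma ip_cr: "ip u u * cr v w = ip u v * cr u w - cr u v * ip u w"
  by (simp add: ip_def cr_def algebra_simps)

lemma sum_ip: "(\<Sum>v\<in>V. ip u v) = 0"
  by (simp add: ip_def sum.distrib sum_f sum_g flip: sum_distrib_left)

lemma sum_cr: "(\<Sum>v\<in>V. cr u v) = 0"
  by (simp add: cr_def sum_subtractf sum_f sum_g flip: sum_distrib_left)

lemma ip_self_nonneg: "0 \<le> ip u u"
  by (simp add: ip_def)

lemma ip_self_eq_0: "ip u u = 0 \<longleftrightarrow> f u = 0 \<and> g u = 0"
  by (simp add: ip_def sum_squares_eq_zero_iff)

text \<open>The product of |y u|^2 and |y v - y w|^2 is the sum of the squares of the two coordinate
  differences.\<close>

lemma eq_if_same_coordinates: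
  assumes "ip u u > 0" "ip u v = ip u w" "cr u v = cr u w"
  shows "f v = f w \<and> g v = g w"
proof -
  define h k where "h = f v - f w" and "k = g v - g w"
  have "f u * h + g u * k = 0" "f u * k - g u * h = 0"
    using assms by (auto simp: ip_def cr_def h_def k_def algebra_simps)
  then have "(f u * h + g u * k)^2 + (f u * k - g u * h)^2 = 0" by simp
  then have "ip u u * (h^2 + k^2) = 0"
    by (simp add: ip_def algebra_simps power2_eq_square)
  then have "h^2 + k^2 = 0" using assms by simp
  then show ?thesis by (simp add: h_def k_def sum_power2_eq_zero_iff)
qed

lemma dist_ge_1: "u \<in> V \<Longrightarrow> v \<in> V \<Longrightarrow> u \<noteq> v \<Longrightarrow> 1 \<le> d u v"
  using dist_eq_0[of u v] by (cases "d u v") auto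

text \<open>For c at most 1 all inner products would be nonnegative. Since \<open>ip u\<close> sums
  to zero over V, every vector would vanish, against \<open>spanning\<close>.\<close>

lemma c_gt_1: "c > 1"
proof (rule ccontr)
  assume "\<not> c > 1"
  have z: "f u = 0 \<and> g u = 0" if u: "u \<in> V" for u
  proof -
    have "0 \<le> ip u v" if "v \<in> V" for v
      using dist_ge_1[OF u that] \<open>\<not> c > 1\<close> ip_dist[OF u that] ip_self_nonneg[of u]
      by (cases "u = v") auto
    then have "ip u u = 0"
      using sum_nonneg_eq_0_iff[OF finite_V, of "ip u"] sum_ip[of u] u by auto
    then show ?thesis by (simp add: ip_self_eq_0)
  qed
  then show False using spanning by auto
qed

lemma ex_nbr: 
  assumes "u \<in> V" shows "\<exists>v. v \<in> nbrs u \<and> v \<noteq> u"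
proof -
  have "\<not> V \<subseteq> {u}" using card_V card_mono[of "{u}" V] by auto
  then obtain w where "w \<in> V" "w \<noteq> u" by blast
  then obtain x where "x \<in> V" "d u x = 1" using dist_step[OF assms] by metis
  then show ?thesis using dist_eq_0[of u u] assms unfolding nbrs_def
    by (intro exI[of _ x]) auto
qed

text \<open>A zero vector would have inner product 0 with a neighbour, but that inner product is 1 -
  c < 0.\<close>

lemma ip_self_pos:
  assumes "u \<in> V" shows "0 < ip u u"
proof (rule ccontr)
  assume "\<not> 0 < ip u u"
  then have "ip u u = 0" using ip_self_nonneg[of u] by simp
  then have "f u = 0 \<and> g u = 0" by (simp add: ip_self_eq_0)
  moreover obtain v where "v \<in> nbrs u" "v \<noteq> u" using ex_nbr[OF assms] by blast
  ultimately show False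
    using ip_dist[of u v] assms c_gt_1 by (auto simp: nbrs_def ip_def)
qed

lemma nbrs_sub: "nbrs u \<subseteq> V" by (auto simp: nbrs_def)

lemma nbrsD: "v \<in> nbrs u \<Longrightarrow> v \<in> V \<and> d u v = 1" by (auto simp: nbrs_def)

lemma nbrs_sym: "u \<in> V \<Longrightarrow> v \<in> nbrs u \<Longrightarrow> u \<in> nbrs v"
  by (auto simp: nbrs_def dist_commute)

lemma nbrs_irrefl: "u \<in> V \<Longrightarrow> v \<in> nbrs u \<Longrightarrow> v \<noteq> u"
  using dist_eq_0 by (force simp: nbrs_def)

lemma finite_nbrs: "finite (nbrs u)"
  using finite_V nbrs_sub finite_subset by blast

text \<open>Connectedness, in the form in which a small explicit set is shown to be all of
  V.\<close>

lemma closed_set: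
  assumes "S \<subseteq> V" "s \<in> S" "\<And>x. x \<in> S \<Longrightarrow> nbrs x \<subseteq> S"
  shows "S = V"
proof -
  have "v \<in> S" if "v \<in> V" for v
    using \<open>s \<in> S\<close>
  proof (induction "d s v" arbitrary: s)
    case 0
    then have "s = v" using dist_eq_0[of s v] assms(1) that by auto
    then show ?case using 0 by simp
  next
    case (Suc k)
    then have "s \<noteq> v" using dist_eq_0[of s v] assms(1) that by auto
    have "s \<in> V" using Suc.prems assms(1) by auto
    from dist_step[OF this that \<open>s \<noteq> v\<close>]
    obtain w where w: "w \<in> V" "d s w = 1" "d s v = d w v + 1" by auto
    then have "w \<in> S" using assms(3)[OF Suc.prems] by (auto simp: nbrs_def)
    then show ?case using Suc.hyps w by simp
  qed
  then show ?thesis using assms(1) by blast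
qed

text \<open>Two neighbours of u are at distance 1 or 2, and both have inner product 1 - c with y u,
  so \<open>ip_ip_cr\<close> leaves one value per distance. The value for adjacent neighbours is
  always negative; the sign of the other one depends on c.\<close>

lemma cr_nbrs:
  assumes u: "u \<in> V" and v: "v \<in> nbrs u" and w: "w \<in> nbrs u" and "v \<noteq> w"
  shows "cr u v * cr u w = ip u u * (1 - c) - (1 - c)^2 \<and> cr u v * cr u w < 0
    \<or> cr u v * cr u w = ip u u * (2 - c) - (1 - c)^2"
proof -
  have V: "v \<in> V" "w \<in> V" and "d u v = 1" "d u w = 1" "v \<noteq> u" "w \<noteq> u"
    using v w nbrs_irrefl[OF u] by (auto simp: nbrs_def)
  then have ip: "ip u v = 1 - c" "ip u w = 1 - c" using u by (auto simp: ip_dist)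
  have "d v w \<le> 2" using dist_triangle[of v u w] V u \<open>d u v = 1\<close> \<open>d u w = 1\<close> dist_commute[of u v]
    by simp
  then consider "d v w = 1" | "d v w = 2" using dist_ge_1[OF V \<open>v \<noteq> w\<close>] by linarith
  then show ?thesis
  proof cases
    case 1
    have "ip u u * (1 - c) < 0" using ip_self_pos[OF u] c_gt_1 by (simp add: mult_pos_neg)
    then have "ip u u * (1 - c) - (1 - c)^2 < 0" by (smt (verit) zero_le_power2)
    then show ?thesis using ip_ip_cr[of u v w] ip 1 ip_dist[OF V \<open>v \<noteq> w\<close>]
      by (simp add: power2_eq_square)
  next
    case 2
    then show ?thesis using ip_ip_cr[of u v w] ip ip_dist[OF V \<open>v \<noteq> w\<close>]
      by (simp add: power2_eq_square)
  qed
qed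

end

section \<open>Pairwise distinct vectors: bounding the degrees\<close>

locale planar_metric_inj = planar_metric +
  assumes inj: "\<And>u v. u \<in> V \<Longrightarrow> v \<in> V \<Longrightarrow> f u = f v \<Longrightarrow> g u = g v \<Longrightarrow> u = v"
begin

text \<open>All neighbours of u share the inner product 1 - c with y u, so only the cross product
  can separate their vectors.\<close>

lemma cr_nbrs_inj:
  assumes "u \<in> V" "v \<in> nbrs u" "w \<in> nbrs u" "cr u v = cr u w"
  shows "v = w"
proof -
  have "ip u v = ip u w"
    using assms nbrs_irrefl[OF assms(1), of v] nbrs_irrefl[OF assms(1), of w]
      ip_dist[of u v] ip_dist[of u w] by (simp add: nbrs_def)
  then show ?thesis
    using eq_if_same_coordinates[OF ip_self_pos] assms inj nbrs_sub by blast
qed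

text \<open>Three distinct non-zero reals have three distinct pairwise products, but only two values
  are available.\<close>

lemma three_nbrs:
  assumes u: "u \<in> V" and N: "a \<in> nbrs u" "b \<in> nbrs u" "e \<in> nbrs u"
    and "a \<noteq> b" "a \<noteq> e" "b \<noteq> e"
  shows "cr u a = 0 \<or> cr u b = 0 \<or> cr u e = 0"
proof (rule ccontr)
  assume nz: "\<not> ?thesis"
  have "cr u a \<noteq> cr u b" "cr u a \<noteq> cr u e" "cr u b \<noteq> cr u e"
    using cr_nbrs_inj[OF u] assms by blast+
  then have "cr u a * cr u b \<noteq> cr u a * cr u e" "cr u a * cr u b \<noteq> cr u b * cr u e"
    "cr u a * cr u e \<noteq> cr u b * cr u e"
    using nz by auto
  then show False
    using cr_nbrs[OF u N(1,2)] cr_nbrs[OF u N(1,3)] cr_nbrs[OF u N(2,3)] assms by metis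
qed

text \<open>Among any three neighbours one has cross product 0, and by injectivity there is only one
  such neighbour z, so a fourth neighbour is impossible. A product with z is 0 and thus not the
  negative value of \<open>cr_nbrs\<close>; so the other value is 0, which gives c < 2. The nonzero
  product for a and b must then be the negative value.\<close>

lemma degree_3:
  assumes u: "u \<in> V" and "card (nbrs u) \<ge> 3"
  obtains a b z where "nbrs u = {a, b, z}" "a \<noteq> b" "a \<noteq> z" "b \<noteq> z"
    "cr u z = 0" "cr u a * cr u b < 0" "c < 2"
proof -
  obtain T where T: "T \<subseteq> nbrs u" "card T = 3"
    using assms obtain_subset_with_card_n by metis
  then obtain x1 x2 x3 where x: "T = {x1, x2, x3}" "x1 \<noteq> x2" "x1 \<noteq> x3" "x2 \<noteq> x3"
    by (auto simp: card_3_iff)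
  have "\<exists>a b z. T = {a, b, z} \<and> a \<noteq> b \<and> a \<noteq> z \<and> b \<noteq> z \<and> cr u z = 0"
    using three_nbrs[OF u, of x1 x2 x3] T x by (metis insert_commute insert_subset)
  then obtain a b z where abz: "T = {a, b, z}" "a \<noteq> b" "a \<noteq> z" "b \<noteq> z" "cr u z = 0" by blast
  have N: "a \<in> nbrs u" "b \<in> nbrs u" "z \<in> nbrs u" using abz T by auto
  have nz: "cr u v \<noteq> 0" if "v \<in> nbrs u" "v \<noteq> z" for v
    using cr_nbrs_inj[OF u that(1) N(3)] abz that by auto
  have "nbrs u = {a, b, z}"
  proof (rule ccontr)
    assume "nbrs u \<noteq> {a, b, z}"
    then obtain w where "w \<in> nbrs u" "w \<notin> {a, b, z}" using N by auto
    then show False using three_nbrs[OF u N(1,2), of w] nz N abz by auto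
  qed
  moreover have az: "ip u u * (2 - c) = (1 - c)^2"
    using cr_nbrs[OF u N(1,3)] abz by auto
  then have "0 < ip u u * (2 - c)" using c_gt_1 by simp
  then have "c < 2" using ip_self_pos[OF u] by (simp add: zero_less_mult_iff)
  moreover have "cr u a * cr u b < 0"
    using cr_nbrs[OF u N(1,2)] az nz[OF N(1)] nz[OF N(2)] abz by auto
  ultimately show thesis using that abz by blast
qed

text \<open>For the collinear neighbour z of u, the vector y z is a negative multiple of y u. This
  splits the other vertices between u and z, makes z a vertex of degree three as well, and the two
  sides then determine c and |y u|^2 completely.\<close>

lemma degree_le_2:
  assumes u: "u \<in> V" shows "card (nbrs u) \<le> 2"
proof (rule ccontr)
  assume "\<not> ?thesis"
  then obtain a b z where N: "nbrs u = {a, b, z}" "a \<noteq> b" "a \<noteq> z" "b \<noteq> z"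
    "cr u z = 0" "cr u a * cr u b < 0" "c < 2"
    using degree_3[OF u] by (metis not_less_eq_eq numeral_2_eq_2 numeral_3_eq_3)
  have z: "z \<in> V" "d u z = 1" "z \<noteq> u" using N nbrsD[of z u] nbrs_irrefl[OF u, of z] by auto
  have uz: "ip u z = 1 - c" using ip_dist[OF u z(1)] z by auto
  have anti: "ip u u * ip z w = (1 - c) * ip u w" for w
    using ip_ip_cr[of u z w] N uz by simp
  \<comment> \<open>Opposite vectors have inner products of opposite sign with y w. As 1 < c < 2,
    the sign of d - c tells exactly whether d = 1, so every other vertex is adjacent to precisely
    one of u and z.\<close>
  have adj: "d z w = 1 \<longleftrightarrow> d u w \<noteq> 1" if w: "w \<in> V" "w \<noteq> u" "w \<noteq> z" for w
  proof -
    have "ip u u * (real (d z w) - c) = (1 - c) * (real (d u w) - c)"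
      using anti[of w] ip_dist[OF u w(1)] ip_dist[OF z(1) w(1)] w by auto
    moreover have "1 \<le> d u w" "1 \<le> d z w" using dist_ge_1 u z w by auto
    moreover have "0 < ip u u" using ip_self_pos[OF u] .
    ultimately have "real (d z w) - c < 0 \<longleftrightarrow> real (d u w) - c > 0"
      using c_gt_1 by (metis diff_gt_0_iff_gt diff_less_0_iff_less mult_less_0_iff not_less_iff_gr_or_eq
          zero_less_mult_iff)
    moreover have "real (d z w) - c < 0 \<longleftrightarrow> d z w = 1" "real (d u w) - c > 0 \<longleftrightarrow> d u w \<noteq> 1"
      using \<open>1 \<le> d z w\<close> \<open>1 \<le> d u w\<close> c_gt_1 \<open>c < 2\<close> by linarith+
    ultimately show ?thesis by simp
  qed
  have "V \<subseteq> nbrs u \<union> nbrs z"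
  proof
    fix w assume w: "w \<in> V"
    consider "w = u" | "w = z" | "w \<noteq> u" "w \<noteq> z" by blast
    then show "w \<in> nbrs u \<union> nbrs z"
    proof cases
      case 1
      then show ?thesis using z u by (simp add: nbrs_def dist_commute)
    next
      case 2
      then show ?thesis using z by (simp add: nbrs_def)
    next
      case 3
      then show ?thesis using adj w by (auto simp: nbrs_def)
    qed
  qed
  \<comment> \<open>Six vertices are covered by two neighbourhoods, one of which has three elements,
    so \<open>degree_3\<close> applies to z too.\<close>
  then have "card V \<le> card (nbrs u) + card (nbrs z)"
    using finite_nbrs by (meson card_Un_le card_mono finite_Un le_trans)
  moreover have "card (nbrs u) = 3" using N by simp
  ultimately have "card (nbrs z) \<ge> 3" using card_V by simp
  then obtain e h z' where M: "nbrs z = {e, h, z'}" "e \<noteq> h" "e \<noteq> z'" "h \<noteq> z'"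
    "cr z z' = 0" "cr z e * cr z h < 0"
    using degree_3[OF z(1)] by metis
  have "cr z u = 0" using N(5) by (simp add: cr_def algebra_simps)
  moreover have "u \<in> nbrs z" using nbrs_sym[OF u] N by auto
  ultimately have "u = z'" using M by auto
  then have eh: "e \<in> V" "h \<in> V" "d z e = 1" "d z h = 1" "e \<noteq> z" "h \<noteq> z" "e \<noteq> u" "h \<noteq> u"
    using M nbrsD[of _ z] nbrs_irrefl[OF z(1)] by auto
  have a: "a \<in> V" "d u a = 1" "a \<noteq> u" "a \<noteq> z" using N nbrsD[of a u] nbrs_irrefl[OF u] by auto
  have "d u e \<noteq> 1" "d u h \<noteq> 1" "d z a \<noteq> 1" using adj eh a by auto
  then have d2: "d u e = 2" "d u h = 2" "d z a = 2"
    using dist_triangle[of u z e] dist_triangle[of u z h] dist_triangle[of z u a] u z a eh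
      dist_ge_1[of u e] dist_ge_1[of u h] dist_ge_1[of z a] dist_commute[of u z] by auto
  \<comment> \<open>The vertex a has distances 1 and 2 to u and z, the vertex e has distances 2 and
    1. The proportionality of y z and y u at these two vertices gives two equations, with the
    solution c = 3/2 and |y u|^2 = 1/2.\<close>
  have "ip u u * (2 - c) = (1 - c) * (1 - c)"
    using anti[of a] ip_dist[of u a] ip_dist[of z a] a z u d2 by auto
  moreover have "ip u u * (1 - c) = (1 - c) * (2 - c)"
    using anti[of e] ip_dist[of u e] ip_dist[of z e] eh z u d2 by auto
  then have q: "ip u u = 2 - c" using c_gt_1 by (simp add: mult.commute)
  ultimately have "(2 - c) * (2 - c) = (1 - c) * (1 - c)" by simp
  then have c: "c = 3/2" by (simp add: algebra_simps)
  \<comment> \<open>With these values the product equals (d a x - 1) / 2. It follows that e and h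
    lie weakly on the side of a, whereas \<open>degree_3\<close> at z puts them strictly on opposite
    sides.\<close>
  have ac: "0 \<le> cr u a * cr u x" if x: "x \<in> V" "x \<noteq> a" "x \<noteq> u" "d u x = 2" for x
  proof -
    have "1/2 * (real (d a x) - 3/2) = (1 - 3/2) * (2 - 3/2) + cr u a * cr u x"
      using ip_ip_cr[of u a x] q c ip_dist[of u a] ip_dist[of u x] ip_dist[of a x] a u x by auto
    then show ?thesis using dist_ge_1[of a x] a x by simp
  qed
  have "cr z x = - cr u x" for x
    using ip_cr[of u z x] N uz q c by simp
  then have "cr u e * cr u h < 0" using M by simp
  moreover have "e \<noteq> a" "h \<noteq> a" using d2 a by auto
  then have "0 \<le> cr u a * cr u e" "0 \<le> cr u a * cr u h" 
    using ac[of e] ac[of h] eh d2 a by auto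
  moreover have "cr u a \<noteq> 0" using N by auto
  ultimately show False
    by (auto simp: zero_le_mult_iff mult_less_0_iff)
qed

end

text \<open>Cramer's rule: in the plane only the zero vector is orthogonal to two independent
  vectors.\<close>

lemma parallel_if_same_line:
  fixes a1 a2 b1 b2 z1 z2 :: real
  assumes "a1 * z1 + a2 * z2 = 0" "b1 * z1 + b2 * z2 = 0" "a1 * b2 - a2 * b1 \<noteq> 0"
  shows "z1 = 0 \<and> z2 = 0"
proof -
  have "(a1 * b2 - a2 * b1) * z1 = b2 * (a1 * z1 + a2 * z2) - a2 * (b1 * z1 + b2 * z2)"
    "(a1 * b2 - a2 * b1) * z2 = a1 * (b1 * z1 + b2 * z2) - b1 * (a1 * z1 + a2 * z2)"
    by (simp_all add: algebra_simps)
  then have "(a1 * b2 - a2 * b1) * z1 = 0" "(a1 * b2 - a2 * b1) * z2 = 0"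
    using assms(1,2) by simp_all
  then show ?thesis using assms(3) by simp
qed

text \<open>Along a shortest path the distance to v drops by one at each step, so no smaller value
  is skipped.\<close>

lemma (in planar_metric) ex_dist:
  assumes "u \<in> V" "v \<in> V" "k \<le> d u v"
  shows "\<exists>w\<in>V. d w v = k"
  using assms
proof (induction "d u v" arbitrary: u rule: less_induct)
  case less
  show ?case
  proof (cases "d u v = k")
    case False
    then have "u \<noteq> v" using less.prems dist_eq_0[of u v] by auto
    from dist_step[OF less.prems(1,2) this]
    obtain w where w: "w \<in> V" "d u w = 1" "d u v = d w v + 1" by auto
    then show ?thesis using less.hyps[of w] less.prems False by simp
  qed (use less.prems in blast)
qed

section \<open>Pairwise distinct vectors: graphs of maximum degree two\<close>

context planar_metric_inj
begin

lemma nbrs_eqI: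
  assumes u: "u \<in> V" and "a \<in> nbrs u" "b \<in> nbrs u" "a \<noteq> b"
  shows "nbrs u = {a, b}"
  using assms degree_le_2[OF u] card_seteq[of "nbrs u" "{a, b}"] finite_nbrs by simp

text \<open>The degree bound fixes the neighbourhoods of p1, p2 and p3, hence all distances among
  the five vertices except d p0 p4. That one is at least 2, which is enough to contradict the
  geometry of the plane.\<close>

lemma no_path:
  assumes V: "p0 \<in> V" "p1 \<in> V" "p2 \<in> V" "p3 \<in> V" "p4 \<in> V"
    and d: "d p0 p1 = 1" "d p1 p2 = 1" "d p2 p3 = 1" "d p3 p4 = 1" "d p0 p3 = 3"
    and new: "p4 \<notin> {p0, p1, p2, p3}"
  shows False
proof -
  note sym = dist_commute[OF V(1) V(2)] dist_commute[OF V(2) V(3)] dist_commute[OF V(3) V(4)]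
    dist_commute[OF V(4) V(5)]
  have d02: "d p0 p2 = 2" and d13: "d p1 p3 = 2"
    using dist_triangle[of p0 p1 p2] dist_triangle[of p0 p2 p3] dist_triangle[of p0 p1 p3]
      dist_triangle[of p1 p2 p3] V d by auto
  have ne: "p0 \<noteq> p1" "p1 \<noteq> p2" "p2 \<noteq> p3" "p0 \<noteq> p3" "p0 \<noteq> p2" "p1 \<noteq> p3"
    using d d02 d13 dist_eq_0[OF V(1,2)] dist_eq_0[OF V(2,3)] dist_eq_0[OF V(3,4)]
      dist_eq_0[OF V(1,4)] dist_eq_0[OF V(1,3)] dist_eq_0[OF V(2,4)] by auto
  have N1: "nbrs p1 = {p0, p2}" and N2: "nbrs p2 = {p1, p3}" and N3: "nbrs p3 = {p2, p4}"
    using nbrs_eqI[of p1 p0 p2] nbrs_eqI[of p2 p1 p3] nbrs_eqI[of p3 p2 p4] V d ne sym new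
    by (auto simp: nbrs_def)
  have d24: "d p2 p4 = 2"
  proof -
    have "d p2 p4 \<noteq> 1" using N2 new V by (auto simp: nbrs_def)
    then show ?thesis using dist_triangle[of p2 p3 p4] dist_ge_1[of p2 p4] V d new by fastforce
  qed
  \<comment> \<open>This edge would close a five-cycle in which every degree is exhausted, leaving
    no room for a sixth vertex.\<close>
  have "d p0 p4 \<noteq> 1"
  proof
    assume "d p0 p4 = 1"
    then have "nbrs p0 = {p1, p4}" "nbrs p4 = {p3, p0}"
      using nbrs_eqI[of p0 p1 p4] nbrs_eqI[of p4 p3 p0] V d sym new ne dist_commute[of p0 p4]
      by (auto simp: nbrs_def)
    then have "nbrs x \<subseteq> {p0, p1, p2, p3, p4}" if "x \<in> {p0, p1, p2, p3, p4}" for x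
      using that N1 N2 N3 by auto
    then have "{p0, p1, p2, p3, p4} = V"
      by (intro closed_set[of "{p0, p1, p2, p3, p4}" p0]) (use V in simp_all)
    then show False using card_V card_length[of "[p0, p1, p2, p3, p4]"] by simp
  qed
  then have d04: "2 \<le> d p0 p4" using dist_ge_1[of p0 p4] V new by fastforce
  have d14: "d p1 p4 = 3"
  proof -
    have "d p1 p4 \<noteq> 1" using N1 new V by (auto simp: nbrs_def)
    moreover have "d p1 p4 \<noteq> 2"
    proof
      assume "d p1 p4 = 2"
      moreover obtain w where "w \<in> V" "d p1 w = 1" "d p1 p4 = d w p4 + 1"
        using dist_step[of p1 p4] V new by auto
      ultimately have "w \<in> nbrs p1" "d w p4 = 1" by (auto simp: nbrs_def)
      then show False using N1 \<open>d p0 p4 \<noteq> 1\<close> d24 by auto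
    qed
    ultimately show ?thesis
      using dist_triangle[of p1 p2 p4] dist_ge_1[of p1 p4] V d d24 new by fastforce
  qed
  \<comment> \<open>For c at least 3, seen from p1 the vertices p0, p2 and p3 would have pairwise
    negative products of cross products: their mutual inner products are not positive, while those
    with p1 are all negative. Three reals cannot do this.\<close>
  have c3: "c < 3"
  proof (rule ccontr)
    assume "\<not> c < 3"
    have neg: "cr p1 v * cr p1 w < 0"
      if "v \<in> V" "w \<in> V" "v \<noteq> w" "v \<noteq> p1" "w \<noteq> p1" "d p1 v \<le> 2" "d p1 w \<le> 2" "d v w \<le> 3" for v w
    proof -
      have "ip p1 p1 * ip v w \<le> 0"
        using that \<open>\<not> c < 3\<close> ip_dist[of v w] ip_self_pos[OF V(2)]
        by (simp add: mult_nonneg_nonpos)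
      moreover have "0 < ip p1 v * ip p1 w"
        using that \<open>\<not> c < 3\<close> ip_dist[of p1 v] ip_dist[of p1 w] V(2) by (simp add: mult_neg_neg)
      ultimately show ?thesis using ip_ip_cr[of p1 v w] by linarith
    qed
    have "cr p1 p0 * cr p1 p2 < 0" "cr p1 p0 * cr p1 p3 < 0" "cr p1 p2 * cr p1 p3 < 0"
      using neg[of p0 p2] neg[of p0 p3] neg[of p2 p3] V ne d d13 d02 sym by auto
    then show False by (auto simp: mult_less_0_iff)
  qed
  note ips = ip_dist[OF V(1) V(2)] ip_dist[OF V(1) V(3)] ip_dist[OF V(1) V(4)] ip_dist[OF V(1) V(5)]
    ip_dist[OF V(2) V(3)] ip_dist[OF V(2) V(4)] ip_dist[OF V(2) V(5)] ip_dist[OF V(3) V(4)]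
    ip_dist[OF V(3) V(5)] ip_dist[OF V(4) V(5)]
  have i: "ip p0 p1 = 1 - c" "ip p0 p2 = 2 - c" "ip p0 p3 = 3 - c" "ip p1 p2 = 1 - c" 
    "ip p1 p4 = 3 - c" "ip p2 p3 = 1 - c" "ip p2 p4 = 2 - c" "ip p3 p4 = 1 - c"
    "ip p0 p4 = real (d p0 p4) - c"
    using ips d d02 d13 d24 d14 ne new by auto
  show False
  proof (cases "cr p0 p4 = 0")
    case True
    \<comment> \<open>If p0 and p4 are collinear, comparing them through p1 forces d p0 p4 = 2 and c
      > 2; comparing them through p2 then gives |y p0|^2 = 2 - c < 0.\<close>
    have "ip p0 p0 * (3 - c) = (1 - c) * (real (d p0 p4) - c)"
      using ip_ip_cr[of p0 p1 p4] True i by simp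
    moreover have "0 < ip p0 p0 * (3 - c)" using c3 ip_self_pos[OF V(1)] by simp
    ultimately have "real (d p0 p4) < c" using c_gt_1 by (simp add: zero_less_mult_iff)
    then have "d p0 p4 < 3" using c3 by linarith
    then have d04': "d p0 p4 = 2" using d04 by simp
    then have "2 < c" using \<open>real (d p0 p4) < c\<close> by simp
    have "ip p0 p0 * (2 - c) = (2 - c) * (2 - c)"
      using ip_ip_cr[of p0 p2 p4] True i d04' by simp
    then have "ip p0 p0 = 2 - c" using \<open>2 < c\<close> by auto
    then show False using ip_self_pos[OF V(1)] \<open>2 < c\<close> by simp
  next
    case False
    txt \<open>Distances from the end points are linear along \<open>p1\<close>, \<open>p2\<close>, \<open>p3\<close>, so the second
      difference is orthogonal to the vectors of \<open>p0\<close> and \<open>p4\<close>.\<close>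
    define h k where "h = f p1 - 2 * f p2 + f p3" and "k = g p1 - 2 * g p2 + g p3"
    have "f p0 * h + g p0 * k = ip p0 p1 - 2 * ip p0 p2 + ip p0 p3"
      "f p4 * h + g p4 * k = ip p1 p4 - 2 * ip p2 p4 + ip p3 p4"
      by (simp_all add: h_def k_def ip_def algebra_simps)
    then have "f p0 * h + g p0 * k = 0" "f p4 * h + g p4 * k = 0" using i by auto
    then have "h = 0 \<and> k = 0"
      using False parallel_if_same_line[of "f p0" h "g p0" k "f p4" "g p4"] by (simp add: cr_def)
    then have "f p2 * h + g p2 * k = 0" by simp
    \<comment> \<open>Pairing the vanishing second difference with y p2 yields |y p2|^2 = 1 - c,
      which is negative.\<close>
    moreover have "f p2 * h + g p2 * k = ip p1 p2 - 2 * ip p2 p2 + ip p2 p3"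
      by (simp add: h_def k_def ip_def algebra_simps)
    ultimately show False using i ip_self_pos[OF V(3)] c_gt_1 by simp
  qed
qed

text \<open>With degrees at most two, a ball of radius two has at most 1 + 2 + 2 = 5 vertices, so
  two vertices at distance three exist. The inner vertices of a shortest path between them have no
  further neighbours, so by connectedness a fifth vertex is attached to one of its ends.\<close>

lemma inconsistent: False
proof -
  obtain p0 where p0: "p0 \<in> V" using card_V by fastforce
  have "\<exists>v\<in>V. 3 \<le> d p0 v"
  proof (rule ccontr)
    assume far: "\<not> ?thesis"
    define W where "W = (\<Union>s\<in>nbrs p0. nbrs s - {p0})"
    have "V \<subseteq> {p0} \<union> nbrs p0 \<union> W"
    proof
      fix v assume v: "v \<in> V"
      show "v \<in> {p0} \<union> nbrs p0 \<union> W"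
      proof (cases "v = p0 \<or> v \<in> nbrs p0")
        case False
        have "d p0 v < 3" using v far by auto
        then have "d p0 v = 2" using False dist_ge_1[of p0 v] p0 v by (auto simp: nbrs_def)
        moreover obtain w where "w \<in> V" "d p0 w = 1" "d p0 v = d w v + 1"
          using dist_step[of p0 v] p0 v False by auto
        ultimately have "w \<in> nbrs p0" "v \<in> nbrs w" using v by (auto simp: nbrs_def)
        then show ?thesis using False by (auto simp: W_def)
      qed auto
    qed
    moreover have "card W \<le> (\<Sum>s\<in>nbrs p0. 1)"
    proof -
      have "card W \<le> (\<Sum>s\<in>nbrs p0. card (nbrs s - {p0}))"
        unfolding W_def by (rule card_UN_le) (rule finite_nbrs)
      also have "\<dots> \<le> (\<Sum>s\<in>nbrs p0. 1)"
      proof (rule sum_mono)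
        fix s assume s: "s \<in> nbrs p0"
        then have "p0 \<in> nbrs s" "s \<in> V" using nbrs_sym[OF p0] nbrs_sub by auto
        then show "card (nbrs s - {p0}) \<le> 1" using degree_le_2[of s] finite_nbrs by simp
      qed
      finally show ?thesis .
    qed
    moreover have "finite W" unfolding W_def using finite_nbrs by auto
    then have "card ({p0} \<union> nbrs p0 \<union> W) \<le> 1 + card (nbrs p0) + card W"
      using card_Un_le[of "{p0} \<union> nbrs p0" W] card_Un_le[of "{p0}" "nbrs p0"] by simp
    moreover have "finite ({p0} \<union> nbrs p0 \<union> W)" using \<open>finite W\<close> finite_nbrs by simp
    ultimately have "card V \<le> 1 + card (nbrs p0) + card (nbrs p0)"
      using card_mono[of "{p0} \<union> nbrs p0 \<union> W" V] by simp
    then show False using card_V degree_le_2[OF p0] by simp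
  qed
  then obtain v where "v \<in> V" "3 \<le> d p0 v" by blast
  then obtain q0 p3 where q0: "q0 \<in> V" and p3: "p3 \<in> V" "d q0 p3 = 3"
    using ex_dist[of p0 v 3] p0 by blast
  obtain p1 where p1: "p1 \<in> V" "d q0 p1 = 1" "d p1 p3 = 2"
    using dist_step[of q0 p3] q0 p3 dist_eq_0[of q0 p3] by fastforce
  obtain p2 where p2: "p2 \<in> V" "d p1 p2 = 1" "d p2 p3 = 1"
    using dist_step[of p1 p3] p1 p3 dist_eq_0[of p1 p3] by fastforce
  have d02: "d q0 p2 = 2"
    using dist_triangle[of q0 p1 p2] dist_triangle[of q0 p2 p3] q0 p1 p2 p3 by simp
  note sym = dist_commute[OF q0 p1(1)] dist_commute[OF p1(1) p2(1)] dist_commute[OF p2(1) p3(1)]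
    dist_commute[OF q0 p3(1)]
  have N1: "nbrs p1 = {q0, p2}"
    using nbrs_eqI[of p1 q0 p2] q0 p1 p2 d02 dist_eq_0[of q0 p2] sym by (auto simp: nbrs_def)
  have "q0 \<noteq> p2" "p1 \<noteq> p3" using d02 p1 dist_eq_0[of q0 p2] dist_eq_0[of p1 p3] q0 p2 p3 by auto
  have N2: "nbrs p2 = {p1, p3}"
    using nbrs_eqI[of p2 p1 p3] p1 p2 p3 \<open>p1 \<noteq> p3\<close> sym by (auto simp: nbrs_def)
  have "{q0, p1, p2, p3} \<noteq> V"
    using card_V card_length[of "[q0, p1, p2, p3]"] by auto
  then obtain x p4 where x: "x \<in> {q0, p1, p2, p3}" "p4 \<in> nbrs x" "p4 \<notin> {q0, p1, p2, p3}"
    using closed_set[of "{q0, p1, p2, p3}" q0] q0 p1 p2 p3 by blast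
  then consider "x = q0" | "x = p3" using N1 N2 by auto
  then show False
  proof cases
    case 1
    \<comment> \<open>The new vertex hangs at the initial end, so the path is read
      backwards.\<close>
    then show False using no_path[of p3 p2 p1 q0 p4] q0 p1 p2 p3 x sym by (auto simp: nbrs_def)
  next
    case 2
    then show False using no_path[of q0 p1 p2 p3 p4] q0 p1 p2 p3 x by (auto simp: nbrs_def)
  qed
qed

end

lemma (in planar_metric) ex_same_coordinates:
  "\<exists>u\<in>V. \<exists>v\<in>V. u \<noteq> v \<and> f u = f v \<and> g u = g v"
proof (rule ccontr)
  assume "\<not> ?thesis"
  then interpret planar_metric_inj V d c f g by unfold_locales auto
  show False by (rule inconsistent)
qed

section \<open>The six families as conditions on an adjacency relation\<close>

definition multipartite_on :: "'a set \<Rightarrow> ('a \<Rightarrow> 'a \<Rightarrow> bool) \<Rightarrow> nat list \<Rightarrow> bool" where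
  "multipartite_on V E as \<longleftrightarrow> (\<exists>l. (\<forall>v\<in>V. l v < length as) \<and>
     (\<forall>i<length as. card {v \<in> V. l v = i} = as ! i) \<and>
     (\<forall>v\<in>V. \<forall>w\<in>V. E v w \<longleftrightarrow> l v \<noteq> l w))"

text \<open>Here \<open>k\<close> is the size of the side that does not contain the additional edge.\<close>

definition bipartite_plus_edge_on :: "'a set \<Rightarrow> ('a \<Rightarrow> 'a \<Rightarrow> bool) \<Rightarrow> nat \<Rightarrow> bool" where
  "bipartite_plus_edge_on V E k \<longleftrightarrow> (\<exists>K a b. K \<subseteq> V \<and> card K = k \<and> a \<in> V - K \<and> b \<in> V - K \<and> a \<noteq> b \<and>
     (\<forall>v\<in>V. \<forall>w\<in>V. E v w \<longleftrightarrow> (v \<in> K) \<noteq> (w \<in> K) \<or> {v, w} = {a, b}))"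

definition double_cone_on :: "'a set \<Rightarrow> ('a \<Rightarrow> 'a \<Rightarrow> bool) \<Rightarrow> bool" where
  "double_cone_on V E \<longleftrightarrow> (\<exists>S \<subseteq> V. card S = 2 \<and>
     (\<forall>v\<in>V. \<forall>w\<in>V. E v w \<longleftrightarrow> v \<noteq> w \<and> (v \<in> S \<or> w \<in> S)))"

text \<open>The families are described on the vertex set itself, so that the metric argument needs
  no isomorphisms. K_1 joined with K_{m,m} appears as the complete tripartite graph with parts 1, m,
  m. The size 1 in the second line is the centre of the star, since the added edge joins two
  leaves.\<close>

definition extremal_on :: "'a set \<Rightarrow> ('a \<Rightarrow> 'a \<Rightarrow> bool) \<Rightarrow> bool" where
  "extremal_on V E \<longleftrightarrow>
     multipartite_on V E [2, card V - 2]
   \<or> bipartite_plus_edge_on V E 1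
   \<or> even (card V) \<and> bipartite_plus_edge_on V E (card V div 2)
   \<or> double_cone_on V E
   \<or> odd (card V) \<and> multipartite_on V E [1, (card V - 1) div 2, (card V - 1) div 2]
   \<or> 3 dvd card V \<and> multipartite_on V E [card V div 3, card V div 3, card V div 3]"

lemma multipartite_on_2I:
  assumes "\<And>v. l v < (2 :: nat)" "card {v \<in> V. l v = 0} = a" "card {v \<in> V. l v = 1} = b"
    "\<And>v w. v \<in> V \<Longrightarrow> w \<in> V \<Longrightarrow> E v w \<longleftrightarrow> l v \<noteq> l w"
  shows "multipartite_on V E [a, b]"
  unfolding multipartite_on_def
proof (intro exI[of _ l] conjI ballI allI impI)
  fix i assume "i < length [a, b]"
  then have "i = 0 \<or> i = 1" by auto
  then show "card {v \<in> V. l v = i} = [a, b] ! i" using assms(2,3) by auto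
next
  fix v show "l v < length [a, b]" using assms(1)[of v] by simp
qed (use assms(4) in auto)

lemma multipartite_on_3I:
  assumes "\<And>v. l v < (3 :: nat)" "card {v \<in> V. l v = 0} = a" "card {v \<in> V. l v = 1} = b"
    "card {v \<in> V. l v = 2} = c" "\<And>v w. v \<in> V \<Longrightarrow> w \<in> V \<Longrightarrow> E v w \<longleftrightarrow> l v \<noteq> l w"
  shows "multipartite_on V E [a, b, c]"
  unfolding multipartite_on_def
proof (intro exI[of _ l] conjI ballI allI impI)
  fix i assume "i < length [a, b, c]"
  then have "i = 0 \<or> i = 1 \<or> i = 2" by auto
  then show "card {v \<in> V. l v = i} = [a, b, c] ! i" using assms(2,3,4) by auto
next
  fix v show "l v < length [a, b, c]" using assms(1)[of v] by simp
qed (use assms(5) in auto)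

lemma three_products_neg:
  fixes x y z :: real
  shows "x * y < 0 \<Longrightarrow> x * z < 0 \<Longrightarrow> y * z < 0 \<Longrightarrow> False"
  by (auto simp: mult_less_0_iff)

lemma card_le_2_if_no_three:
  assumes "finite N" "\<And>x y z. x \<in> N \<Longrightarrow> y \<in> N \<Longrightarrow> z \<in> N \<Longrightarrow> x \<noteq> y \<Longrightarrow> x \<noteq> z \<Longrightarrow> y \<noteq> z \<Longrightarrow> False"
  shows "card N \<le> 2"
proof (rule ccontr)
  assume "\<not> card N \<le> 2"
  then obtain T where "T \<subseteq> N" "card T = 3"
    using obtain_subset_with_card_n[of 3 N] by auto
  then show False using assms(2) by (auto simp: card_3_iff)
qed

section \<open>The graph seen from a vertex whose vector occurs twice\<close>

locale planar_metric_twins = planar_metric +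
  fixes u u' :: 'a
  assumes u: "u \<in> V" and u': "u' \<in> V" "u \<noteq> u'" and twins: "f u = f u'" "g u = g u'"
begin

text \<open>Seen from u, a neighbour has inner product -s and a vertex at distance two has inner
  product t; \<open>X\<close> is the remaining coordinate. \<open>C\<close> collects the vertices
  with the vector of u, and \<open>B\<close> the other vertices at distance two. Since s + t = 1,
  quadratic expressions in c become linear below.\<close>

definition s :: real where "s = c - 1"
definition t :: real where "t = 2 - c"
definition X :: "'a \<Rightarrow> real" where "X = cr u"
definition C :: "'a set" where "C = {v \<in> V. f v = f u \<and> g v = g u}"
definition N :: "'a set" where "N = {v \<in> V. d u v = 1}"
definition B :: "'a set" where "B = {v \<in> V - C. d u v = 2}"

text \<open>Coincidence gives |y u|^2 = d u u' - c. This is positive, so u and u' are not adjacent;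
  a neighbour of u on a shortest path to u' has the same inner product with y u', hence is adjacent
  to u' as well, and d u u' = 2.\<close>

lemma ip_self: "ip u u = t" and t_pos: "t > 0"
proof -
  have "ip u u = ip u u'" using twins by (simp add: ip_def)
  then have q: "ip u u = real (d u u') - c" using ip_dist[OF u u'] by simp
  from dist_step[OF u u'(1,2)] obtain x where x: "x \<in> V" "d u x = 1" "d u u' = d x u' + 1" by auto
  have "x \<noteq> u'" 
  proof
    assume "x = u'"
    then have "ip u u = 1 - c" using q x by simp
    then show False using ip_self_pos[OF u] c_gt_1 by simp
  qed
  have "x \<noteq> u" using x dist_eq_0[OF u u] by auto
  have "ip u x = ip u' x" using twins by (simp add: ip_def)
  then have "d u' x = 1"
    using ip_dist[of u x] ip_dist[of u' x] u u' x \<open>x \<noteq> u'\<close> \<open>x \<noteq> u\<close> by auto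
  then have "d u u' = 2" using x dist_commute[of u' x] u' by simp
  then show "ip u u = t" using q by (simp add: t_def)
  then show "t > 0" using ip_self_pos[OF u] by simp
qed

lemma s_pos: "s > 0" and s_t: "s + t = 1"
  using c_gt_1 by (simp_all add: s_def t_def)

lemma u_in_C: "u \<in> C" and C_sub: "C \<subseteq> V" and N_sub: "N \<subseteq> V" and B_sub: "B \<subseteq> V"
  using u by (auto simp: C_def N_def B_def)

lemma finite_sets: "finite C" "finite N" "finite B"
  using finite_subset[OF _ finite_V] C_sub N_sub B_sub by auto

lemma dist_C:
  assumes "v \<in> C" "w \<in> V" "v \<noteq> w" "w \<noteq> u" shows "d v w = d u w"
proof -
  have "v \<in> V" using assms C_sub by auto
  have "ip u w = ip v w" using assms by (simp add: C_def ip_def)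
  then show ?thesis using ip_dist[OF u assms(2)] ip_dist[OF \<open>v \<in> V\<close> assms(2)] assms by auto
qed

lemma dist_u_C: "v \<in> C \<Longrightarrow> v \<noteq> u \<Longrightarrow> d u v = 2"
proof -
  assume v: "v \<in> C" "v \<noteq> u"
  have "ip u v = ip u u" using v by (simp add: C_def ip_def)
  then show ?thesis using ip_dist[of u v] u v C_sub ip_self t_def by auto
qed

lemma dist_C_C: "v \<in> C \<Longrightarrow> w \<in> C \<Longrightarrow> v \<noteq> w \<Longrightarrow> d v w = 2"
  using dist_C[of v w] dist_u_C dist_commute[of u v] u C_sub by (cases "w = u") auto

lemma X_C: "v \<in> C \<Longrightarrow> X v = 0"
  by (simp add: C_def X_def cr_def)

text \<open>At distance two the inner product with y u is 2 - c = |y u|^2, so both coordinates agree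
  with those of y u itself.\<close>

lemma X_eq_0: "v \<in> V \<Longrightarrow> d u v = 2 \<Longrightarrow> X v = 0 \<Longrightarrow> v \<in> C"
proof -
  assume v: "v \<in> V" "d u v = 2" "X v = 0"
  then have "v \<noteq> u" using dist_eq_0[OF u u] by auto
  then have "ip u v = ip u u" using ip_dist[OF u v(1)] v ip_self by (simp add: t_def)
  moreover have "cr u v = cr u u" using v by (simp add: X_def cr_def)
  ultimately have "f v = f u \<and> g v = g u" by (rule eq_if_same_coordinates[OF ip_self_pos[OF u]])
  then show ?thesis using v by (simp add: C_def)
qed

lemma X_X:
  assumes "v \<in> V" "w \<in> V" "v \<noteq> w" "v \<noteq> u" "w \<noteq> u"
  shows "X v * X w = t * (real (d v w) - c) - (real (d u v) - c) * (real (d u w) - c)"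
  using ip_ip_cr[of u v w] ip_self ip_dist[of v w] ip_dist[of u v] ip_dist[of u w] assms u
  by (simp add: X_def)

lemma not_u: "v \<in> N \<Longrightarrow> v \<noteq> u" "v \<in> B \<Longrightarrow> v \<noteq> u"
  using dist_eq_0[OF u u] by (auto simp: N_def B_def)

lemma X_B: "w \<in> B \<Longrightarrow> X w \<noteq> 0"
  using X_eq_0 by (auto simp: B_def)

text \<open>As \<open>ip u w\<close> = t = |y u|^2, the factor t splits off. The product is never
  negative, and it vanishes exactly for adjacent v and w; within \<open>B\<close>, by contrast, it
  is distance two that makes it vanish.\<close>

lemma X_N_B: "v \<in> N \<Longrightarrow> w \<in> B \<Longrightarrow> X v * X w = t * (real (d v w) - 1)"
proof -
  assume v: "v \<in> N" and w: "w \<in> B"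
  then have "v \<noteq> w" by (auto simp: N_def B_def)
  then have "X v * X w = t * (real (d v w) - c) - (1 - c) * (2 - c)"
    using X_X[of v w] v w not_u by (auto simp: N_def B_def)
  then show ?thesis by (simp add: t_def algebra_simps)
qed

lemma X_B_B: "v \<in> B \<Longrightarrow> w \<in> B \<Longrightarrow> v \<noteq> w \<Longrightarrow> X v * X w = t * (real (d v w) - 2)"
  using X_X[of v w] not_u by (auto simp: B_def t_def algebra_simps)

text \<open>On a shortest path u, z, x, w the adjacent vertices z in \<open>N\<close> and x in
  \<open>B\<close> force X z = 0, because X x is nonzero. The formula for X z X w then reads t (d z
  w - 1) + s = 0, although its left side is positive.\<close>

lemma dist_u_le_2:
  assumes "v \<in> V" shows "d u v \<le> 2"
proof (rule ccontr)
  assume "\<not> ?thesis"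
  moreover have "d v u = d u v" using dist_commute u assms by simp
  ultimately obtain w where w: "w \<in> V" "d w u = 3" using ex_dist[of v u 3] u assms by auto
  then have "w \<noteq> u" using dist_eq_0[OF u u] by auto
  from dist_step[OF w(1) u this] obtain x where x: "x \<in> V" "d w x = 1" "d x u = 2"
    using w by auto
  then have "x \<noteq> u" using dist_eq_0[OF u u] by auto
  from dist_step[OF x(1) u this] obtain z where z: "z \<in> V" "d x z = 1" "d z u = 1"
    using x by auto
  have "z \<noteq> u" using z dist_eq_0[OF u u] by auto
  have sym: "d u w = 3" "d u x = 2" "d u z = 1" "d z x = 1" "d x w = 1"
    using dist_commute u w x z by auto
  have "x \<noteq> w" using sym by auto
  then have "x \<notin> C" using dist_C[of x w] w \<open>w \<noteq> u\<close> sym by auto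
  then have "x \<in> B" "z \<in> N" using x z sym by (auto simp: B_def N_def)
  then have "X z = 0" using X_N_B[of z x] X_B[of x] sym by simp
  moreover have "z \<noteq> w" using sym by auto
  then have "X z * X w = t * (real (d z w) - c) - (1 - c) * (3 - c)"
    using X_X[of z w] w z \<open>w \<noteq> u\<close> \<open>z \<noteq> u\<close> sym by simp
  ultimately have "t * (real (d z w) - 1) + s = 0" by (simp add: t_def s_def algebra_simps)
  moreover have "0 \<le> t * (real (d z w) - 1)"
    using dist_ge_1[of z w] \<open>z \<noteq> w\<close> w z t_pos by simp
  ultimately show False using s_pos by simp
qed

lemma V_cases: "v \<in> V \<Longrightarrow> v \<in> C \<or> v \<in> N \<or> v \<in> B"
proof -
  assume v: "v \<in> V"
  have "d u v = 1 \<or> d u v = 2" if "v \<noteq> u"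
    using dist_u_le_2[OF v] dist_ge_1[OF u v] that by force
  then consider "v = u" | "d u v = 1" | "d u v = 2" by blast
  then show ?thesis using v u_in_C by cases (auto simp: B_def N_def)
qed

lemma disjoint: "C \<inter> N = {}" "C \<inter> B = {}" "N \<inter> B = {}"
proof -
  have "d u v \<noteq> 1" if "v \<in> C" for v
    using dist_u_C[OF that] dist_eq_0[OF u u] by (cases "v = u") auto
  then show "C \<inter> N = {}" "C \<inter> B = {}" "N \<inter> B = {}" by (auto simp: N_def B_def)
qed

lemma V_eq: "V = C \<union> N \<union> B"
  using V_cases C_sub N_sub B_sub by auto

lemma sum_V: "(\<Sum>v\<in>V. h v) = (\<Sum>v\<in>C. h v) + (\<Sum>v\<in>N. h v) + (\<Sum>v\<in>B. h v)" for h :: "'a \<Rightarrow> real"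
proof -
  have "(\<Sum>v\<in>C \<union> N \<union> B. h v) = (\<Sum>v\<in>C \<union> N. h v) + (\<Sum>v\<in>B. h v)"
    using finite_sets disjoint by (intro sum.union_disjoint) auto
  then show ?thesis using V_eq finite_sets disjoint by (simp add: sum.union_disjoint)
qed

lemma sum_X: "(\<Sum>v\<in>N. X v) + (\<Sum>v\<in>B. X v) = 0"
  using sum_cr[of u] sum_V[of X] X_C by (simp add: X_def)

text \<open>The zero sum in the direction of y u. It turns information about c into information
  about part sizes.\<close>

lemma card_eq: "real (card C + card B) * t = real (card N) * s"
proof -
  have "ip u v = t" if "v \<in> C" for v using that ip_self by (simp add: C_def ip_def)
  moreover have "ip u v = t" if "v \<in> B" for v
    using that ip_dist[of u v] u not_u by (auto simp: B_def t_def)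
  moreover have "ip u v = - s" if "v \<in> N" for v
    using that ip_dist[of u v] u not_u by (auto simp: N_def s_def)
  ultimately show ?thesis using sum_V[of "ip u"] sum_ip[of u] by (simp add: algebra_simps)
qed

lemma card_V_eq: "card V = card C + card N + card B"
proof -
  have "card (C \<union> N \<union> B) = card (C \<union> N) + card B"
    using finite_sets disjoint by (intro card_Un_disjoint) auto
  then show ?thesis using finite_sets disjoint by (simp add: card_Un_disjoint flip: V_eq)
qed

lemma card_C: "card C \<ge> 2"
proof -
  have "{u, u'} \<subseteq> C" using u u' twins by (auto simp: C_def)
  then have "card {u, u'} \<le> card C" by (rule card_mono[OF finite_sets(1)])
  then show ?thesis using u' by simp
qed

lemma X_nonzero: "\<exists>v\<in>V. X v \<noteq> 0"
proof (rule ccontr)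
  assume 0: "\<not> ?thesis"
  obtain v w where "v \<in> V" "w \<in> V" "cr v w \<noteq> 0" using spanning by (auto simp: cr_def)
  then show False using 0 ip_cr[of u v w] ip_self t_pos by (simp add: X_def)
qed

lemma dist_C_N: "v \<in> C \<Longrightarrow> w \<in> N \<Longrightarrow> d v w = 1"
  using dist_C[of v w] disjoint not_u(1)[of w] N_sub by (auto simp: N_def)

lemma dist_C_B: "v \<in> C \<Longrightarrow> w \<in> B \<Longrightarrow> d v w = 2"
  using dist_C[of v w] disjoint not_u(2)[of w] B_sub by (auto simp: B_def)

text \<open>The raw values are -st - s^2 and t^2 - s^2; the relation s + t = 1 reduces them to -s
  and t - s. The sign of t - s decides which family arises when \<open>B\<close> is empty.\<close>

lemma N_N:
  assumes "v \<in> N" "w \<in> N" "v \<noteq> w"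
  shows "d v w = 1 \<and> X v * X w = - s \<or> d v w = 2 \<and> X v * X w = t - s"
proof -
  have V: "v \<in> V" "w \<in> V" using assms N_sub by auto
  have "d v w \<le> 2"
    using dist_triangle[of v u w] dist_commute[of u v] assms u V by (auto simp: N_def)
  then have "d v w = 1 \<or> d v w = 2" using dist_ge_1[OF V assms(3)] by auto
  moreover have "X v * X w = t * (real (d v w) - c) - s * s"
    using X_X[of v w] assms not_u V by (auto simp: N_def s_def algebra_simps)
  moreover have "t * (1 - c) - s * s = - s * (s + t)" "t * t - s * s = (s + t) * (t - s)"
    by (simp_all add: s_def algebra_simps)
  then have "t * (1 - c) - s * s = - s" "t * (2 - c) - s * s = t - s"
    unfolding s_t by (simp_all add: t_def)
  ultimately show ?thesis by auto
qed

lemma C_independent: "v \<in> C \<Longrightarrow> w \<in> C \<Longrightarrow> d v w \<noteq> 1"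
  using dist_C_C[of v w] dist_eq_0[of v v] C_sub by (cases "v = w") auto

text \<open>This case yields the star or the balanced bipartite graph with an added edge, where the
  edge lies on the side that contains u: the sides are \<open>N\<close> and the union of
  \<open>C\<close> and \<open>B\<close>, and \<open>B\<close> consists of the ends of the
  edge.\<close>

lemma extremal_if_B_nonempty:
  assumes "B \<noteq> {}"
  shows "extremal_on V (\<lambda>v w. d v w = 1)"
proof -
  obtain b where b: "b \<in> B" using assms by auto
  have N0: "0 \<le> X b * X v" if "v \<in> N" "b \<in> B" for v b
  proof -
    have "v \<noteq> b" "v \<in> V" "b \<in> V" using that disjoint N_sub B_sub by auto
    then have "1 \<le> d v b" using dist_ge_1 by blast
    then show ?thesis using X_N_B[of v b] that t_pos by (simp add: mult.commute)
  qed
  \<comment> \<open>After multiplying the zero sum by X b, the contributions of \<open>N\<close> are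
    nonnegative and that of b is positive, so some other vertex of \<open>B\<close> has the opposite
    sign.\<close>
  have "X b * ((\<Sum>v\<in>N. X v) + (\<Sum>v\<in>B. X v)) = 0" using sum_X by simp
  then have "(\<Sum>v\<in>N. X b * X v) + (\<Sum>v\<in>B. X b * X v) = 0"
    by (simp add: sum_distrib_left distrib_left)
  moreover have "0 \<le> (\<Sum>v\<in>N. X b * X v)" using N0[OF _ b] by (intro sum_nonneg) auto
  moreover have "(\<Sum>v\<in>B. X b * X v) = X b * X b + (\<Sum>v\<in>B - {b}. X b * X v)"
    using b finite_sets by (simp add: sum.remove)
  moreover have "0 < X b * X b" using X_B[OF b] by (simp add: zero_less_mult_iff) linarith
  ultimately have "(\<Sum>v\<in>B - {b}. X b * X v) < 0" by linarith
  then obtain a where a: "a \<in> B" "a \<noteq> b" "X b * X a < 0"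
    by (metis DiffE insertI1 linorder_not_le sum_nonneg)
  \<comment> \<open>X v must not have the sign opposite to X a or to X b, and these two have
    different signs.\<close>
  have XN: "X v = 0" if "v \<in> N" for v
    using N0[OF that b] N0[OF that a(1)] a(3)
    by (auto simp: zero_le_mult_iff mult_less_0_iff)
  have NB: "d v w = 1" if "v \<in> N" "w \<in> B" for v w
    using X_N_B[OF that] XN[OF that(1)] t_pos by simp
  have "N \<noteq> {}"
  proof
    assume "N = {}"
    then show False using card_eq t_pos card_C by simp
  qed
  then obtain x where x: "x \<in> N" by auto
  \<comment> \<open>A common neighbour in \<open>N\<close> bounds the distance by 2. Distance two
    would make the product zero, which \<open>X_B\<close> excludes. Pairwise negative products then
    limit \<open>B\<close> to two vertices.\<close>
  have B2: "X v * X w < 0 \<and> d v w = 1" if vw: "v \<in> B" "w \<in> B" "v \<noteq> w" for v w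
  proof -
    have V: "v \<in> V" "w \<in> V" "x \<in> V" using that x B_sub N_sub by auto
    have "d v w \<le> 2"
      using dist_triangle[of v x w] NB[OF x vw(1)] NB[OF x vw(2)] dist_commute[of v x] V by simp
    moreover have "X v * X w \<noteq> 0" using X_B vw by simp
    ultimately have "d v w = 1" using X_B_B[OF vw] dist_ge_1[of v w] V vw(3) by (cases "d v w = 2") auto
    then show ?thesis using X_B_B[OF vw] t_pos by simp
  qed
  have "card B \<le> 2"
    using card_le_2_if_no_three[OF finite_sets(3)] B2 three_products_neg by metis
  then have "B = {a, b}"
    using card_seteq[of B "{a, b}"] a b finite_sets by simp
  have NN: "d v w = 2 \<and> t = s" if "v \<in> N" "w \<in> N" "v \<noteq> w" for v w
    using N_N[OF that] XN[OF that(1)] s_pos by auto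
  have N_ind: "d v w \<noteq> 1" if "v \<in> N" "w \<in> N" for v w
    using NN[OF that] dist_eq_0[of v v] that N_sub by (cases "v = w") auto
  have adj: "d v w = 1 \<longleftrightarrow> (v \<in> N) \<noteq> (w \<in> N) \<or> {v, w} = {a, b}" if vw: "v \<in> V" "w \<in> V" for v w
  proof -
    have ab: "a \<notin> N" "b \<notin> N" "a \<notin> C" "b \<notin> C" "a \<in> V" "b \<in> V" using a b disjoint B_sub by auto
    consider "v \<in> C" "w \<in> C" | "v \<in> C" "w \<in> N" | "v \<in> N" "w \<in> C" | "v \<in> C" "w \<in> B" | "v \<in> B" "w \<in> C"
      | "v \<in> N" "w \<in> N" | "v \<in> N" "w \<in> B" | "v \<in> B" "w \<in> N" | "v \<in> B" "w \<in> B"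
      using V_cases[OF vw(1)] V_cases[OF vw(2)] by blast
    then show ?thesis
    proof cases
      case 9
      then show ?thesis using \<open>B = {a, b}\<close> ab B2[of v w] dist_eq_0[of v v] vw a(2)
        by (cases "v = w") (auto simp: doubleton_eq_iff)
    qed (use C_independent dist_C_N dist_C_B NB N_ind dist_commute[OF vw] disjoint ab
        in \<open>auto simp: doubleton_eq_iff\<close>)
  qed
  have bip: "bipartite_plus_edge_on V (\<lambda>v w. d v w = 1) (card N)"
    unfolding bipartite_plus_edge_on_def
    using adj a b disjoint N_sub B_sub by (intro exI[of _ N] exI[of _ a] exI[of _ b]) auto
  have "card N \<noteq> 0" using \<open>N \<noteq> {}\<close> finite_sets by simp
  then consider "card N = 1" | "card N \<ge> 2" by linarith
  then show ?thesis
  proof cases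
    case 1
    then show ?thesis using bip by (simp add: extremal_on_def)
  next
    case 2
    then obtain T where "T \<subseteq> N" "card T = 2"
      using obtain_subset_with_card_n by metis
    \<comment> \<open>Two vertices of \<open>N\<close> have product 0 at distance two, so t - s = 0
      and \<open>card_eq\<close> balances the sides. A single vertex in \<open>N\<close> imposes no
      such condition and gives the star.\<close>
    then have "t = s" using NN by (auto simp: card_2_iff)
    then have "card C + card B = card N" using card_eq t_pos by simp
    then have "card V = 2 * card N" using card_V_eq by simp
    then have "even (card V)" "card N = card V div 2" by simp_all
    then show ?thesis using bip by (simp add: extremal_on_def)
  qed
qed

text \<open>Now the graph is the join of the independent set \<open>C\<close> with the graph on
  \<open>N\<close>, so only the latter has to be found. The numbers X v on \<open>N\<close> sum to
  zero without all vanishing, and their pairwise products are -s or t - s.\<close>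

lemma extremal_if_B_empty:
  assumes "B = {}"
  shows "extremal_on V (\<lambda>v w. d v w = 1)"
proof -
  have sumX: "(\<Sum>v\<in>N. X v) = 0" using sum_X assms by simp
  have V_CN: "V = C \<union> N" "card V = card C + card N" using V_eq card_V_eq assms by auto
  have cards: "real (card C) * t = real (card N) * s" using card_eq assms by simp
  obtain v0 where v0: "v0 \<in> N" "X v0 \<noteq> 0" using X_nonzero X_C V_CN by auto
  have ex: "\<exists>v\<in>N. X v > 0" "\<exists>v\<in>N. X v < 0"
  proof -
    show "\<exists>v\<in>N. X v > 0"
    proof (rule ccontr)
      assume "\<not> ?thesis"
      then have "(\<Sum>v\<in>N. - X v) = 0 \<longleftrightarrow> (\<forall>v\<in>N. - X v = 0)"
        using finite_sets by (intro sum_nonneg_eq_0_iff) auto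
      then show False using sumX v0 by (simp add: sum_negf)
    qed
    show "\<exists>v\<in>N. X v < 0"
    proof (rule ccontr)
      assume "\<not> ?thesis"
      then have "(\<Sum>v\<in>N. X v) = 0 \<longleftrightarrow> (\<forall>v\<in>N. X v = 0)"
        using finite_sets by (intro sum_nonneg_eq_0_iff) auto
      then show False using sumX v0 by simp
    qed
  qed
  then obtain a b where ab: "a \<in> N" "b \<in> N" "X a > 0" "X b < 0" by blast
  have "a \<noteq> b" using ab by auto
  have CN: "d v w = 1 \<longleftrightarrow> (v \<in> C) \<noteq> (w \<in> C)" if "v \<in> V" "w \<in> V" "v \<in> C \<or> w \<in> C" for v w
    using that C_independent dist_C_N[of v w] dist_C_N[of w v] dist_commute[OF that(1,2)] V_CN disjoint
    by auto
  have NV: "v \<in> N \<longleftrightarrow> v \<notin> C" if "v \<in> V" for v using that V_CN disjoint by auto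
  consider "t < s" | "t = s" | "t > s" by linarith
  then show ?thesis
  proof cases
    case 1
    \<comment> \<open>Both admissible values are negative, so \<open>N\<close> has only the two
      vertices a and b. Adjacent or not, they give the double cone and K_{2,n-2}
      respectively.\<close>
    have neg: "X v * X w < 0" if "v \<in> N" "w \<in> N" "v \<noteq> w" for v w
      using N_N[OF that] 1 s_pos by auto
    have "card N \<le> 2"
      using card_le_2_if_no_three[OF finite_sets(2)] neg three_products_neg by metis
    then have N: "N = {a, b}" using card_seteq[of N "{a, b}"] ab \<open>a \<noteq> b\<close> finite_sets by simp
    then have card_N: "card N = 2" using \<open>a \<noteq> b\<close> by simp
    show ?thesis
    proof (cases "d a b = 1")
      case True
      have "d v w = 1 \<longleftrightarrow> v \<noteq> w \<and> (v \<in> N \<or> w \<in> N)" if "v \<in> V" "w \<in> V" for v w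
      proof (cases "v \<in> C \<or> w \<in> C")
        case False
        then have "v \<in> N" "w \<in> N" using NV that by auto
        then show ?thesis using N that True dist_commute[of a b] dist_eq_0[of v v] by auto
      qed (use CN[OF that] NV that in auto)
      then have "double_cone_on V (\<lambda>v w. d v w = 1)"
        unfolding double_cone_on_def using N_sub card_N by blast
      then show ?thesis by (simp add: extremal_on_def)
    next
      case False
      have adj: "d v w = 1 \<longleftrightarrow> (v \<in> C) \<noteq> (w \<in> C)" if "v \<in> V" "w \<in> V" for v w
      proof (cases "v \<in> C \<or> w \<in> C")
        case F: False
        then have "v \<in> N" "w \<in> N" using NV that by auto
        then have "d v w \<noteq> 1"
          using N that False dist_commute[of a b] dist_eq_0[of v v] by auto
        then show ?thesis using F by simp
      qed (use CN[OF that] in auto)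
      define l where "l v = (if v \<in> C then 1 else 0 :: nat)" for v
      have "{v \<in> V. l v = 0} = N" "{v \<in> V. l v = 1} = C" using NV N_sub C_sub by (auto simp: l_def)
      moreover have "d v w = 1 \<longleftrightarrow> l v \<noteq> l w" if "v \<in> V" "w \<in> V" for v w
        using adj[OF that] by (simp add: l_def)
      moreover have "\<And>v. l v < 2" by (simp add: l_def)
      ultimately have "multipartite_on V (\<lambda>v w. d v w = 1) [2, card V - 2]"
        using card_N V_CN(2) by (intro multipartite_on_2I[of l]) auto
      then show ?thesis by (simp add: extremal_on_def)
    qed
  next
    case 2
    have nn: "X v * X w \<le> 0" if "v \<in> N" "w \<in> N" "v \<noteq> w" for v w
      using N_N[OF that] 2 s_pos by auto
    have "X a * X b < 0" using ab by (simp add: mult_pos_neg)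
    then have dab: "d a b = 1" using N_N[OF ab(1,2)] \<open>a \<noteq> b\<close> 2 by auto
    \<comment> \<open>For t = s no product is positive, so a third vertex fits neither sign; as the
      product of an adjacent pair is -s, the edge ab is the only one inside
      \<open>N\<close>.\<close>
    have zero: "X v = 0" if v: "v \<in> N" "v \<noteq> a" "v \<noteq> b" for v
      using nn[OF v(1) ab(1)] nn[OF v(1) ab(2)] v ab by (auto simp: mult_le_0_iff)
    have NN: "d v w = 1 \<longleftrightarrow> {v, w} = {a, b}" if "v \<in> N" "w \<in> N" for v w
    proof (cases "v = w")
      case True
      then show ?thesis using dist_eq_0[of v v] that N_sub \<open>a \<noteq> b\<close> by (auto simp: doubleton_eq_iff)
    next
      case False
      show ?thesis
      proof (cases "X v * X w = 0")
        case True
        then have "d v w \<noteq> 1" using N_N[OF that False] s_pos by auto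
        then show ?thesis using True ab by (auto simp: doubleton_eq_iff)
      next
        case nz: False
        then have "v \<in> {a, b}" "w \<in> {a, b}" using zero that by auto
        moreover have "d b a = 1"
          using dab dist_commute[OF subsetD[OF N_sub ab(1)] subsetD[OF N_sub ab(2)]] by simp
        ultimately show ?thesis using False dab by auto
      qed
    qed
    have "a \<notin> C" "b \<notin> C" using ab disjoint by auto
    have "d v w = 1 \<longleftrightarrow> (v \<in> C) \<noteq> (w \<in> C) \<or> {v, w} = {a, b}" if "v \<in> V" "w \<in> V" for v w
    proof (cases "v \<in> C \<or> w \<in> C")
      case True
      then show ?thesis using CN[OF that] \<open>a \<notin> C\<close> \<open>b \<notin> C\<close> by (auto simp: doubleton_eq_iff)
    next
      case False
      then show ?thesis using NN[of v w] NV that by auto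
    qed
    then have "bipartite_plus_edge_on V (\<lambda>v w. d v w = 1) (card C)"
      unfolding bipartite_plus_edge_on_def
      using ab \<open>a \<noteq> b\<close> \<open>a \<notin> C\<close> \<open>b \<notin> C\<close> C_sub N_sub
      by (intro exI[of _ C] exI[of _ a] exI[of _ b]) auto
    moreover have "card C = card N" using cards 2 t_pos by simp
    ultimately show ?thesis using V_CN(2) by (simp add: extremal_on_def)
  next
    case 3
    \<comment> \<open>For t > s the sign of the product decides adjacency, so the signs of X split
      \<open>N\<close> into two independent sets that are completely joined.\<close>
    define P Q where "P = {v \<in> N. X v > 0}" and "Q = {v \<in> N. X v < 0}"
    have nz: "X v \<noteq> 0" if "v \<in> N" for v
    proof
      assume "X v = 0"
      then have "v \<noteq> a" using ab by auto
      then show False using N_N[OF that ab(1)] \<open>X v = 0\<close> 3 s_pos by auto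
    qed
    have N_PQ: "N = P \<union> Q" "P \<inter> Q = {}" using nz by (auto simp: P_def Q_def not_less_iff_gr_or_eq)
    have fin: "finite P" "finite Q" using finite_sets by (auto simp: P_def Q_def)
    have PQ: "X v * X w = - s \<and> d v w = 1" if "v \<in> P" "w \<in> Q" for v w
    proof -
      have "X v * X w < 0" using that by (auto simp: P_def Q_def mult_pos_neg)
      moreover have "v \<noteq> w" using that by (auto simp: P_def Q_def)
      ultimately show ?thesis using N_N[of v w] that 3 by (auto simp: P_def Q_def)
    qed
    have same: "X v * X w = t - s \<and> d v w = 2" if "v \<in> P \<and> w \<in> P \<or> v \<in> Q \<and> w \<in> Q" "v \<noteq> w" for v w
    proof -
      have "X v * X w > 0" using that by (auto simp: P_def Q_def mult_neg_neg)
      then show ?thesis using N_N[of v w] that s_pos by (auto simp: P_def Q_def)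
    qed
    have card_N: "card N = card P + card Q" using N_PQ fin by (simp add: card_Un_disjoint)
    have "a \<in> P" "b \<in> Q" using ab by (auto simp: P_def Q_def)
    then have pos: "card P > 0" "card Q > 0" using fin by (auto simp: card_gt_0_iff)
    \<comment> \<open>With two vertices in A, the constant products with A' make X constant on A,
      with square t - s. The zero sum then gives |A| (t - s) = |A'| s, and \<open>card_eq\<close>
      turns this into |A| = |C|. A one-element part has no such square to compute and remains
      unconstrained.\<close>
    have part: "card A = card C"
      if A: "2 \<le> card A" "A = P \<and> A' = Q \<or> A = Q \<and> A' = P" for A A'
    proof -
      obtain T where T: "T \<subseteq> A" "card T = 2"
        using A(1) obtain_subset_with_card_n by metis
      then obtain p q where pq: "p \<in> A" "q \<in> A" "p \<noteq> q" by (auto simp: card_2_iff)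
      obtain r where r: "r \<in> A'" using A \<open>a \<in> P\<close> \<open>b \<in> Q\<close> by auto
      have cross: "X v * X w = - s" if "v \<in> A" "w \<in> A'" for v w
        using that A PQ[of v w] PQ[of w v] by (auto simp: mult.commute)
      have "X p * X r = X q * X r" using cross pq r by simp
      moreover have "X r \<noteq> 0" using r A nz N_PQ by auto
      ultimately have "X p = X q" by simp
      then have pp: "X p * X p = t - s" using same[of p q] pq A by auto
      have finA: "finite A" "finite A'" using fin A by auto
      have "0 = X p * (\<Sum>v\<in>N. X v)" using sumX by simp
      also have "(\<Sum>v\<in>N. X v) = (\<Sum>v\<in>A. X v) + (\<Sum>v\<in>A'. X v)"
        using N_PQ A fin by (auto simp: sum.union_disjoint)
      also have "X p * \<dots> = (\<Sum>v\<in>A. X p * X v) + (\<Sum>v\<in>A'. X p * X v)"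
        by (simp add: sum_distrib_left distrib_left)
      also have "(\<Sum>v\<in>A. X p * X v) = (\<Sum>v\<in>A. t - s)"
        using pp same[of p] pq A by (intro sum.cong) auto
      also have "(\<Sum>v\<in>A'. X p * X v) = (\<Sum>v\<in>A'. - s)"
        using cross pq by (intro sum.cong) auto
      finally have "real (card A) * (t - s) = real (card A') * s" by simp
      moreover have "card N = card A + card A'" using card_N A by auto
      ultimately have "real (card C) * t = real (card A) * t"
        using cards by (simp add: algebra_simps)
      then show ?thesis using t_pos by simp
    qed
    define l where "l v = (if v \<in> C then 0 else if v \<in> P then 1 else 2 :: nat)" for v
    have adj: "d v w = 1 \<longleftrightarrow> l v \<noteq> l w" if "v \<in> V" "w \<in> V" for v w
    proof (cases "v \<in> C \<or> w \<in> C")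
      case True
      then show ?thesis using CN[OF that] by (auto simp: l_def)
    next
      case False
      then have "v \<in> P \<union> Q" "w \<in> P \<union> Q" using NV that N_PQ by auto
      then show ?thesis
        using False N_PQ(2) PQ[of v w] PQ[of w v] same[of v w] dist_commute[OF that] dist_eq_0[of v v] that
        by (cases "v = w") (auto simp: l_def)
    qed
    have classes: "{v \<in> V. l v = 0} = C" "{v \<in> V. l v = 1} = P" "{v \<in> V. l v = 2} = Q"
      using V_CN N_PQ disjoint by (auto simp: l_def)
    have sizes: "card V = card C + card P + card Q" using V_CN card_N by simp
    \<comment> \<open>Two singletons would give |C| t = 2 s, whereas |C| is at least 2 and t >
      s.\<close>
    have not_both: "\<not> (card P = 1 \<and> card Q = 1)"
    proof
      assume "card P = 1 \<and> card Q = 1"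
      then have "real (card C) * t = 2 * s" using cards card_N by simp
      moreover have "2 * t \<le> real (card C) * t" using card_C t_pos by (intro mult_right_mono) auto
      ultimately show False using 3 by simp
    qed
    consider "card P \<ge> 2" "card Q \<ge> 2" | "card P \<ge> 2" "card Q = 1" | "card P = 1" "card Q \<ge> 2"
      using pos not_both by linarith
    then show ?thesis
    proof cases
      case 1
      then have "card P = card C" "card Q = card C" using part by auto
      then have "multipartite_on V (\<lambda>v w. d v w = 1) [card V div 3, card V div 3, card V div 3]"
        using adj classes sizes by (intro multipartite_on_3I[of l]) (auto simp: l_def)
      moreover have "card V = 3 * card C" using sizes \<open>card P = card C\<close> \<open>card Q = card C\<close> by simp
      then have "3 dvd card V" by simp
      ultimately show ?thesis by (simp add: extremal_on_def)
    next
      case 2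
      then have PC: "card P = card C" using part by auto
      \<comment> \<open>The reversed labels put the one-element class \<open>Q\<close> first, as the
        list of part sizes demands.\<close>
      define l' where "l' v = 2 - l v" for v
      have l: "l v \<le> 2" for v by (simp add: l_def)
      have "l' v = l' w \<longleftrightarrow> l v = l w" for v w using l[of v] l[of w] unfolding l'_def by linarith
      moreover have "\<And>v. l' v < 3" by (simp add: l'_def)
      moreover have "{v \<in> V. l' v = 0} = Q" "{v \<in> V. l' v = 1} = P" "{v \<in> V. l' v = 2} = C"
        using V_CN N_PQ disjoint by (auto simp: l_def l'_def)
      ultimately have "multipartite_on V (\<lambda>v w. d v w = 1) [1, (card V - 1) div 2, (card V - 1) div 2]"
        using adj sizes 2 PC \<open>\<And>v. l' v < 3\<close> by (intro multipartite_on_3I[of l']) auto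
      moreover have "odd (card V)" using sizes 2 PC by simp
      ultimately show ?thesis by (simp add: extremal_on_def)
    next
      case 3
      then have QC: "card Q = card C" using part by auto
      define l' where "l' v = (if l v = 0 then 1 else if l v = 1 then 0 else 2 :: nat)" for v
      have l: "l v \<le> 2" for v by (simp add: l_def)
      have "l' v = l' w \<longleftrightarrow> l v = l w" for v w using l[of v] l[of w] unfolding l'_def by auto
      moreover have "\<And>v. l' v < 3" by (simp add: l'_def)
      moreover have "{v \<in> V. l' v = 0} = P" "{v \<in> V. l' v = 1} = C" "{v \<in> V. l' v = 2} = Q"
        using V_CN N_PQ disjoint by (auto simp: l_def l'_def)
      ultimately have "multipartite_on V (\<lambda>v w. d v w = 1) [1, (card V - 1) div 2, (card V - 1) div 2]"
        using adj sizes 3 QC \<open>\<And>v. l' v < 3\<close> by (intro multipartite_on_3I[of l']) auto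
      moreover have "odd (card V)" using sizes 3 QC by simp
      ultimately show ?thesis by (simp add: extremal_on_def)
    qed
  qed
qed

end

theorem (in planar_metric) extremal: "extremal_on V (\<lambda>v w. d v w = 1)"
proof -
  obtain u u' where "u \<in> V" "u' \<in> V" "u \<noteq> u'" "f u = f u'" "g u = g u'"
    using ex_same_coordinates by blast
  then interpret planar_metric_twins V d c f g u u' by unfold_locales
  show ?thesis using extremal_if_B_empty extremal_if_B_nonempty by blast
qed

section \<open>Spectral decomposition of real symmetric matrices\<close>

lemma order_prod_linear_factors:
  fixes e :: "'b \<Rightarrow> real"
  assumes "finite K"
  shows "order x (\<Prod>k\<in>K. [:- e k, 1:]) = card {k \<in> K. e k = x}"
  using assms
proof (induction K rule: finite_induct)
  case (insert k K)
  have "(\<Prod>k\<in>K. [:- e k, 1:]) \<noteq> 0" using insert by simp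
  then have "[:- e k, 1:] * (\<Prod>k\<in>K. [:- e k, 1:]) \<noteq> 0"
    by (simp only: mult_eq_0_iff) simp
  then have "order x ([:- e k, 1:] * (\<Prod>k\<in>K. [:- e k, 1:])) =
      order x [:- e k, 1:] + card {k \<in> K. e k = x}"
    using insert by (subst order_mult) simp_all
  moreover have "order x [:- e k, 1:] = (if e k = x then 1 else 0)"
    using order_power_n_n[of "e k" 1] order_0I[of "[:- e k, 1:]" x] by auto
  moreover have "{j \<in> insert k K. e j = x} = (if e k = x then insert k {j \<in> K. e j = x} else {j \<in> K. e j = x})"
    by auto
  ultimately show ?case using insert by auto
qed simp

text \<open>For a complex eigenvector v, the Hermitian form S equals its own conjugate because A is
  real and symmetric, and it is also a times |v|^2. So a is real and a root of the real
  characteristic polynomial.\<close>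

lemma real_symmetric_eigenvalue:
  fixes A :: "real mat"
  assumes A: "A \<in> carrier_mat n n" and sym: "A\<^sup>T = A" and n: "n > 0"
  shows "\<exists>e. eigenvalue A e"
proof -
  define B :: "complex mat" where "B = map_mat of_real A"
  have B: "B \<in> carrier_mat n n" using A by (simp add: B_def)
  obtain a where "eigenvalue B a"
    using spectrum_non_empty[OF B n] by (auto simp: spectrum_def)
  then obtain v where v: "v \<in> carrier_vec n" "v \<noteq> 0\<^sub>v n" "B *\<^sub>v v = a \<cdot>\<^sub>v v"
    using B by (auto simp: eigenvalue_def eigenvector_def)
  have Bv: "(\<Sum>j<n. of_real (A $$ (i, j)) * v $ j) = a * v $ i" if "i < n" for i
  proof -
    have "(B *\<^sub>v v) $ i = (\<Sum>j<n. of_real (A $$ (i, j)) * v $ j)"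
      using that A B v(1) by (auto simp: scalar_prod_def B_def lessThan_atLeast0 intro!: sum.cong)
    then show ?thesis using v that by simp
  qed
  define S where "S = (\<Sum>i<n. \<Sum>j<n. of_real (A $$ (i, j)) * v $ j * cnj (v $ i))"
  have "cnj S = (\<Sum>i<n. \<Sum>j<n. of_real (A $$ (i, j)) * cnj (v $ j) * v $ i)"
    by (simp add: S_def)
  also have "\<dots> = (\<Sum>j<n. \<Sum>i<n. of_real (A $$ (i, j)) * cnj (v $ j) * v $ i)"
    by (rule sum.swap)
  also have "\<dots> = S"
    unfolding S_def
  proof (intro sum.cong refl)
    fix i j assume "i \<in> {..<n}" "j \<in> {..<n}"
    then have "A $$ (j, i) = A $$ (i, j)" using sym A index_transpose_mat(1)[of i A j] by auto
    then show "of_real (A $$ (j, i)) * cnj (v $ i) * v $ j = of_real (A $$ (i, j)) * v $ j * cnj (v $ i)"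
      by simp
  qed
  finally have S_real: "cnj S = S" .
  define q where "q = (\<Sum>i<n. (norm (v $ i))\<^sup>2)"
  have "S = (\<Sum>i<n. (\<Sum>j<n. of_real (A $$ (i, j)) * v $ j) * cnj (v $ i))"
    by (simp add: S_def sum_distrib_right)
  also have "\<dots> = (\<Sum>i<n. a * (v $ i * cnj (v $ i)))"
    using Bv by (intro sum.cong) (auto simp: mult.assoc)
  also have "\<dots> = a * of_real q"
    by (simp add: q_def sum_distrib_left complex_norm_square del: of_real_power)
  finally have "S = a * of_real q" .
  moreover have "q \<noteq> 0"
  proof
    assume "q = 0"
    then have "\<forall>i<n. v $ i = 0" by (auto simp: q_def sum_nonneg_eq_0_iff)
    then have "v = 0\<^sub>v n" using v(1) by (intro eq_vecI) auto
    then show False using v(2) by simp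
  qed
  ultimately have "cnj a = a" using S_real by simp
  then have a: "a = of_real (Re a)" by (simp add: complex_eq_iff)
  have "poly (char_poly B) a = 0" using \<open>eigenvalue B a\<close> eigenvalue_root_char_poly[OF B] by simp
  moreover have "char_poly B = map_poly complex_of_real (char_poly A)"
    unfolding B_def by (rule of_real_hom.char_poly_hom[OF A])
  ultimately have "poly (map_poly complex_of_real (char_poly A)) (complex_of_real (Re a)) = 0"
    using a by metis
  then have "poly (char_poly A) (Re a) = 0" by simp
  then show ?thesis using eigenvalue_root_char_poly[OF A] by blast
qed

lemma conjugate_real_vec: "conjugate (v :: real vec) = v"
  by (intro eq_vecI) (auto simp: conjugate_real_def)

lemma scalar_prod_self_nonneg: "0 \<le> v \<bullet> (v :: real vec)"
  by (simp add: scalar_prod_def sum_nonneg)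

lemma scalar_prod_self_pos:
  fixes v :: "real vec"
  assumes "v \<in> carrier_vec n" "v \<noteq> 0\<^sub>v n"
  shows "0 < v \<bullet> v"
proof -
  have "v \<bullet> v \<noteq> 0"
  proof
    assume "v \<bullet> v = 0"
    then have "\<forall>i<n. v $ i = 0"
      using assms(1) by (auto simp: scalar_prod_def sum_nonneg_eq_0_iff)
    then show False using assms by (auto intro: eq_vecI)
  qed
  then show ?thesis using scalar_prod_self_nonneg[of v] by simp
qed

text \<open>Gram-Schmidt applied to a basis that starts with v leaves v in place, and normalising
  does not change it since v is a unit vector.\<close>

lemma orthogonal_completion:
  fixes v :: "real vec"
  assumes v: "v \<in> carrier_vec n" and v1: "v \<bullet> v = 1" and n: "n > 0"
  obtains U where "U \<in> carrier_mat n n" "U\<^sup>T * U = 1\<^sub>m n" "col U 0 = v"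
proof -
  interpret cof_vec_space n "TYPE(real)" .
  have v0: "v \<noteq> 0\<^sub>v n" using v1 by auto
  define b where "b = basis_completion v"
  from basis_completion[OF v v0, folded b_def]
  have b: "distinct b" "\<not> lin_dep (set b)" "set b \<subseteq> carrier_vec n" "hd b = v" "length b = n"
    by auto
  then obtain vs where bv: "b = v # vs" using n by (cases b) auto
  define ws where "ws = gram_schmidt n b"
  from gram_schmidt_result[OF b(3,1,2) ws_def]
  have ws: "set ws \<subseteq> carrier_vec n" "corthogonal ws" "length ws = n" using b by auto
  have hd: "ws ! 0 = v"
    using gram_schmidt_hd[OF v, of vs] ws n by (simp add: ws_def bv hd_conv_nth flip: length_greater_0_conv)
  have orth: "ws ! i \<bullet> ws ! j = 0 \<longleftrightarrow> i \<noteq> j" if "i < n" "j < n" for i j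
    using corthogonalD[OF ws(2), of i j] that ws(3) by (simp add: conjugate_real_vec)
  have wc: "ws ! i \<in> carrier_vec n" if "i < n" for i using ws that by auto
  define us where "us = map (\<lambda>w. (1 / sqrt (w \<bullet> w)) \<cdot>\<^sub>v w) ws"
  have us: "us ! i = (1 / sqrt (ws ! i \<bullet> ws ! i)) \<cdot>\<^sub>v ws ! i" if "i < n" for i
    using that ws by (simp add: us_def)
  have len: "length us = n" using ws by (simp add: us_def)
  have uc: "us ! i \<in> carrier_vec n" if "i < n" for i using us[OF that] wc[OF that] by simp
  define U where "U = mat_of_cols n us"
  have U: "U \<in> carrier_mat n n" using len by (auto simp: U_def)
  have col: "col U i = us ! i" if "i < n" for i
    using that len uc by (simp add: U_def)
  have "us ! i \<bullet> us ! j = (if i = j then 1 else 0)" if "i < n" "j < n" for i j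
  proof -
    have "us ! i \<bullet> us ! j = 1 / sqrt (ws ! i \<bullet> ws ! i) * (1 / sqrt (ws ! j \<bullet> ws ! j)) * (ws ! i \<bullet> ws ! j)"
      using us that wc[OF that(1)] wc[OF that(2)]
      by (simp add: smult_scalar_prod_distrib[of _ n] scalar_prod_smult_distrib[of _ n])
    moreover have "ws ! i \<bullet> ws ! i > 0"
      using orth[of i i] that scalar_prod_self_nonneg[of "ws ! i"] by (simp add: order.strict_iff_order)
    ultimately show ?thesis using orth[OF that] by auto
  qed
  then have "U\<^sup>T * U = 1\<^sub>m n"
    using U col by (intro eq_matI) auto
  moreover have "col U 0 = v" using col[OF n] us[OF n] hd v1 v by simp
  ultimately show thesis using that U by blast
qed

text \<open>Induction on the dimension: with a unit eigenvector as first column of an orthogonal U,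
  symmetry clears both the first row and the first column of the conjugated matrix, leaving a
  symmetric block of size m.\<close>

lemma real_symmetric_diagonalization:
  fixes A :: "real mat"
  assumes "A \<in> carrier_mat n n" "A\<^sup>T = A"
  shows "\<exists>P e. P \<in> carrier_mat n n \<and> P\<^sup>T * P = 1\<^sub>m n \<and> A = P * mat_diag n e * P\<^sup>T"
  using assms
proof (induction n arbitrary: A)
  case 0
  then show ?case by (intro exI[of _ "1\<^sub>m 0"] exI[of _ "\<lambda>_. 0"]) (auto intro!: eq_matI)
next
  case (Suc m)
  note A = Suc.prems(1)
  obtain k where "eigenvalue A k" using real_symmetric_eigenvalue[OF Suc.prems] by blast
  then obtain v where v: "v \<in> carrier_vec (Suc m)" "v \<noteq> 0\<^sub>v (Suc m)" "A *\<^sub>v v = k \<cdot>\<^sub>v v"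
    using A by (auto simp: eigenvalue_def eigenvector_def)
  have "v \<bullet> v > 0" using v(1,2) by (rule scalar_prod_self_pos)
  define w where "w = (1 / sqrt (v \<bullet> v)) \<cdot>\<^sub>v v"
  have w: "w \<in> carrier_vec (Suc m)" "w \<bullet> w = 1"
    using v \<open>v \<bullet> v > 0\<close> by (simp_all add: w_def)
  have Aw: "A *\<^sub>v w = k \<cdot>\<^sub>v w"
    using v A by (simp add: w_def mult_mat_vec smult_smult_assoc mult.commute)
  obtain U where U: "U \<in> carrier_mat (Suc m) (Suc m)" "U\<^sup>T * U = 1\<^sub>m (Suc m)" "col U 0 = w"
    using orthogonal_completion[OF w] by auto
  have UU: "U * U\<^sup>T = 1\<^sub>m (Suc m)"
    using mat_mult_left_right_inverse[of "U\<^sup>T" "Suc m" U] U by simp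
  define A' where "A' = U\<^sup>T * A * U"
  have A': "A' \<in> carrier_mat (Suc m) (Suc m)" using A U by (simp add: A'_def)
  have sym: "A'\<^sup>T = A'"
    using A U Suc.prems(2)
    by (simp add: A'_def transpose_mult[of _ "Suc m" "Suc m" _ "Suc m"] assoc_mult_mat[of _ "Suc m" "Suc m" _ "Suc m" _ "Suc m"])
  have "A' = U\<^sup>T * (A * U)" using A U by (simp add: A'_def)
  then have "col A' 0 = U\<^sup>T *\<^sub>v col (A * U) 0"
    using A U col_mult2[of "U\<^sup>T" "Suc m" "Suc m" "A * U" "Suc m" 0] by simp
  also have "col (A * U) 0 = A *\<^sub>v w" using col_mult2[OF A U(1), of 0] U(3) by simp
  also have "U\<^sup>T *\<^sub>v (A *\<^sub>v w) = k \<cdot>\<^sub>v (U\<^sup>T *\<^sub>v w)" using Aw U w by (simp add: mult_mat_vec)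
  also have "U\<^sup>T *\<^sub>v w = col (U\<^sup>T * U) 0"
    by (subst col_mult2[of _ "Suc m" "Suc m" _ "Suc m"]) (use U in auto)
  also have "\<dots> = unit_vec (Suc m) 0" using U(2) by simp
  finally have c0: "col A' 0 = k \<cdot>\<^sub>v unit_vec (Suc m) 0" .
  have A'_col: "A' $$ (i, 0) = (if i = 0 then k else 0)" if "i < Suc m" for i
    using arg_cong[OF c0, of "\<lambda>x. x $ i"] that A' by simp
  have A'_sym: "A' $$ (i, j) = A' $$ (j, i)" if "i < Suc m" "j < Suc m" for i j
    using arg_cong[OF sym, of "\<lambda>x. x $$ (i, j)"] that A' by simp
  define A3 where "A3 = mat m m (\<lambda>(i, j). A' $$ (Suc i, Suc j))"
  have A3: "A3 \<in> carrier_mat m m" "A3\<^sup>T = A3"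
    using A'_sym by (auto simp: A3_def intro!: eq_matI)
  obtain P e where P: "P \<in> carrier_mat m m" "P\<^sup>T * P = 1\<^sub>m m" "A3 = P * mat_diag m e * P\<^sup>T"
    using Suc.IH[OF A3] by blast
  define D where "D = mat 1 1 (\<lambda>_. k)"
  have D: "D \<in> carrier_mat 1 1" by (simp add: D_def)
  have A'_block: "A' = four_block_mat D (0\<^sub>m 1 m) (0\<^sub>m m 1) A3"
  proof (rule eq_matI)
    fix i j assume "i < dim_row (four_block_mat D (0\<^sub>m 1 m) (0\<^sub>m m 1) A3)"
      "j < dim_col (four_block_mat D (0\<^sub>m 1 m) (0\<^sub>m m 1) A3)"
    then have ij: "i < Suc m" "j < Suc m" using D A3 by auto
    then show "A' $$ (i, j) = four_block_mat D (0\<^sub>m 1 m) (0\<^sub>m m 1) A3 $$ (i, j)"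
      using A'_col[of i] A'_col[of j] A'_sym[of i j]
      by (cases i; cases j) (auto simp: D_def A3_def)
  qed (use A' D A3 in auto)
  define R where "R = four_block_mat (1\<^sub>m 1) (0\<^sub>m 1 m) (0\<^sub>m m 1) P"
  define E where "E = mat_diag (Suc m) (\<lambda>i. case i of 0 \<Rightarrow> k | Suc i \<Rightarrow> e i)"
  have R: "R \<in> carrier_mat (Suc m) (Suc m)" using P by (auto simp: R_def)
  have RT: "R\<^sup>T = four_block_mat (1\<^sub>m 1) (0\<^sub>m 1 m) (0\<^sub>m m 1) P\<^sup>T"
    unfolding R_def using P by (subst transpose_four_block_mat[of _ 1 1 _ m _ m]) auto
  have E: "E = four_block_mat D (0\<^sub>m 1 m) (0\<^sub>m m 1) (mat_diag m e)"
    unfolding E_def D_def mat_diag_def by (intro eq_matI) (auto split: nat.splits)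
  have Ec: "E \<in> carrier_mat (Suc m) (Suc m)" by (simp add: E_def)
  have "R\<^sup>T * R = four_block_mat (1\<^sub>m 1) (0\<^sub>m 1 m) (0\<^sub>m m 1) (1\<^sub>m m)"
    unfolding RT unfolding R_def using P by (subst mult_four_block_mat[of _ 1 1 _ m _ m _ _ 1 _ m]) (auto simp: left_mult_zero_mat[OF mat_diag_dim])
  also have "\<dots> = 1\<^sub>m (Suc m)" by (intro eq_matI) auto
  finally have RR: "R\<^sup>T * R = 1\<^sub>m (Suc m)" .
  define F where "F = P * mat_diag m e"
  have F: "F \<in> carrier_mat m m" "A3 = F * P\<^sup>T" using P by (auto simp: F_def)
  have "R * E = four_block_mat D (0\<^sub>m 1 m) (0\<^sub>m m 1) F"
    unfolding E R_def F_def using P D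
    by (subst mult_four_block_mat[of _ 1 1 _ m _ m _ _ 1 _ m])
      (auto simp: left_mult_zero_mat[OF mat_diag_dim])
  moreover have "four_block_mat D (0\<^sub>m 1 m) (0\<^sub>m m 1) F * R\<^sup>T
      = four_block_mat D (0\<^sub>m 1 m) (0\<^sub>m m 1) A3"
    unfolding RT F(2) using P D F(1)
    by (subst mult_four_block_mat[of _ 1 1 _ m _ m _ _ 1 _ m]) auto
  ultimately have "R * E * R\<^sup>T = four_block_mat D (0\<^sub>m 1 m) (0\<^sub>m m 1) A3" by simp
  then have A'_eq: "A' = R * E * R\<^sup>T" using A'_block by simp
  note assoc = assoc_mult_mat[of _ "Suc m" "Suc m" _ "Suc m" _ "Suc m"]
  have "U * A' * U\<^sup>T = (U * U\<^sup>T) * A * (U * U\<^sup>T)"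
    using A U by (simp add: A'_def assoc del: UU)
  then have "A = U * A' * U\<^sup>T" using UU A by simp
  also have "\<dots> = U * R * E * (U * R)\<^sup>T"
    using U R Ec by (simp add: A'_eq assoc transpose_mult[of _ "Suc m" "Suc m" _ "Suc m"])
  finally have "A = U * R * E * (U * R)\<^sup>T" .
  moreover have "U\<^sup>T * (U * R) = (U\<^sup>T * U) * R"
    using U(1) R by (simp add: assoc)
  then have "(U * R)\<^sup>T * (U * R) = 1\<^sub>m (Suc m)"
    using U R RR by (simp add: assoc transpose_mult[of _ "Suc m" "Suc m" _ "Suc m"])
  moreover have "U * R \<in> carrier_mat (Suc m) (Suc m)" using U R by simp
  ultimately show ?case unfolding E_def by blast
qed

text \<open>The spectral theorem in entries: \<open>p i k\<close> is the i-th coordinate of the k-th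
  vector of an orthonormal eigenbasis. Both applications below only manipulate finite sums.\<close>

lemma real_symmetric_spectral:
  fixes A :: "real mat"
  assumes A: "A \<in> carrier_mat n n" and sym: "A\<^sup>T = A"
  obtains p :: "nat \<Rightarrow> nat \<Rightarrow> real" and e where
    "\<And>i j. i < n \<Longrightarrow> j < n \<Longrightarrow> A $$ (i, j) = (\<Sum>k<n. e k * (p i k * p j k))"
    "\<And>i j. i < n \<Longrightarrow> j < n \<Longrightarrow> (\<Sum>k<n. p i k * p j k) = (if i = j then 1 else 0)"
    "\<And>k l. k < n \<Longrightarrow> l < n \<Longrightarrow> (\<Sum>i<n. p i k * p i l) = (if k = l then 1 else 0)"
    "\<And>x. order x (char_poly A) = card {k \<in> {..<n}. e k = x}"
    "spectrum A = e ` {..<n}"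
proof -
  obtain P e where P: "P \<in> carrier_mat n n" "P\<^sup>T * P = 1\<^sub>m n" "A = P * mat_diag n e * P\<^sup>T"
    using real_symmetric_diagonalization[OF A sym] by blast
  define p where "p i k = P $$ (i, k)" for i k
  have PP: "P * P\<^sup>T = 1\<^sub>m n" using mat_mult_left_right_inverse[of "P\<^sup>T" n P] P by simp
  have entry: "A $$ (i, j) = (\<Sum>k<n. e k * (p i k * p j k))" if "i < n" "j < n" for i j
  proof -
    have "P * mat_diag n e = mat n n (\<lambda>(i, k). p i k * e k)"
      using mat_diag_mult_right[OF P(1)] by (simp add: p_def)
    then show ?thesis using P(1) that unfolding P(3)
      by (auto simp: scalar_prod_def p_def lessThan_atLeast0 intro!: sum.cong)
  qed
  have rows: "(\<Sum>k<n. p i k * p j k) = (if i = j then 1 else 0)" if "i < n" "j < n" for i j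
    using arg_cong[OF PP, of "\<lambda>M. M $$ (i, j)"] P(1) that
    by (auto simp: scalar_prod_def p_def lessThan_atLeast0)
  have cols: "(\<Sum>i<n. p i k * p i l) = (if k = l then 1 else 0)" if "k < n" "l < n" for k l
    using arg_cong[OF P(2), of "\<lambda>M. M $$ (k, l)"] P(1) that
    by (auto simp: scalar_prod_def p_def lessThan_atLeast0)
  have "similar_mat A (mat_diag n e)"
    unfolding similar_mat_def
    by (intro exI[of _ P] exI[of _ "P\<^sup>T"] similar_mat_witI[of _ _ n]) (use P PP A in auto)
  then have "char_poly A = char_poly (mat_diag n e)" by (rule char_poly_similar)
  also have "\<dots> = (\<Prod>a\<leftarrow>diag_mat (mat_diag n e). [:- a, 1:])"
    by (rule char_poly_upper_triangular[of _ n]) (auto simp: mat_diag_def)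
  also have "diag_mat (mat_diag n e) = map e [0..<n]"
    by (intro nth_equalityI) (auto simp: diag_mat_def mat_diag_def)
  also have "(\<Prod>a\<leftarrow>map e [0..<n]. [:- a, 1:]) = (\<Prod>k\<in>{..<n}. [:- e k, 1:])"
    by (simp add: prod.distinct_set_conv_list[symmetric] comp_def lessThan_atLeast0)
  finally have cp: "char_poly A = (\<Prod>k\<in>{..<n}. [:- e k, 1:])" .
  have "spectrum A = {x. poly (char_poly A) x = 0}" by (rule spectrum_root_char_poly[OF A])
  also have "\<dots> = e ` {..<n}" by (auto simp: cp poly_prod)
  finally show thesis
    using that entry rows cols order_prod_linear_factors[of "{..<n}" _ e] cp by simp
qed

text \<open>These are the relations for (s2, -s1, 0) / sqrt H and (s1 s3, s2 s3, -H) / sqrt (H r),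
  an orthonormal basis of the plane orthogonal to (s1, s2, s3). The quotients are what remains after
  the square roots have been multiplied out; a and b stand for the normalising factors.\<close>

lemma plane_basis_identities:
  fixes s1 s2 s3 H r a b :: real
  assumes nz: "H \<noteq> 0" "r \<noteq> 0" and H: "H = s1 * s1 + s2 * s2" and r: "r = H + s3 * s3"
  shows "s2 * s2 / H + s1 * s3 * (s1 * s3) / (H * r) = 1 - s1 * s1 / r"
  "- s1 * - s1 / H + s2 * s3 * (s2 * s3) / (H * r) = 1 - s2 * s2 / r"
  "0 * 0 / H + - H * - H / (H * r) = 1 - s3 * s3 / r"
  "s2 * - s1 / H + s1 * s3 * (s2 * s3) / (H * r) = - s1 * s2 / r"
  "s2 * 0 / H + s1 * s3 * - H / (H * r) = - s1 * s3 / r"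
  "- s1 * 0 / H + s2 * s3 * - H / (H * r) = - s2 * s3 / r"
  "s2 * s2 / H + - s1 * - s1 / H + 0 * 0 / H = 1"
  "s1 * s3 * (s1 * s3) / (H * r) + s2 * s3 * (s2 * s3) / (H * r) + - H * - H / (H * r) = 1"
  "s2 * a * (s1 * s3 * b) + - s1 * a * (s2 * s3 * b) + 0 * a * (- H * b) = 0"
  "s2 * a * s1 + - s1 * a * s2 + 0 * a * s3 = 0"
  "s1 * s3 * b * s1 + s2 * s3 * b * s2 + - H * b * s3 = 0"
  subgoal using nz by (simp add: divide_simps) (use H r in Groebner_Basis.algebra)
  subgoal using nz by (simp add: divide_simps) (use H r in Groebner_Basis.algebra)
  subgoal using nz by (simp add: divide_simps) (use H r in Groebner_Basis.algebra)
  subgoal using nz by (simp add: divide_simps) (use H r in Groebner_Basis.algebra)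
  subgoal using nz by (simp add: divide_simps)
  subgoal using nz by (simp add: divide_simps)
  subgoal using nz by (simp add: divide_simps) (use H r in Groebner_Basis.algebra)
  subgoal using nz by (simp add: divide_simps) (use H r in Groebner_Basis.algebra)
  subgoal by (simp add: algebra_simps)
  subgoal by (simp add: algebra_simps)
  subgoal using H by Groebner_Basis.algebra
  done
lemma orthonormal_basis_of_plane:
  fixes s1 s2 s3 :: real
  assumes "s1\<^sup>2 + s2\<^sup>2 + s3\<^sup>2 = r" "r > 0"
  obtains u1 u2 u3 v1 v2 v3 :: real where
    "u1 * u1 + v1 * v1 = 1 - s1 * s1 / r" "u2 * u2 + v2 * v2 = 1 - s2 * s2 / r"
    "u3 * u3 + v3 * v3 = 1 - s3 * s3 / r" "u1 * u2 + v1 * v2 = - s1 * s2 / r"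
    "u1 * u3 + v1 * v3 = - s1 * s3 / r" "u2 * u3 + v2 * v3 = - s2 * s3 / r"
    "u1 * u1 + u2 * u2 + u3 * u3 = 1" "v1 * v1 + v2 * v2 + v3 * v3 = 1"
    "u1 * v1 + u2 * v2 + u3 * v3 = 0" "u1 * s1 + u2 * s2 + u3 * s3 = 0" "v1 * s1 + v2 * s2 + v3 * s3 = 0"
proof (cases "s1 = 0 \<and> s2 = 0")
  case True
  \<comment> \<open>Here H = 0 and the general formula breaks down, but the plane is spanned by the
    first two coordinate axes.\<close>
  then show ?thesis using assms that[of 1 0 0 1 0 0] by (auto simp: power2_eq_square)
next
  case False
  define H where "H = s1 * s1 + s2 * s2"
  have H: "H > 0" using False by (simp add: H_def sum_squares_gt_zero_iff)
  have r: "r = H + s3 * s3" using assms by (simp add: H_def power2_eq_square)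
  define a b where "a = 1 / sqrt H" and "b = 1 / sqrt (H * r)"
  have a: "a * a = 1 / H" using H by (simp add: a_def)
  have b: "b * b = 1 / (H * r)" using H assms(2) by (simp add: b_def)
  have aa: "(x * a) * (y * a) = x * y / H" for x y using a by (metis (no_types) mult.assoc mult.commute mult.left_commute times_divide_eq_right mult.right_neutral)
  have bb: "(x * b) * (y * b) = x * y / (H * r)" for x y using b by (metis (no_types) mult.assoc mult.commute mult.left_commute times_divide_eq_right mult.right_neutral)
  have nz: "H \<noteq> 0" "r \<noteq> 0" using H assms(2) by auto
  show ?thesis
    using plane_basis_identities[OF nz H_def r]
    \<comment> \<open>The zero coordinate is written \<open>0 * a\<close> so that \<open>aa\<close>
      rewrites every product uniformly.\<close>
    by (intro that[of "s2 * a" "s1 * s3 * b" "- s1 * a" "s2 * s3 * b" "0 * a" "- H * b"])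
      (simp_all only: aa bb)
qed

lemma sum_mult_delta:
  fixes h :: "nat \<Rightarrow> real"
  assumes "l < n"
  shows "(\<Sum>k<n. h k * (if k = l then 1 else 0)) = h l" "(\<Sum>k<n. h k * (if l = k then 1 else 0)) = h l"
proof -
  have "(\<Sum>k<n. h k * (if k = l then 1 else 0)) = (\<Sum>k<n. if k = l then h k else 0)"
    by (intro sum.cong) auto
  then show "(\<Sum>k<n. h k * (if k = l then 1 else 0)) = h l" using assms by simp
  then show "(\<Sum>k<n. h k * (if l = k then 1 else 0)) = h l" by (simp add: eq_commute[of l])
qed

lemma card_complement_of_eq:
  "card {k \<in> {..<n}. e k \<noteq> x} + card {k \<in> {..<n}. e k = x} = (n :: nat)"
proof -
  have "{k \<in> {..<n}. e k \<noteq> x} \<union> {k \<in> {..<n}. e k = x} = {..<n}" by auto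
  moreover have "{k \<in> {..<n}. e k \<noteq> x} \<inter> {k \<in> {..<n}. e k = x} = {}" by auto
  ultimately show ?thesis
    using card_Un_disjoint[of "{k \<in> {..<n}. e k \<noteq> x}" "{k \<in> {..<n}. e k = x}"] by simp
qed

text \<open>Scaling the three eigenvectors below the maximum by sqrt (L - e k) realises L I - A as a
  Gram matrix in dimension three. All these vectors have inner product L with their sum, whose
  squared length is n L; projecting along the sum subtracts L^2 / (n L) = L / n, which is the
  constant c.\<close>

lemma planar_vectors_if_max_eigenvalue_mult:
  fixes A :: "real mat"
  assumes A: "A \<in> carrier_mat n n" and sym: "A\<^sup>T = A" and n: "n \<ge> 4"
    and row_sums: "\<And>i. i < n \<Longrightarrow> (\<Sum>j<n. A $$ (i, j)) = 0"
    and pos: "i0 < n" "A $$ (i0, i0) > 0"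
    and mult: "max_eigenvalue_mult A = n - 3"
  obtains c :: real and f g :: "nat \<Rightarrow> real" where
    "\<And>i j. i < n \<Longrightarrow> j < n \<Longrightarrow> i \<noteq> j \<Longrightarrow> f i * f j + g i * g j = - A $$ (i, j) - c"
    "(\<Sum>i<n. f i) = 0" "(\<Sum>i<n. g i) = 0" "\<exists>i<n. \<exists>j<n. f i * g j - g i * f j \<noteq> 0"
proof -
  obtain p e where
    entry: "\<And>i j. i < n \<Longrightarrow> j < n \<Longrightarrow> A $$ (i, j) = (\<Sum>k<n. e k * (p i k * p j k))"
    and rows: "\<And>i j. i < n \<Longrightarrow> j < n \<Longrightarrow> (\<Sum>k<n. p i k * p j k) = (if i = j then 1 else 0 :: real)"
    and cols: "\<And>k l. k < n \<Longrightarrow> l < n \<Longrightarrow> (\<Sum>i<n. p i k * p i l) = (if k = l then 1 else 0 :: real)"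
    and ord: "\<And>x. order x (char_poly A) = card {k \<in> {..<n}. e k = x}"
    and spec: "spectrum A = e ` {..<n}"
    by (rule real_symmetric_spectral[OF A sym]) (rule that)
  define L where "L = Max (e ` {..<n})"
  have L_max: "e k \<le> L" if "k < n" for k using that by (simp add: L_def)
  define I where "I = {k \<in> {..<n}. e k \<noteq> L}"
  have "card I = 3"
    using mult ord[of L] spec card_complement_of_eq[of n e L] n
    by (simp add: max_eigenvalue_mult_def L_def I_def)
  then obtain k1 k2 k3 where I: "I = {k1, k2, k3}" "k1 \<noteq> k2" "k1 \<noteq> k3" "k2 \<noteq> k3"
    by (auto simp: card_3_iff)
  then have k: "k1 < n" "k2 < n" "k3 < n" "e k1 < L" "e k2 < L" "e k3 < L"
    using L_max by (auto simp: I_def order.strict_iff_order)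
  \<comment> \<open>A nonpositive maximum would make every diagonal entry nonpositive. Positivity is
    needed to divide by the squared length of the sum vector.\<close>
  have "L > 0"
  proof (rule ccontr)
    assume "\<not> L > 0"
    then have "e k * (p i0 k * p i0 k) \<le> 0" if "k < n" for k
      using L_max[OF that] by (simp add: mult_nonpos_nonneg)
    then have "A $$ (i0, i0) \<le> 0" unfolding entry[OF pos(1) pos(1)] by (intro sum_nonpos) auto
    then show False using pos by simp
  qed
  define x where "x k i = sqrt (L - e k) * p i k" for k i
  have xx: "x k i * x k j = (L - e k) * (p i k * p j k)" if "k < n" for k i j
  proof -
    have "x k i * x k j = (sqrt (L - e k) * sqrt (L - e k)) * (p i k * p j k)"
      by (simp add: x_def algebra_simps)
    then show ?thesis using L_max[OF that] by simp
  qed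
  have M: "x k1 i * x k1 j + x k2 i * x k2 j + x k3 i * x k3 j = (if i = j then L else 0) - A $$ (i, j)"
    if "i < n" "j < n" for i j
  proof -
    have "(if i = j then L else 0) - A $$ (i, j) = (\<Sum>k<n. (L - e k) * (p i k * p j k))"
      using entry[OF that] arg_cong[OF rows[OF that], of "\<lambda>x. L * x"]
      by (simp add: left_diff_distrib sum_subtractf sum_distrib_left)
    also have "\<dots> = (\<Sum>k\<in>I. (L - e k) * (p i k * p j k))"
      by (rule sum.mono_neutral_right) (auto simp: I_def)
    also have "\<dots> = x k1 i * x k1 j + x k2 i * x k2 j + x k3 i * x k3 j"
      using I k by (simp add: xx)
    finally show ?thesis by simp
  qed
  define s1 s2 s3 where "s1 = (\<Sum>i<n. x k1 i)" and "s2 = (\<Sum>i<n. x k2 i)" and "s3 = (\<Sum>i<n. x k3 i)"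
  have xs: "x k1 i * s1 + x k2 i * s2 + x k3 i * s3 = L" if "i < n" for i
  proof -
    have "x k1 i * s1 + x k2 i * s2 + x k3 i * s3
        = (\<Sum>j<n. x k1 i * x k1 j + x k2 i * x k2 j + x k3 i * x k3 j)"
      by (simp add: s1_def s2_def s3_def sum_distrib_left sum.distrib)
    also have "\<dots> = (\<Sum>j<n. (if i = j then L else 0) - A $$ (i, j))"
      using M[OF that] by (intro sum.cong) auto
    also have "\<dots> = L" using that row_sums by (simp add: sum_subtractf)
    finally show ?thesis .
  qed
  have "s1\<^sup>2 + s2\<^sup>2 + s3\<^sup>2 = (\<Sum>i<n. x k1 i * s1 + x k2 i * s2 + x k3 i * s3)"
    by (simp add: s1_def s2_def s3_def sum_distrib_right sum.distrib power2_eq_square)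
  also have "\<dots> = n * L" using xs by simp
  finally have s: "s1\<^sup>2 + s2\<^sup>2 + s3\<^sup>2 = n * L" .
  define r where "r = n * L"
  have r: "r > 0" using \<open>L > 0\<close> n by (simp add: r_def)
  obtain u1 u2 u3 v1 v2 v3 where uv:
    "u1 * u1 + v1 * v1 = 1 - s1 * s1 / r" "u2 * u2 + v2 * v2 = 1 - s2 * s2 / r"
    "u3 * u3 + v3 * v3 = 1 - s3 * s3 / r" "u1 * u2 + v1 * v2 = - s1 * s2 / r"
    "u1 * u3 + v1 * v3 = - s1 * s3 / r" "u2 * u3 + v2 * v3 = - s2 * s3 / r"
    and uv1: "u1 * u1 + u2 * u2 + u3 * u3 = 1" "v1 * v1 + v2 * v2 + v3 * v3 = 1"
    "u1 * v1 + u2 * v2 + u3 * v3 = 0"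
    and uvs: "u1 * s1 + u2 * s2 + u3 * s3 = 0" "v1 * s1 + v2 * s2 + v3 * s3 = 0"
    by (rule orthonormal_basis_of_plane[OF s[folded r_def] r]) (rule that)
  define f g where "f i = u1 * x k1 i + u2 * x k2 i + u3 * x k3 i"
    and "g i = v1 * x k1 i + v2 * x k2 i + v3 * x k3 i" for i
  have "f i * f j + g i * g j = - A $$ (i, j) - L / n" if "i < n" "j < n" "i \<noteq> j" for i j
  proof -
    have "f i * f j + g i * g j = (u1 * u1 + v1 * v1) * (x k1 i * x k1 j)
        + (u2 * u2 + v2 * v2) * (x k2 i * x k2 j) + (u3 * u3 + v3 * v3) * (x k3 i * x k3 j)
        + (u1 * u2 + v1 * v2) * (x k1 i * x k2 j + x k2 i * x k1 j)
        + (u1 * u3 + v1 * v3) * (x k1 i * x k3 j + x k3 i * x k1 j)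
        + (u2 * u3 + v2 * v3) * (x k2 i * x k3 j + x k3 i * x k2 j)"
      by (simp add: f_def g_def algebra_simps)
    also have "\<dots> = (x k1 i * x k1 j + x k2 i * x k2 j + x k3 i * x k3 j)
        - (x k1 i * s1 + x k2 i * s2 + x k3 i * s3) * (x k1 j * s1 + x k2 j * s2 + x k3 j * s3) / r"
      unfolding uv using r by (simp add: field_simps)
    also have "\<dots> = - A $$ (i, j) - L * L / r"
      using M[OF that(1,2)] xs that by simp
    also have "L * L / r = L / n" using \<open>L > 0\<close> by (simp add: r_def)
    finally show ?thesis .
  qed
  moreover have "(\<Sum>i<n. f i) = 0"
    using uvs(1) by (simp add: f_def sum.distrib s1_def s2_def s3_def flip: sum_distrib_left)
  moreover have "(\<Sum>i<n. g i) = 0"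
    using uvs(2) by (simp add: g_def sum.distrib s1_def s2_def s3_def flip: sum_distrib_left)
  moreover have "\<exists>i<n. \<exists>j<n. f i * g j - g i * f j \<noteq> 0"
  proof (rule ccontr)
    assume "\<not> ?thesis"
    then have par: "f i * g j = g i * f j" if "i < n" "j < n" for i j using that by auto
    \<comment> \<open>If all planar vectors are parallel, some nonzero (a, b) is orthogonal to all
      of them. It lifts to a linear relation among the three scaled eigenvectors, which are
      orthogonal and nonzero.\<close>
    obtain a b where ab: "a \<noteq> 0 \<or> b \<noteq> 0" "\<And>i. i < n \<Longrightarrow> a * f i + b * g i = 0"
    proof (cases "\<exists>i<n. f i \<noteq> 0 \<or> g i \<noteq> 0")
      case True
      then obtain i where i: "i < n" "f i \<noteq> 0 \<or> g i \<noteq> 0" by blast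
      show ?thesis
      proof (rule that[of "g i" "- f i"])
        show "g i * f j + - f i * g j = 0" if "j < n" for j using par[OF i(1) that] by simp
      qed (use i in auto)
    next
      case False
      then show ?thesis using that[of 1 0] by auto
    qed
    define w1 w2 w3 where "w1 = a * u1 + b * v1" and "w2 = a * u2 + b * v2" and "w3 = a * u3 + b * v3"
    have dep: "w1 * x k1 i + w2 * x k2 i + w3 * x k3 i = 0" if "i < n" for i
      using ab(2)[OF that] by (simp add: w1_def w2_def w3_def f_def g_def algebra_simps)
    have inner: "(\<Sum>i<n. x k i * x l i) = (if k = l then L - e k else 0)" if "k < n" "l < n" for k l
    proof -
      have "(\<Sum>i<n. x k i * x l i) = (\<Sum>i<n. sqrt (L - e k) * sqrt (L - e l) * (p i k * p i l))"
        by (simp add: x_def algebra_simps)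
      also have "\<dots> = sqrt (L - e k) * sqrt (L - e l) * (if k = l then 1 else 0)"
        by (simp add: cols[OF that] flip: sum_distrib_left)
      finally show ?thesis using L_max[OF that(1)] by auto
    qed
    have wk: "w1 * (\<Sum>i<n. x k i * x k1 i) + w2 * (\<Sum>i<n. x k i * x k2 i) + w3 * (\<Sum>i<n. x k i * x k3 i) = 0" for k
    proof -
      have "(\<Sum>i<n. x k i * (w1 * x k1 i + w2 * x k2 i + w3 * x k3 i)) = 0" using dep by simp
      then show ?thesis
        by (simp add: sum_distrib_left sum.distrib distrib_left mult.left_commute)
    qed
    have "w1 = 0" "w2 = 0" "w3 = 0"
      using wk[of k1] wk[of k2] wk[of k3] I k by (auto simp: inner)
    then have "w1 * w1 + w2 * w2 + w3 * w3 = 0" by simp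
    moreover have "w1 * w1 + w2 * w2 + w3 * w3 = a * a * (u1 * u1 + u2 * u2 + u3 * u3)
        + b * b * (v1 * v1 + v2 * v2 + v3 * v3) + 2 * a * b * (u1 * v1 + u2 * v2 + u3 * v3)"
      by (simp add: w1_def w2_def w3_def algebra_simps)
    ultimately have "a * a + b * b = 0" using uv1 by simp
    then show False using ab(1) by (simp add: sum_squares_eq_zero_iff)
  qed
  ultimately show thesis using that by blast
qed

text \<open>The vectors w k are not assumed to be part of an eigenbasis that diagonalises A. They
  are compared with an arbitrary one through the inner products \<open>t k l\<close>, and a double
  count of normalised squares shows that exactly card K eigenvalues differ from L. As card K < n,
  the value L does occur, and it is the maximum.\<close>

lemma max_eigenvalue_mult_if_decomposition:
  fixes A :: "real mat" and w :: "'k \<Rightarrow> nat \<Rightarrow> real"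
  assumes A: "A \<in> carrier_mat n n" and sym: "A\<^sup>T = A" and K: "finite K" "card K < n"
    and m: "\<And>k. k \<in> K \<Longrightarrow> m k > 0" and nz: "\<And>k. k \<in> K \<Longrightarrow> (\<Sum>i<n. w k i * w k i) \<noteq> 0"
    and orth: "\<And>k l. k \<in> K \<Longrightarrow> l \<in> K \<Longrightarrow> k \<noteq> l \<Longrightarrow> (\<Sum>i<n. w k i * w l i) = 0"
    and decomp: "\<And>i j. i < n \<Longrightarrow> j < n \<Longrightarrow>
      (if i = j then L else 0) - A $$ (i, j) = (\<Sum>k\<in>K. m k * (w k i * w k j))"
  shows "max_eigenvalue_mult A = n - card K"
proof -
  obtain p e where
    entry: "\<And>i j. i < n \<Longrightarrow> j < n \<Longrightarrow> A $$ (i, j) = (\<Sum>k<n. e k * (p i k * p j k))"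
    and rows: "\<And>i j. i < n \<Longrightarrow> j < n \<Longrightarrow> (\<Sum>k<n. p i k * p j k) = (if i = j then 1 else 0 :: real)"
    and cols: "\<And>k l. k < n \<Longrightarrow> l < n \<Longrightarrow> (\<Sum>i<n. p i k * p i l) = (if k = l then 1 else 0 :: real)"
    and ord: "\<And>x. order x (char_poly A) = card {k \<in> {..<n}. e k = x}"
    and spec: "spectrum A = e ` {..<n}"
    by (rule real_symmetric_spectral[OF A sym]) (rule that)
  define q where "q k = (\<Sum>i<n. w k i * w k i)" for k
  define t where "t k l = (\<Sum>i<n. w k i * p i l)" for k l
  have q_pos: "q k > 0" if "k \<in> K" for k
    using nz[OF that] sum_nonneg[of "{..<n}" "\<lambda>i. w k i * w k i"] by (simp add: q_def order.strict_iff_order)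
  have eig: "(L - e l) * p i l = (\<Sum>k\<in>K. m k * (w k i * t k l))" if "i < n" "l < n" for i l
  proof -
    have "(\<Sum>j<n. A $$ (i, j) * p j l) = (\<Sum>j<n. \<Sum>k<n. e k * p i k * (p j k * p j l))"
      using entry[OF that(1)] by (intro sum.cong) (auto simp: sum_distrib_right mult.assoc)
    also have "\<dots> = (\<Sum>k<n. e k * p i k * (\<Sum>j<n. p j k * p j l))"
      by (subst sum.swap) (simp add: sum_distrib_left)
    also have "\<dots> = (\<Sum>k<n. e k * p i k * (if k = l then 1 else 0))"
      using cols that by (intro sum.cong) auto
    also have "\<dots> = e l * p i l" by (rule sum_mult_delta(1)[OF that(2)])
    finally have "(\<Sum>j<n. A $$ (i, j) * p j l) = e l * p i l" .
    moreover have "(\<Sum>j<n. (if i = j then L else 0) * p j l) = (\<Sum>j<n. L * p j l * (if i = j then 1 else 0))"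
      by (intro sum.cong) auto
    ultimately have "(L - e l) * p i l = (\<Sum>j<n. ((if i = j then L else 0) - A $$ (i, j)) * p j l)"
      using sum_mult_delta(2)[OF that(1), of "\<lambda>j. L * p j l"]
      by (simp add: left_diff_distrib sum_subtractf)
    also have "\<dots> = (\<Sum>j<n. \<Sum>k\<in>K. m k * (w k i * (w k j * p j l)))"
    proof (intro sum.cong refl)
      fix j assume "j \<in> {..<n}"
      then have "j < n" by simp
      then show "((if i = j then L else 0) - A $$ (i, j)) * p j l = (\<Sum>k\<in>K. m k * (w k i * (w k j * p j l)))"
        by (simp only: decomp[OF that(1)] sum_distrib_right mult.assoc)
    qed
    also have "\<dots> = (\<Sum>k\<in>K. m k * (w k i * t k l))"
      by (subst sum.swap) (simp add: t_def sum_distrib_left)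
    finally show ?thesis .
  qed
  have gap: "L - e l = (\<Sum>k\<in>K. m k * (t k l * t k l))" if "l < n" for l
  proof -
    have "L - e l = (\<Sum>i<n. (L - e l) * p i l * p i l)"
      using cols[OF that that] by (simp add: mult.assoc flip: sum_distrib_left)
    also have "\<dots> = (\<Sum>i<n. \<Sum>k\<in>K. m k * (w k i * p i l * t k l))"
    proof (intro sum.cong refl)
      fix i assume "i \<in> {..<n}"
      then have i: "i < n" by simp
      have "(L - e l) * p i l * p i l = (\<Sum>k\<in>K. m k * (w k i * t k l)) * p i l"
        using eig[OF i, of l] that by simp
      also have "\<dots> = (\<Sum>k\<in>K. m k * (w k i * p i l * t k l))"
        by (simp add: sum_distrib_left sum_distrib_right mult_ac)
      finally show "(L - e l) * p i l * p i l = (\<Sum>k\<in>K. m k * (w k i * p i l * t k l))" .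
    qed
    also have "\<dots> = (\<Sum>k\<in>K. m k * (t k l * t k l))"
    proof -
      have "(\<Sum>i<n. \<Sum>k\<in>K. m k * (w k i * p i l * t k l)) = (\<Sum>k\<in>K. \<Sum>i<n. m k * (w k i * p i l * t k l))"
        by (rule sum.swap)
      also have "\<dots> = (\<Sum>k\<in>K. m k * ((\<Sum>i<n. w k i * p i l) * t k l))"
        by (simp add: sum_distrib_left sum_distrib_right)
      finally show ?thesis by (simp only: t_def)
    qed
    finally show ?thesis .
  qed
  \<comment> \<open>By orthogonality, w k is an eigenvector of L I - A with eigenvalue m k q k, so
    it can only meet eigenvectors of A with that same gap to L.\<close>
  have ev: "(L - e l) * t k l = m k * q k * t k l" if "l < n" "k \<in> K" for k l
  proof -
    have "(L - e l) * t k l = (\<Sum>i<n. w k i * ((L - e l) * p i l))"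
      by (simp add: t_def sum_distrib_left mult.left_commute)
    also have "\<dots> = (\<Sum>i<n. \<Sum>h\<in>K. m h * t h l * (w k i * w h i))"
    proof (intro sum.cong refl)
      fix i assume "i \<in> {..<n}"
      then have i: "i < n" by simp
      have "w k i * ((L - e l) * p i l) = w k i * (\<Sum>h\<in>K. m h * (w h i * t h l))"
        using eig[OF i, of l] that by simp
      also have "\<dots> = (\<Sum>h\<in>K. m h * t h l * (w k i * w h i))"
        by (simp add: sum_distrib_left sum_distrib_right mult_ac)
      finally show "w k i * ((L - e l) * p i l) = (\<Sum>h\<in>K. m h * t h l * (w k i * w h i))" .
    qed
    also have "\<dots> = (\<Sum>h\<in>K. m h * t h l * (\<Sum>i<n. w k i * w h i))"
      by (subst sum.swap) (simp add: sum_distrib_left)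
    also have "\<dots> = (\<Sum>h\<in>K. if h = k then m k * t k l * q k else 0)"
      using orth that by (intro sum.cong) (auto simp: q_def)
    also have "\<dots> = m k * q k * t k l" using that K by simp
    finally show ?thesis .
  qed
  have parseval: "(\<Sum>l<n. t k l * t k l) = q k" for k
  proof -
    have "(\<Sum>l<n. t k l * t k l) = (\<Sum>l<n. \<Sum>i<n. \<Sum>j<n. w k i * w k j * (p i l * p j l))"
      by (simp add: t_def sum_product algebra_simps)
    also have "\<dots> = (\<Sum>i<n. \<Sum>l<n. \<Sum>j<n. w k i * w k j * (p i l * p j l))"
      by (rule sum.swap)
    also have "\<dots> = (\<Sum>i<n. \<Sum>j<n. \<Sum>l<n. w k i * w k j * (p i l * p j l))"
      by (intro sum.cong refl sum.swap)
    also have "\<dots> = (\<Sum>i<n. \<Sum>j<n. w k i * w k j * (if i = j then 1 else 0))"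
      using rows by (intro sum.cong) (auto simp flip: sum_distrib_left)
    also have "\<dots> = q k" unfolding q_def using sum_mult_delta(2) by (intro sum.cong) auto
    finally show ?thesis .
  qed
  have e_le: "e l \<le> L" if "l < n" for l
  proof -
    have "0 \<le> (\<Sum>k\<in>K. m k * (t k l * t k l))" using m by (intro sum_nonneg) (simp add: less_imp_le)
    then show ?thesis using gap[OF that] by simp
  qed
  text \<open>The weights \<open>t k l ^ 2 / q k\<close> sum up to 1 over all \<open>l\<close> for fixed \<open>k\<close>, and over all \<open>k\<close>
    to 1 or 0 for fixed \<open>l\<close>, according to whether \<open>e l\<close> differs from \<open>L\<close>.\<close>
  have weight: "(\<Sum>k\<in>K. t k l * t k l / q k) = (if e l \<noteq> L then 1 else 0)" if l: "l < n" for l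
  proof (cases "e l = L")
    case True
    have "(\<Sum>k\<in>K. m k * (t k l * t k l)) = 0" using gap[OF l] True by simp
    then have "\<forall>k\<in>K. m k * (t k l * t k l) = 0"
      using K m by (subst (asm) sum_nonneg_eq_0_iff) (auto simp: less_imp_le)
    then have "\<forall>k\<in>K. t k l = 0" using m by force
    then show ?thesis using True by simp
  next
    case False
    have "t k l * t k l / q k = m k * (t k l * t k l) / (L - e l)" if "k \<in> K" for k
    proof (cases "t k l = 0")
      case nz: False
      then have "L - e l = m k * q k" using ev[OF l that] by simp
      then show ?thesis using q_pos[OF that] m[OF that] by (simp add: field_simps)
    qed simp
    then have "(\<Sum>k\<in>K. t k l * t k l / q k) = (\<Sum>k\<in>K. m k * (t k l * t k l)) / (L - e l)"
      by (simp add: sum_divide_distrib)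
    then show ?thesis using gap[OF l] False by simp
  qed
  have "real (card {l \<in> {..<n}. e l \<noteq> L}) = (\<Sum>l<n. if e l \<noteq> L then 1 else 0)"
    by (simp add: sum.If_cases Int_def)
  also have "\<dots> = (\<Sum>l<n. \<Sum>k\<in>K. t k l * t k l / q k)" using weight by (intro sum.cong) auto
  also have "\<dots> = (\<Sum>k\<in>K. (\<Sum>l<n. t k l * t k l) / q k)"
    by (subst sum.swap) (simp add: sum_divide_distrib)
  also have "\<dots> = card K" using q_pos by (simp add: parseval order.strict_iff_order)
  finally have "card {l \<in> {..<n}. e l \<noteq> L} = card K" by simp
  then have c: "card {l \<in> {..<n}. e l = L} = n - card K"
    using card_complement_of_eq[of n e L] by simp
  then have "{l \<in> {..<n}. e l = L} \<noteq> {}" using K by (metis card.empty diff_is_0_eq not_le)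
  then have "Max (spectrum A) = L" unfolding spec using e_le by (intro Max_eqI) auto
  then show ?thesis using c ord[of L] by (simp add: max_eigenvalue_mult_def)
qed

section \<open>Shortest walks and isomorphisms\<close>

text \<open>A natural-number counterpart of \<open>graph_dist\<close>, on which case distinctions
  and induction are possible. It is meaningful only if a walk exists, hence the connected locale
  below.\<close>

definition walk_dist :: "'a pair_pre_digraph \<Rightarrow> 'a \<Rightarrow> 'a \<Rightarrow> nat" where
  "walk_dist G u v = (LEAST k. \<exists>p. pre_digraph.awalk (with_proj G) u p v \<and> length p = k)"

locale connected_pair_graph = pair_graph +
  assumes conn: "Digraph_Component.connected (with_proj G)"
begin

lemma awalk_cost_unit: "awalk_cost (\<lambda>_. 1) p = real (length p)"
  by (induction p) auto

lemma ex_awalk: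
  assumes "u \<in> pverts G" "v \<in> pverts G" shows "\<exists>p. awalk u p v"
proof -
  have "u \<rightarrow>\<^sup>*\<^bsub>with_proj (mk_symmetric (with_proj G))\<^esub> v"
    using conn assms unfolding Digraph_Component.connected_def by (auto elim!: strongly_connectedE)
  then have "u \<rightarrow>\<^sup>*\<^bsub>with_proj G\<^esub> v"
    using reachable_mk_symmetric_eq[OF sym_arcs] by simp
  then show ?thesis by (simp add: reachable_awalk)
qed

lemma walk_dist_le: "awalk u p v \<Longrightarrow> walk_dist G u v \<le> length p"
  unfolding walk_dist_def by (intro Least_le exI[of _ p] conjI refl)

lemma shortest_awalk:
  assumes "u \<in> pverts G" "v \<in> pverts G"
  obtains p where "awalk u p v" "length p = walk_dist G u v"
proof -
  have "\<exists>k p. awalk u p v \<and> length p = k" using ex_awalk[OF assms] by blast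
  then have "\<exists>p. awalk u p v \<and> length p = walk_dist G u v"
    unfolding walk_dist_def by (rule LeastI_ex)
  then show thesis using that by blast
qed

text \<open>Between reachable vertices the infimum is attained by a path, and with unit costs its
  value is a length; so the conversion from extended reals loses nothing.\<close>

lemma graph_dist_eq:
  assumes "u \<in> pverts G" "v \<in> pverts G"
  shows "graph_dist G u v = real (walk_dist G u v)"
proof -
  have "u \<rightarrow>\<^sup>*\<^bsub>with_proj G\<^esub> v" using ex_awalk[OF assms] by (simp add: reachable_awalk)
  then obtain p where p: "apath u p v" "\<mu> (\<lambda>_. 1) u v = awalk_cost (\<lambda>_. 1) p"
    using min_cost_awalk[of u v "\<lambda>_. 1"] by auto
  then have "awalk u p v" by (auto simp: apath_def)
  obtain q where q: "awalk u q v" "length q = walk_dist G u v" using shortest_awalk[OF assms] .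
  have "\<mu> (\<lambda>_. 1) u v \<le> awalk_cost (\<lambda>_. 1) q" using q(1) by (rule min_cost_le_walk_cost)
  then have "length p \<le> length q" using p(2) by (simp add: awalk_cost_unit)
  then have "length p = walk_dist G u v" using walk_dist_le[OF \<open>awalk u p v\<close>] q by simp
  then show ?thesis using p(2) by (simp add: graph_dist_def awalk_cost_unit)
qed

lemma walk_dist_eq_0:
  assumes "u \<in> pverts G" "v \<in> pverts G" shows "walk_dist G u v = 0 \<longleftrightarrow> u = v"
proof
  assume "walk_dist G u v = 0"
  then show "u = v" using shortest_awalk[OF assms] by (metis awalk_Nil_iff length_0_conv)
next
  assume "u = v"
  then have "awalk u [] v" using assms by (simp add: awalk_Nil_iff)
  from walk_dist_le[OF this] show "walk_dist G u v = 0" by simp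
qed

lemma walk_dist_commute:
  assumes "u \<in> pverts G" "v \<in> pverts G" shows "walk_dist G u v = walk_dist G v u"
proof -
  have len: "length (rev_path p) = length p" for p :: "('a \<times> 'a) list" by (induction p) auto
  have "walk_dist G v u \<le> walk_dist G u v" if uv: "u \<in> pverts G" "v \<in> pverts G" for u v
  proof -
    obtain p where p: "awalk u p v" "length p = walk_dist G u v" using shortest_awalk[OF uv] .
    show ?thesis using walk_dist_le[OF awalk_rev_path'[OF p(1)]] p(2) len[of p] by simp
  qed
  then show ?thesis using assms by (simp add: order.antisym)
qed

lemma walk_dist_triangle:
  assumes "u \<in> pverts G" "v \<in> pverts G" "w \<in> pverts G"
  shows "walk_dist G u w \<le> walk_dist G u v + walk_dist G v w"
proof -
  obtain p where p: "awalk u p v" "length p = walk_dist G u v" using shortest_awalk[OF assms(1,2)] .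
  obtain q where q: "awalk v q w" "length q = walk_dist G v w" using shortest_awalk[OF assms(2,3)] .
  have "awalk u (p @ q) w" using p(1) q(1) by (rule awalk_appendI)
  then have "walk_dist G u w \<le> length (p @ q)" by (rule walk_dist_le)
  then show ?thesis using p q by simp
qed

lemma walk_dist_eq_1:
  assumes "u \<in> pverts G" "v \<in> pverts G" shows "walk_dist G u v = 1 \<longleftrightarrow> (u, v) \<in> parcs G"
proof
  assume "walk_dist G u v = 1"
  then obtain p where "awalk u p v" "length p = 1" using shortest_awalk[OF assms] by metis
  then obtain a where "p = [a]" by (auto simp: length_Suc_conv)
  then show "(u, v) \<in> parcs G" using \<open>awalk u p v\<close> by (cases a) (auto simp: awalk_simps)
next
  assume uv: "(u, v) \<in> parcs G"
  then have "awalk u [(u, v)] v" using assms by (auto simp: awalk_simps)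
  then have "walk_dist G u v \<le> length [(u, v)]" by (rule walk_dist_le)
  then have "walk_dist G u v \<le> 1" by simp
  moreover have "u \<noteq> v" using uv no_loops' by blast
  ultimately show "walk_dist G u v = 1" using walk_dist_eq_0[OF assms] by linarith
qed

lemma walk_dist_step:
  assumes "u \<in> pverts G" "v \<in> pverts G" "u \<noteq> v"
  shows "\<exists>w\<in>pverts G. walk_dist G u w = 1 \<and> walk_dist G u v = walk_dist G w v + 1"
proof -
  obtain p where p: "awalk u p v" "length p = walk_dist G u v" using shortest_awalk[OF assms(1,2)] .
  then obtain a p' where ap: "p = a # p'" using assms by (cases p) (auto simp: awalk_Nil_iff)
  define w where "w = snd a"
  have a: "(u, w) \<in> parcs G" "awalk w p' v"
    using p(1) by (auto simp: ap awalk_Cons_iff w_def)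
  then have w: "w \<in> pverts G" by (auto dest: in_arcsD2)
  have "walk_dist G u w = 1" using walk_dist_eq_1 a(1) assms(1) w by blast
  moreover have "walk_dist G w v \<le> length p'" using a(2) by (rule walk_dist_le)
  moreover have "walk_dist G u v \<le> walk_dist G u w + walk_dist G w v"
    using walk_dist_triangle assms w by blast
  ultimately show ?thesis using w p(2) ap by (intro bexI[of _ w]) auto
qed

end

lemma connected_if_common_neighbours:
  assumes G: "pair_graph G" and ne: "pverts G \<noteq> {}"
    and nb: "\<And>u v. u \<in> pverts G \<Longrightarrow> v \<in> pverts G \<Longrightarrow> u \<noteq> v \<Longrightarrow> (u, v) \<notin> parcs G \<Longrightarrow>
      \<exists>w. (u, w) \<in> parcs G \<and> (w, v) \<in> parcs G"
  shows "Digraph_Component.connected (with_proj G)"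
proof -
  interpret pair_graph G by fact
  have "\<exists>p. awalk u p v" if uv: "u \<in> pverts G" "v \<in> pverts G" for u v
  proof -
    consider "u = v" | "(u, v) \<in> parcs G" | w where "(u, w) \<in> parcs G" "(w, v) \<in> parcs G"
      using nb[OF uv] by blast
    then show ?thesis
    proof cases
      case 1
      then show ?thesis using uv by (intro exI[of _ "[]"]) (simp add: awalk_Nil_iff)
    next
      case 2
      then show ?thesis using uv by (intro exI[of _ "[(u, v)]"]) (auto simp: awalk_simps)
    next
      case (3 w)
      then show ?thesis using uv
        by (intro exI[of _ "[(u, w), (w, v)]"]) (auto simp: awalk_simps dest: in_arcsD2)
    qed
  qed
  then have "u \<rightarrow>\<^sup>*\<^bsub>with_proj G\<^esub> v" if "u \<in> pverts G" "v \<in> pverts G" for u v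
    using that by (simp add: reachable_awalk)
  then show ?thesis
    unfolding Digraph_Component.connected_def
    using ne reachable_mk_symmetric_eq[OF sym_arcs] by (intro strongly_connectedI) auto
qed

section \<open>Isomorphism as an adjacency-preserving bijection\<close>

definition adj_iso :: "'a pair_pre_digraph \<Rightarrow> 'b pair_pre_digraph \<Rightarrow> bool" where
  "adj_iso G H \<longleftrightarrow> (\<exists>h. bij_betw h (pverts G) (pverts H) \<and>
     (\<forall>u\<in>pverts G. \<forall>v\<in>pverts G. (u, v) \<in> parcs G \<longleftrightarrow> (h u, h v) \<in> parcs H))"

text \<open>Arcs are pairs of vertices, so the arc map of an isomorphism is determined by its vertex
  map. Well-formedness of G must be stated separately, since \<open>adj_iso\<close> does not look at
  arcs that leave the vertex set.\<close>

lemma iso_graph_iff_adj_iso: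
  assumes H: "pair_wf_digraph H"
  shows "G \<simeq>\<^sub>G H \<longleftrightarrow> pair_wf_digraph G \<and> adj_iso G H"
proof
  assume "G \<simeq>\<^sub>G H"
  then obtain h where h: "pre_digraph.digraph_isomorphism (with_proj G) h" "with_proj H = app_iso h (with_proj G)"
    by (auto simp: iso_graph_def digraph_iso_def)
  have wf: "pair_wf_digraph G"
    using h(1) by (auto simp: pre_digraph.digraph_isomorphism_def wf_digraph_wp_iff)
  have inj: "inj_on (iso_verts h) (pverts G)"
    using h(1) by (auto simp: pre_digraph.digraph_isomorphism_def)
  have V: "pverts H = iso_verts h ` pverts G" and E: "parcs H = iso_arcs h ` parcs G"
    using arg_cong[OF h(2), of verts] arg_cong[OF h(2), of arcs] by simp_all
  have "iso_tail h = fst" "iso_head h = snd"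
    using arg_cong[OF h(2), of tail] arg_cong[OF h(2), of head] by simp_all
  then have arc: "iso_arcs h (u, v) = (iso_verts h u, iso_verts h v)" if "(u, v) \<in> parcs G" for u v
    using h(1) that by (force simp: pre_digraph.digraph_isomorphism_def prod_eq_iff)
  have "(u, v) \<in> parcs G \<longleftrightarrow> (iso_verts h u, iso_verts h v) \<in> parcs H"
    if uv: "u \<in> pverts G" "v \<in> pverts G" for u v
  proof
    assume "(u, v) \<in> parcs G"
    then show "(iso_verts h u, iso_verts h v) \<in> parcs H" using arc E by force
  next
    assume "(iso_verts h u, iso_verts h v) \<in> parcs H"
    then obtain a b where ab: "(a, b) \<in> parcs G" "(iso_verts h u, iso_verts h v) = iso_arcs h (a, b)"
      using E by auto
    then have "a \<in> pverts G" "b \<in> pverts G"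
      using pair_wf_digraph.in_arcsD1[OF wf] pair_wf_digraph.in_arcsD2[OF wf] by auto
    then have "a = u" "b = v" using ab(2) arc[OF ab(1)] inj uv by (auto dest: inj_onD)
    then show "(u, v) \<in> parcs G" using ab by simp
  qed
  then show "pair_wf_digraph G \<and> adj_iso G H"
    using wf inj V unfolding adj_iso_def by (intro conjI exI[of _ "iso_verts h"]) (auto simp: bij_betw_def)
next
  assume "pair_wf_digraph G \<and> adj_iso G H"
  then obtain h where wf: "pair_wf_digraph G" and h: "bij_betw h (pverts G) (pverts H)"
    "\<And>u v. u \<in> pverts G \<Longrightarrow> v \<in> pverts G \<Longrightarrow> (u, v) \<in> parcs G \<longleftrightarrow> (h u, h v) \<in> parcs H"
    by (auto simp: adj_iso_def)
  have inj: "inj_on h (pverts G)" and V: "pverts H = h ` pverts G" using h(1) by (auto simp: bij_betw_def)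
  have GV: "u \<in> pverts G \<and> v \<in> pverts G" if "(u, v) \<in> parcs G" for u v
    using pair_wf_digraph.in_arcsD1[OF wf that] pair_wf_digraph.in_arcsD2[OF wf that] by simp
  define k where "k = \<lparr>iso_verts = h, iso_arcs = map_prod h h, iso_head = snd, iso_tail = fst\<rparr>"
  have "parcs H = map_prod h h ` parcs G"
  proof (intro equalityI subsetI)
    fix a assume a: "a \<in> parcs H"
    then obtain x y where xy: "a = (x, y)" "x \<in> pverts H" "y \<in> pverts H"
      using pair_wf_digraph.in_arcsD1[OF H] pair_wf_digraph.in_arcsD2[OF H] by (metis surj_pair)
    then obtain u v where "u \<in> pverts G" "v \<in> pverts G" "x = h u" "y = h v" using V by auto
    then show "a \<in> map_prod h h ` parcs G" using h(2)[of u v] a xy by force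
  next
    fix a assume "a \<in> map_prod h h ` parcs G"
    then show "a \<in> parcs H" using h(2) GV by auto
  qed
  then have "with_proj H = app_iso k (with_proj G)"
    using V by (simp add: k_def app_iso_def with_proj_def)
  moreover have "inj_on (map_prod h h) (parcs G)"
    using GV by (intro inj_on_subset[OF map_prod_inj_on[OF inj inj]]) auto
  then have "pre_digraph.digraph_isomorphism (with_proj G) k"
    using inj wf by (auto simp: pre_digraph.digraph_isomorphism_def k_def wf_digraph_wp_iff)
  ultimately show "G \<simeq>\<^sub>G H" unfolding iso_graph_def digraph_iso_def by blast
qed

lemma adj_iso_sym:
  assumes "adj_iso G H" shows "adj_iso H G"
proof -
  obtain h where h: "bij_betw h (pverts G) (pverts H)"
    "\<And>u v. u \<in> pverts G \<Longrightarrow> v \<in> pverts G \<Longrightarrow> (u, v) \<in> parcs G \<longleftrightarrow> (h u, h v) \<in> parcs H"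
    using assms by (auto simp: adj_iso_def)
  define k where "k = the_inv_into (pverts G) h"
  have k: "bij_betw k (pverts H) (pverts G)" unfolding k_def by (rule bij_betw_the_inv_into[OF h(1)])
  have "h (k u) = u" "k u \<in> pverts G" if "u \<in> pverts H" for u
    using that h(1) k by (auto simp: k_def f_the_inv_into_f_bij_betw bij_betw_apply)
  then show ?thesis unfolding adj_iso_def using k h(2) by (intro exI[of _ k]) auto
qed

lemma adj_iso_trans:
  assumes "adj_iso G H" "adj_iso H K" shows "adj_iso G K"
proof -
  obtain h where h: "bij_betw h (pverts G) (pverts H)"
    "\<And>u v. u \<in> pverts G \<Longrightarrow> v \<in> pverts G \<Longrightarrow> (u, v) \<in> parcs G \<longleftrightarrow> (h u, h v) \<in> parcs H"
    using assms(1) by (auto simp: adj_iso_def)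
  obtain k where k: "bij_betw k (pverts H) (pverts K)"
    "\<And>u v. u \<in> pverts H \<Longrightarrow> v \<in> pverts H \<Longrightarrow> (u, v) \<in> parcs H \<longleftrightarrow> (k u, k v) \<in> parcs K"
    using assms(2) by (auto simp: adj_iso_def)
  have "h u \<in> pverts H" if "u \<in> pverts G" for u using h(1) that by (rule bij_betw_apply)
  then show ?thesis unfolding adj_iso_def
    using bij_betw_trans[OF h(1) k(1)] h(2) k(2) by (intro exI[of _ "k \<circ> h"]) auto
qed

text \<open>Numbering the vertices inside each label class turns a labelling into a bijection onto
  the standard vertex set of a multipartite graph.\<close>

lemma ex_class_bij:
  assumes fin: "finite V" and l: "\<And>v. v \<in> V \<Longrightarrow> l v < length as"
    and c: "\<And>i. i < length as \<Longrightarrow> card {v \<in> V. l v = i} = as ! i"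
  obtains h where "bij_betw h V {(i, j). i < length as \<and> j < as ! i}" "\<And>v. v \<in> V \<Longrightarrow> fst (h v) = l v"
proof -
  have "\<forall>i. \<exists>b. i < length as \<longrightarrow> bij_betw b {v \<in> V. l v = i} {..<as ! i}"
  proof
    fix i show "\<exists>b. i < length as \<longrightarrow> bij_betw b {v \<in> V. l v = i} {..<as ! i}"
      using finite_same_card_bij[of "{v \<in> V. l v = i}" "{..<as ! i}"] fin c[of i] by auto
  qed
  then obtain b where b: "\<And>i. i < length as \<Longrightarrow> bij_betw (b i) {v \<in> V. l v = i} {..<as ! i}"
    by metis
  define h where "h v = (l v, b (l v) v)" for v
  have "inj_on h V"
  proof (rule inj_onI)
    fix v w assume vw: "v \<in> V" "w \<in> V" "h v = h w"
    then have "inj_on (b (l v)) {x \<in> V. l x = l v}" using b[OF l[OF vw(1)]] by (simp add: bij_betw_def)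
    then show "v = w" using vw by (auto simp: h_def dest: inj_onD)
  qed
  moreover have "h ` V = {(i, j). i < length as \<and> j < as ! i}"
  proof (intro equalityI subsetI)
    fix x assume "x \<in> h ` V"
    then obtain v where v: "v \<in> V" "x = h v" by auto
    then show "x \<in> {(i, j). i < length as \<and> j < as ! i}"
      using l[OF v(1)] bij_betw_apply[OF b[OF l[OF v(1)]], of v] by (simp add: h_def)
  next
    fix x assume "x \<in> {(i, j). i < length as \<and> j < as ! i}"
    then obtain i j where x: "x = (i, j)" "i < length as" "j < as ! i" by auto
    have "j \<in> b i ` {v \<in> V. l v = i}" using b[OF x(2)] x(3) by (simp add: bij_betw_def)
    then show "x \<in> h ` V" using x by (auto simp: h_def)
  qed
  ultimately show thesis using that[of h] by (simp add: bij_betw_def h_def)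
qed

lemma pverts_complete_multipartite: "pverts (complete_multipartite as) = {(i, j). i < length as \<and> j < as ! i}"
  and parcs_complete_multipartite: "parcs (complete_multipartite as) =
    {(u, v). u \<in> pverts (complete_multipartite as) \<and> v \<in> pverts (complete_multipartite as) \<and> fst u \<noteq> fst v}"
  by (simp_all add: complete_multipartite_def Let_def)

lemma multipartite_classes:
  assumes "bij_betw h V {(i, j). i < length as \<and> j < as ! i}" "i < length as"
  shows "card {v \<in> V. fst (h v) = i} = as ! i"
proof -
  have inj: "inj_on h V" and im: "h ` V = {(i, j). i < length as \<and> j < as ! i}"
    using assms(1) by (auto simp: bij_betw_def)
  have "h ` {v \<in> V. fst (h v) = i} = {x \<in> h ` V. fst x = i}" by auto
  also have "\<dots> = {i} \<times> {..<as ! i}" unfolding im using assms(2) by auto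
  finally have "card (h ` {v \<in> V. fst (h v) = i}) = as ! i" by (simp add: card_cartesian_product)
  moreover have "inj_on h {v \<in> V. fst (h v) = i}" using inj by (rule inj_on_subset) auto
  ultimately show ?thesis by (simp add: card_image)
qed

lemma finite_complete_multipartite: "finite (pverts (complete_multipartite as))"
proof -
  have "pverts (complete_multipartite as) = (SIGMA i:{..<length as}. {..<as ! i})"
    by (auto simp: pverts_complete_multipartite)
  then show ?thesis by simp
qed

lemma adj_iso_finite:
  assumes "adj_iso G H" "finite (pverts H)"
  shows "finite (pverts G)" "card (pverts G) = card (pverts H)"
  using assms by (auto simp: adj_iso_def bij_betw_finite bij_betw_same_card)

abbreviation adj :: "'a pair_pre_digraph \<Rightarrow> 'a \<Rightarrow> 'a \<Rightarrow> bool" where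
  "adj G u v \<equiv> (u, v) \<in> parcs G"

lemma adj_iso_complete_multipartite:
  assumes "finite (pverts G)"
  shows "adj_iso G (complete_multipartite as) \<longleftrightarrow> multipartite_on (pverts G) (adj G) as"
proof
  assume "adj_iso G (complete_multipartite as)"
  then obtain h where h: "bij_betw h (pverts G) {(i, j). i < length as \<and> j < as ! i}"
    "\<And>u v. u \<in> pverts G \<Longrightarrow> v \<in> pverts G \<Longrightarrow> adj G u v \<longleftrightarrow> (h u, h v) \<in> parcs (complete_multipartite as)"
    by (auto simp: adj_iso_def pverts_complete_multipartite)
  have hv: "h v \<in> {(i, j). i < length as \<and> j < as ! i}" if "v \<in> pverts G" for v
    using h(1) that by (rule bij_betw_apply)
  show "multipartite_on (pverts G) (adj G) as"
    unfolding multipartite_on_def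
  proof (intro exI[of _ "\<lambda>v. fst (h v)"] conjI ballI allI impI)
    show "fst (h v) < length as" if "v \<in> pverts G" for v using hv[OF that] by auto
    show "card {v \<in> pverts G. fst (h v) = i} = as ! i" if "i < length as" for i
      using h(1) that by (rule multipartite_classes)
    show "adj G u v \<longleftrightarrow> fst (h u) \<noteq> fst (h v)" if "u \<in> pverts G" "v \<in> pverts G" for u v
      using h(2)[OF that] hv[OF that(1)] hv[OF that(2)]
      by (simp add: parcs_complete_multipartite pverts_complete_multipartite)
  qed
next
  assume "multipartite_on (pverts G) (adj G) as"
  then obtain l where l: "\<And>v. v \<in> pverts G \<Longrightarrow> l v < length as"
    "\<And>i. i < length as \<Longrightarrow> card {v \<in> pverts G. l v = i} = as ! i"
    "\<And>v w. v \<in> pverts G \<Longrightarrow> w \<in> pverts G \<Longrightarrow> adj G v w \<longleftrightarrow> l v \<noteq> l w"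
    unfolding multipartite_on_def by blast
  obtain h where h: "bij_betw h (pverts G) {(i, j). i < length as \<and> j < as ! i}"
    "\<And>v. v \<in> pverts G \<Longrightarrow> fst (h v) = l v"
    using ex_class_bij[OF assms l(1,2)] by blast
  have hv: "h v \<in> {(i, j). i < length as \<and> j < as ! i}" if "v \<in> pverts G" for v
    using h(1) that by (rule bij_betw_apply)
  have "adj G u v \<longleftrightarrow> (h u, h v) \<in> parcs (complete_multipartite as)"
    if "u \<in> pverts G" "v \<in> pverts G" for u v
    using hv[OF that(1)] hv[OF that(2)] h(2) l(3)[OF that] that
    by (simp add: parcs_complete_multipartite pverts_complete_multipartite)
  then show "adj_iso G (complete_multipartite as)"
    unfolding adj_iso_def using h(1) by (intro exI[of _ h]) (simp add: pverts_complete_multipartite)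
qed

lemma less_Suc_Suc_0: "i < Suc (Suc 0) \<longleftrightarrow> i = 0 \<or> i = 1"
  by auto

lemma adj_iso_plus_edge_if:
  assumes fin: "finite (pverts G)" and "bipartite_plus_edge_on (pverts G) (adj G) k"
  shows "\<exists>H \<in> plus_edge (complete_multipartite [k, card (pverts G) - k]). adj_iso G H"
proof -
  obtain K a b where K: "K \<subseteq> pverts G" "card K = k" "a \<in> pverts G - K" "b \<in> pverts G - K" "a \<noteq> b"
    and E: "\<And>v w. v \<in> pverts G \<Longrightarrow> w \<in> pverts G \<Longrightarrow> adj G v w \<longleftrightarrow> (v \<in> K) \<noteq> (w \<in> K) \<or> {v, w} = {a, b}"
    using assms(2) unfolding bipartite_plus_edge_on_def by blast
  define as where "as = [k, card (pverts G) - k]"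
  define l where "l v = (if v \<in> K then 0 else 1 :: nat)" for v
  have "{v \<in> pverts G. l v = 0} = K" "{v \<in> pverts G. l v = 1} = pverts G - K"
    using K(1) by (auto simp: l_def)
  then have c: "card {v \<in> pverts G. l v = i} = as ! i" if "i < length as" for i
    using that K(1,2) fin by (auto simp: as_def less_Suc_Suc_0 card_Diff_subset finite_subset)
  have "l v < length as" for v by (simp add: l_def as_def)
  then obtain h where h: "bij_betw h (pverts G) {(i, j). i < length as \<and> j < as ! i}"
    "\<And>v. v \<in> pverts G \<Longrightarrow> fst (h v) = l v"
    using ex_class_bij[OF fin _ c] by blast
  have inj: "inj_on h (pverts G)" using h(1) by (simp add: bij_betw_def)
  have hv: "h v \<in> pverts (complete_multipartite as)" if "v \<in> pverts G" for v
    using bij_betw_apply[OF h(1) that] by (simp add: pverts_complete_multipartite)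
  define H where "H = add_edge (complete_multipartite as) (h a) (h b)"
  have ab: "a \<in> pverts G" "b \<in> pverts G" "l a = l b" using K by (auto simp: l_def)
  have "H \<in> plus_edge (complete_multipartite as)"
  proof -
    have "h a \<noteq> h b" using inj ab K(5) by (auto dest: inj_onD)
    moreover have "(h a, h b) \<notin> parcs (complete_multipartite as)"
      using ab h(2) by (simp add: parcs_complete_multipartite)
    ultimately show ?thesis unfolding H_def plus_edge_def using hv[OF ab(1)] hv[OF ab(2)] by blast
  qed
  moreover have "adj G v w \<longleftrightarrow> (h v, h w) \<in> parcs H" if "v \<in> pverts G" "w \<in> pverts G" for v w
  proof -
    have "h v = h a \<longleftrightarrow> v = a" "h w = h a \<longleftrightarrow> w = a" "h v = h b \<longleftrightarrow> v = b" "h w = h b \<longleftrightarrow> w = b"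
      using inj that ab by (auto dest: inj_onD)
    moreover have "(v \<in> K) \<noteq> (w \<in> K) \<longleftrightarrow> fst (h v) \<noteq> fst (h w)" using h(2) that by (auto simp: l_def)
    ultimately show ?thesis
      using E[OF that] hv that
      by (auto simp: H_def add_edge_def parcs_complete_multipartite doubleton_eq_iff)
  qed
  then have "adj_iso G H"
    unfolding adj_iso_def using h(1) by (intro exI[of _ h]) (simp add: pverts_complete_multipartite H_def add_edge_def)
  ultimately show ?thesis unfolding as_def by blast
qed

text \<open>\<open>plus_edge\<close> allows the new edge in either part, while k is the size of the
  part without it. For k = 1 the first part has too few vertices to hold the edge; for k = m both
  parts have the same size. So K is chosen as the part opposite to the edge.\<close>

lemma bipartite_plus_edge_if:
  assumes "H \<in> plus_edge (complete_multipartite [k, m])" "adj_iso G H" "k = 1 \<or> k = m"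
  shows "bipartite_plus_edge_on (pverts G) (adj G) k"
proof -
  define M where "M = complete_multipartite [k, m]"
  obtain x y where xy: "x \<in> pverts M" "y \<in> pverts M" "x \<noteq> y" "(x, y) \<notin> parcs M" "H = add_edge M x y"
    using assms(1) unfolding plus_edge_def M_def by blast
  then have H: "pverts H = pverts M" "parcs H = parcs M \<union> {(x, y), (y, x)}"
    by (simp_all add: add_edge_def)
  have fxy: "fst x = fst y" using xy by (simp add: M_def parcs_complete_multipartite)
  obtain h where h: "bij_betw h (pverts G) (pverts M)"
    "\<And>u v. u \<in> pverts G \<Longrightarrow> v \<in> pverts G \<Longrightarrow> adj G u v \<longleftrightarrow> (h u, h v) \<in> parcs H"
    using assms(2) H(1) by (auto simp: adj_iso_def)
  have inj: "inj_on h (pverts G)" using h(1) by (simp add: bij_betw_def)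
  have hv: "h v \<in> pverts M" if "v \<in> pverts G" for v using h(1) that by (rule bij_betw_apply)
  have M: "pverts M = {(i, j). i < length [k, m] \<and> j < [k, m] ! i}"
    by (simp add: M_def pverts_complete_multipartite)
  obtain a b where ab: "a \<in> pverts G" "h a = x" "b \<in> pverts G" "h b = y"
  proof -
    have "x \<in> h ` pverts G" "y \<in> h ` pverts G" using h(1) xy(1,2) by (auto simp: bij_betw_def)
    then show thesis using that by blast
  qed
  define K where "K = {v \<in> pverts G. fst (h v) = 1 - fst x}"
  have fx: "fst x = 0 \<or> fst x = 1" using xy(1) unfolding M by auto
  have fv: "fst (h v) = 0 \<or> fst (h v) = 1" if "v \<in> pverts G" for v using hv[OF that] unfolding M by auto
  have "card K = [k, m] ! (1 - fst x)"
    unfolding K_def using h(1)[unfolded M] fx by (intro multipartite_classes) auto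
  moreover have "\<not> (k = 1 \<and> fst x = 0)"
  proof
    assume k: "k = 1 \<and> fst x = 0"
    have "snd x < [k, m] ! fst x" "snd y < [k, m] ! fst y" using xy(1,2) unfolding M by auto
    then show False using xy(3) fxy k by (simp add: prod_eq_iff)
  qed
  ultimately have "card K = k" using assms(3) fx by auto
  moreover have "adj G v w \<longleftrightarrow> (v \<in> K) \<noteq> (w \<in> K) \<or> {v, w} = {a, b}" if "v \<in> pverts G" "w \<in> pverts G" for v w
  proof -
    have "h v = x \<longleftrightarrow> v = a" "h w = x \<longleftrightarrow> w = a" "h v = y \<longleftrightarrow> v = b" "h w = y \<longleftrightarrow> w = b"
      using inj that ab by (auto dest: inj_onD)
    moreover have "(v \<in> K) \<noteq> (w \<in> K) \<longleftrightarrow> fst (h v) \<noteq> fst (h w)"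
      using fv[OF that(1)] fv[OF that(2)] fx that by (auto simp: K_def)
    ultimately show ?thesis
      using h(2)[OF that] hv that
      by (auto simp: H(2) M_def parcs_complete_multipartite doubleton_eq_iff)
  qed
  ultimately show ?thesis
    unfolding bipartite_plus_edge_on_def using ab xy(3) fxy fx
    by (intro exI[of _ K] exI[of _ a] exI[of _ b]) (auto simp: K_def)
qed

lemma adj_iso_double_cone:
  assumes fin: "finite (pverts G)" and n: "card (pverts G) = n" "n \<ge> 2"
  shows "adj_iso G (complete_graph 2 \<nabla> copies (n - 2) (complete_graph 1)) \<longleftrightarrow> double_cone_on (pverts G) (adj G)"
proof -
  define H where "H = complete_graph 2 \<nabla> copies (n - 2) (complete_graph 1)"
  have V: "pverts H = {..<2} <+> {..<n - 2} \<times> {..<1}"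
    by (simp add: H_def join_graph_def complete_graph_def copies_def)
  have E: "(x, y) \<in> parcs H \<longleftrightarrow> x \<noteq> y \<and> (isl x \<or> isl y)" if "x \<in> pverts H" "y \<in> pverts H" for x y
    using that by (auto simp: H_def join_graph_def complete_graph_def copies_def image_iff)
  show ?thesis
    unfolding H_def[symmetric]
  proof
    assume "adj_iso G H"
    then obtain h where h: "bij_betw h (pverts G) (pverts H)"
      "\<And>u v. u \<in> pverts G \<Longrightarrow> v \<in> pverts G \<Longrightarrow> adj G u v \<longleftrightarrow> (h u, h v) \<in> parcs H"
      by (auto simp: adj_iso_def)
    have inj: "inj_on h (pverts G)" and im: "h ` pverts G = pverts H" using h(1) by (auto simp: bij_betw_def)
    define S where "S = {v \<in> pverts G. isl (h v)}"
    have "h ` S = {x \<in> pverts H. isl x}" unfolding S_def im[symmetric] by auto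
    also have "\<dots> = Inl ` {..<2}" unfolding V by auto
    finally have "card (h ` S) = 2" by (simp add: card_image)
    moreover have "inj_on h S" using inj by (rule inj_on_subset) (auto simp: S_def)
    ultimately have "card S = 2" by (simp add: card_image)
    moreover have "adj G v w \<longleftrightarrow> v \<noteq> w \<and> (v \<in> S \<or> w \<in> S)" if "v \<in> pverts G" "w \<in> pverts G" for v w
      using h(2)[OF that] E[of "h v" "h w"] that im inj by (auto simp: S_def dest: inj_onD)
    ultimately show "double_cone_on (pverts G) (adj G)"
      unfolding double_cone_on_def by (intro exI[of _ S]) (auto simp: S_def)
  next
    assume "double_cone_on (pverts G) (adj G)"
    then obtain S where S: "S \<subseteq> pverts G" "card S = 2"
      "\<And>v w. v \<in> pverts G \<Longrightarrow> w \<in> pverts G \<Longrightarrow> adj G v w \<longleftrightarrow> v \<noteq> w \<and> (v \<in> S \<or> w \<in> S)"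
      unfolding double_cone_on_def by blast
    have finS: "finite S" using S(1) fin finite_subset by blast
    obtain f where f: "bij_betw f S {..<2::nat}"
      using finite_same_card_bij[OF finS, of "{..<2::nat}"] S(2) by auto
    have "card (pverts G - S) = card ({..<n - 2} \<times> {..<1::nat})"
      using S n finS by (simp add: card_Diff_subset card_cartesian_product)
    then obtain g where g: "bij_betw g (pverts G - S) ({..<n - 2} \<times> {..<1::nat})"
      using finite_same_card_bij[of "pverts G - S" "{..<n - 2} \<times> {..<1::nat}"] fin by auto
    define h where "h v = (if v \<in> S then Inl (f v) else Inr (g v))" for v
    have "inj_on h (pverts G)"
      using f g by (intro inj_onI) (auto simp: h_def bij_betw_def split: if_splits dest: inj_onD)
    moreover have "h ` pverts G = pverts H"
    proof -
      have "h ` pverts G = h ` S \<union> h ` (pverts G - S)" using S(1) by auto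
      also have "h ` S = Inl ` f ` S" by (auto simp: h_def image_iff)
      also have "h ` (pverts G - S) = Inr ` g ` (pverts G - S)" by (auto simp: h_def image_iff)
      finally show ?thesis using f g by (simp add: V bij_betw_def Plus_def)
    qed
    ultimately have h: "bij_betw h (pverts G) (pverts H)" by (simp add: bij_betw_def)
    moreover have "adj G v w \<longleftrightarrow> (h v, h w) \<in> parcs H" if "v \<in> pverts G" "w \<in> pverts G" for v w
    proof -
      have "h v = h w \<longleftrightarrow> v = w" using \<open>inj_on h (pverts G)\<close> that by (auto dest: inj_onD)
      moreover have "isl (h v) \<longleftrightarrow> v \<in> S" "isl (h w) \<longleftrightarrow> w \<in> S" by (simp_all add: h_def)
      ultimately show ?thesis
        using S(3)[OF that] E[OF bij_betw_apply[OF h that(1)] bij_betw_apply[OF h that(2)]] by simp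
    qed
    ultimately show "adj_iso G H" unfolding adj_iso_def by blast
  qed
qed

text \<open>The one-vertex part becomes the left summand and the labels of the other two parts shift
  down by one.\<close>

lemma adj_iso_cone:
  "adj_iso (complete_multipartite [1, m, m]) (complete_graph 1 \<nabla> complete_multipartite [m, m])"
proof -
  define h :: "nat \<times> nat \<Rightarrow> nat + nat \<times> nat" where
    "h x = (case fst x of 0 \<Rightarrow> Inl (snd x) | Suc i \<Rightarrow> Inr (i, snd x))" for x
  define H where "H = complete_graph 1 \<nabla> complete_multipartite [m, m]"
  have V: "pverts H = {..<1} <+> {(i, j). i < length [m, m] \<and> j < [m, m] ! i}"
    by (simp add: H_def join_graph_def complete_graph_def pverts_complete_multipartite)
  have less3: "i < Suc (Suc (Suc 0)) \<longleftrightarrow> i = 0 \<or> i = 1 \<or> i = 2" for i by auto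
  have VM: "pverts (complete_multipartite [1, m, m]) = {(0, 0)} \<union> {1, 2} \<times> {..<m}"
    by (auto simp: pverts_complete_multipartite less3)
  have VH: "pverts H = {Inl 0} \<union> Inr ` ({0, 1} \<times> {..<m})"
    by (auto simp: V less_Suc_Suc_0)
  have "inj h" by (intro injI) (auto simp: h_def split: nat.splits)
  then have "inj_on h (pverts (complete_multipartite [1, m, m]))" by (rule inj_on_subset) auto
  moreover have "h ` pverts (complete_multipartite [1, m, m]) = pverts H"
  proof -
    have "h ` ({1, 2} \<times> {..<m}) = Inr ` ({0, 1} \<times> {..<m})"
    proof -
      have "{1, 2} \<times> {..<m} = map_prod Suc id ` ({0, 1} \<times> {..<m})" by (auto simp: image_iff)
      moreover have "h (map_prod Suc id x) = Inr x" for x by (simp add: h_def)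
      ultimately show ?thesis by (simp add: image_image)
    qed
    moreover have "h (0, 0) = Inl 0" by (simp add: h_def)
    ultimately show ?thesis unfolding VM VH image_Un by simp
  qed
  moreover have "(x, y) \<in> parcs (complete_multipartite [1, m, m]) \<longleftrightarrow> (h x, h y) \<in> parcs H"
    if "x \<in> pverts (complete_multipartite [1, m, m])" "y \<in> pverts (complete_multipartite [1, m, m])" for x y
  proof -
    have "(x, y) \<in> parcs (complete_multipartite [1, m, m]) \<longleftrightarrow> fst x \<noteq> fst y"
      using that by (simp add: parcs_complete_multipartite)
    moreover have "(h x, h y) \<in> parcs H \<longleftrightarrow> fst x \<noteq> fst y"
      using that unfolding VM
      by (auto simp: h_def H_def join_graph_def complete_graph_def image_iff less_Suc_Suc_0
          parcs_complete_multipartite pverts_complete_multipartite)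
    ultimately show ?thesis by simp
  qed
  ultimately show ?thesis
    unfolding H_def[symmetric] adj_iso_def by (intro exI[of _ h]) (auto simp: bij_betw_def)
qed

section \<open>Multiplicity of the largest eigenvalue of the distance Laplacian\<close>

lemma distance_laplacian_carrier: "distance_laplacian G vs \<in> carrier_mat (length vs) (length vs)"
  by (simp add: distance_laplacian_def distance_matrix_def mat_diag_def minus_carrier_mat)

lemma distance_laplacian_index:
  assumes "i < length vs" "j < length vs"
  shows "distance_laplacian G vs $$ (i, j) =
    (if i = j then transmission G (vs ! i) else 0) - graph_dist G (vs ! i) (vs ! j)"
  using assms by (simp add: distance_laplacian_def distance_matrix_def mat_diag_def)

lemma sum_nth_eq: "distinct vs \<Longrightarrow> (\<Sum>i<length vs. h (vs ! i)) = (\<Sum>v\<in>set vs. h v)" for h :: "'a \<Rightarrow> real"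
  using sum.reindex_bij_betw[OF bij_betw_nth[of vs "{..<length vs}" "set vs"], of h] by simp

lemma extremal_on_cong:
  assumes "\<And>u v. u \<in> V \<Longrightarrow> v \<in> V \<Longrightarrow> E u v \<longleftrightarrow> E' u v"
  shows "extremal_on V E \<longleftrightarrow> extremal_on V E'"
proof -
  have "multipartite_on V E as \<longleftrightarrow> multipartite_on V E' as" for as
    using assms by (simp add: multipartite_on_def cong: ball_cong)
  moreover have "bipartite_plus_edge_on V E k \<longleftrightarrow> bipartite_plus_edge_on V E' k" for k
    using assms by (simp add: bipartite_plus_edge_on_def cong: ball_cong)
  moreover have "double_cone_on V E \<longleftrightarrow> double_cone_on V E'"
    using assms by (simp add: double_cone_on_def cong: ball_cong)
  ultimately show ?thesis by (simp add: extremal_on_def)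
qed

context connected_pair_graph
begin

lemma distance_laplacian_symmetric:
  assumes "set vs = pverts G"
  shows "(distance_laplacian G vs)\<^sup>T = distance_laplacian G vs"
proof (rule eq_matI)
  fix i j assume "i < dim_row (distance_laplacian G vs)" "j < dim_col (distance_laplacian G vs)"
  then have ij: "i < length vs" "j < length vs"
    using distance_laplacian_carrier[of G vs] by auto
  then have "vs ! i \<in> pverts G" "vs ! j \<in> pverts G" using assms nth_mem by blast+
  then show "(distance_laplacian G vs)\<^sup>T $$ (i, j) = distance_laplacian G vs $$ (i, j)"
    using ij distance_laplacian_carrier[of G vs] graph_dist_eq walk_dist_commute[of "vs ! i" "vs ! j"]
    by (auto simp: distance_laplacian_index)
qed (use distance_laplacian_carrier[of G vs] in auto)

lemma distance_laplacian_row_sum: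
  assumes "distinct vs" "set vs = pverts G" "i < length vs"
  shows "(\<Sum>j<length vs. distance_laplacian G vs $$ (i, j)) = 0"
proof -
  have "(\<Sum>j<length vs. distance_laplacian G vs $$ (i, j)) =
      (\<Sum>j<length vs. (if i = j then transmission G (vs ! i) else 0)) - (\<Sum>j<length vs. graph_dist G (vs ! i) (vs ! j))"
    using assms(3) by (simp add: distance_laplacian_index sum_subtractf)
  also have "\<dots> = 0"
    using assms sum_nth_eq[OF assms(1), of "graph_dist G (vs ! i)"] by (simp add: transmission_def)
  finally show ?thesis .
qed

text \<open>The third vector of the decomposition is the all-ones vector with coefficient c. Since
  D^L annihilates it, L must be n c.\<close>

lemma max_eigenvalue_mult_if_weights:
  fixes w1 w2 :: "'a \<Rightarrow> real"
  assumes card: "card (pverts G) > 3"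
    and diam: "\<And>u v. u \<in> pverts G \<Longrightarrow> v \<in> pverts G \<Longrightarrow> walk_dist G u v \<le> 2"
    and vs: "distinct vs" "set vs = pverts G"
    and pos: "c > 0" "m1 > 0" "m2 > 0"
    and sums: "(\<Sum>v\<in>pverts G. w1 v) = 0" "(\<Sum>v\<in>pverts G. w2 v) = 0" "(\<Sum>v\<in>pverts G. w1 v * w2 v) = 0"
      "(\<Sum>v\<in>pverts G. w1 v * w1 v) \<noteq> 0" "(\<Sum>v\<in>pverts G. w2 v * w2 v) \<noteq> 0"
    and off_diag: "\<And>u v. u \<in> pverts G \<Longrightarrow> v \<in> pverts G \<Longrightarrow> u \<noteq> v \<Longrightarrow>
      c + m1 * (w1 u * w1 v) + m2 * (w2 u * w2 v) = (if (u, v) \<in> parcs G then 1 else 2)"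
  shows "max_eigenvalue_mult (distance_laplacian G vs) = card (pverts G) - 3"
proof -
  define n where "n = length vs"
  have n: "card (pverts G) = n" using vs distinct_card n_def by metis
  define m :: "nat \<Rightarrow> real" where "m k = (if k = 0 then c else if k = 1 then m1 else m2)" for k
  define w :: "nat \<Rightarrow> nat \<Rightarrow> real" where
    "w k i = (if k = 0 then 1 else if k = 1 then w1 (vs ! i) else w2 (vs ! i))" for k i
  have sum_vs: "(\<Sum>i<n. h (vs ! i)) = (\<Sum>v\<in>pverts G. h v)" for h :: "'a \<Rightarrow> real"
    using sum_nth_eq[OF vs(1), of h] vs(2) n_def by simp
  have K: "{..<3::nat} = {0, 1, 2}" by auto
  have orth: "(\<Sum>i<n. w k i * w l i) = 0" if "k \<in> {..<3}" "l \<in> {..<3}" "k \<noteq> l" for k l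
    using that sums(1-3) sum_vs[of w1] sum_vs[of w2] sum_vs[of "\<lambda>v. w1 v * w2 v"]
    unfolding K by (auto simp: w_def mult.commute)
  have dist: "graph_dist G u v = c + m1 * (w1 u * w1 v) + m2 * (w2 u * w2 v)"
    if uv: "u \<in> pverts G" "v \<in> pverts G" "u \<noteq> v" for u v
    using off_diag[OF uv] graph_dist_eq[OF uv(1,2)] walk_dist_eq_1[OF uv(1,2)] walk_dist_eq_0[OF uv(1,2)]
      diam[OF uv(1,2)] uv(3) by (cases "walk_dist G u v = 1") (auto simp: le_Suc_eq numeral_2_eq_2)
  have self: "graph_dist G u u = 0" if "u \<in> pverts G" for u
    using graph_dist_eq[OF that that] walk_dist_eq_0[OF that that] by simp
  \<comment> \<open>The off-diagonal formula, extended to v = u, sums to n c because both weights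
    sum to zero; its extra term at u is the diagonal entry of L I - D^L.\<close>
  have trans: "transmission G u = n * c - (c + m1 * (w1 u * w1 u) + m2 * (w2 u * w2 u))" if u: "u \<in> pverts G" for u
  proof -
    have fin: "finite (pverts G)" using vs by (metis List.finite_set)
    define h where "h v = c + m1 * (w1 u * w1 v) + m2 * (w2 u * w2 v)" for v
    have "(\<Sum>v\<in>pverts G. h v) = n * c"
      using sums(1,2) by (simp add: h_def sum.distrib n flip: sum_distrib_left)
    moreover have "(\<Sum>v\<in>pverts G. h v) = h u + (\<Sum>v\<in>pverts G - {u}. h v)"
      using fin u by (simp add: sum.remove)
    moreover have "(\<Sum>v\<in>pverts G - {u}. h v) = (\<Sum>v\<in>pverts G - {u}. graph_dist G u v)"
      using dist u by (intro sum.cong) (auto simp: h_def)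
    moreover have "transmission G u = graph_dist G u u + (\<Sum>v\<in>pverts G - {u}. graph_dist G u v)"
      unfolding transmission_def using fin u by (simp add: sum.remove)
    ultimately show ?thesis using self[OF u] by (simp add: h_def)
  qed
  have "max_eigenvalue_mult (distance_laplacian G vs) = n - card {..<3::nat}"
  proof (rule max_eigenvalue_mult_if_decomposition[where m = m and w = w and L = "n * c"])
    show "distance_laplacian G vs \<in> carrier_mat n n"
      using distance_laplacian_carrier by (simp add: n_def)
    show "(distance_laplacian G vs)\<^sup>T = distance_laplacian G vs"
      using vs(2) by (rule distance_laplacian_symmetric)
    show "m k > 0" for k using pos by (simp add: m_def)
    show "(\<Sum>i<n. w k i * w k i) \<noteq> 0" for k
      using sums(4,5) sum_vs[of "\<lambda>v. w1 v * w1 v"] sum_vs[of "\<lambda>v. w2 v * w2 v"] card n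
      by (cases "k = 0"; cases "k = 1") (auto simp: w_def)
    show "(if i = j then n * c else 0) - distance_laplacian G vs $$ (i, j) = (\<Sum>k<3. m k * (w k i * w k j))"
      if ij: "i < n" "j < n" for i j
    proof -
      have V: "vs ! i \<in> pverts G" "vs ! j \<in> pverts G" using ij vs(2) nth_mem n_def by blast+
      have "(\<Sum>k<3. m k * (w k i * w k j)) = c + m1 * (w1 (vs ! i) * w1 (vs ! j)) + m2 * (w2 (vs ! i) * w2 (vs ! j))"
        unfolding K by (simp add: m_def w_def)
      moreover have "i \<noteq> j \<Longrightarrow> vs ! i \<noteq> vs ! j" using ij vs(1) n_def by (simp add: nth_eq_iff_index_eq)
      ultimately show ?thesis
        using ij V dist self trans by (cases "i = j") (auto simp: distance_laplacian_index n_def)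
    qed
  qed (use orth card n in auto)
  then show ?thesis using n by simp
qed

end

lemma sum_over_classes:
  fixes h :: "nat \<Rightarrow> real"
  assumes "finite V" "\<And>v. v \<in> V \<Longrightarrow> l v < N"
  shows "(\<Sum>v\<in>V. h (l v)) = (\<Sum>i<N. real (card {v \<in> V. l v = i}) * h i)"
proof -
  have "(\<Sum>v\<in>V. h (l v)) = (\<Sum>i<N. \<Sum>v\<in>{v \<in> V. l v = i}. h (l v))"
    using assms by (intro sum.group[symmetric]) auto
  also have "\<dots> = (\<Sum>i<N. real (card {v \<in> V. l v = i}) * h i)"
    by (intro sum.cong) auto
  finally show ?thesis .
qed

text \<open>The off-diagonal entries of \<open>\<lambda> I - D\<^sup>L\<close> are the distances, and the diagonal is determined by
  the row sums, so a decomposition of rank three only has to be checked off the diagonal.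
  \<open>W1\<close> and \<open>W2\<close> are eigenvectors that are constant on the classes of \<open>l\<close>.\<close>

lemma graphs_with_mult_if_class_weights:
  fixes l :: "'a \<Rightarrow> nat" and W1 W2 :: "nat \<Rightarrow> real"
  assumes G: "pair_graph G" and n: "card (pverts G) = n" "n > 3"
    and nb: "\<And>u v. u \<in> pverts G \<Longrightarrow> v \<in> pverts G \<Longrightarrow> u \<noteq> v \<Longrightarrow> \<not> adj G u v \<Longrightarrow>
      \<exists>w\<in>pverts G. adj G u w \<and> adj G w v"
    and l: "\<And>v. v \<in> pverts G \<Longrightarrow> l v < N"
    and s: "\<And>i. i < N \<Longrightarrow> card {v \<in> pverts G. l v = i} = s i"
    and pos: "c > 0" "m1 > 0" "m2 > 0"
    and sums: "(\<Sum>i<N. real (s i) * W1 i) = 0" "(\<Sum>i<N. real (s i) * W2 i) = 0"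
      "(\<Sum>i<N. real (s i) * (W1 i * W2 i)) = 0"
      "(\<Sum>i<N. real (s i) * (W1 i * W1 i)) \<noteq> 0" "(\<Sum>i<N. real (s i) * (W2 i * W2 i)) \<noteq> 0"
    and off_diag: "\<And>u v. u \<in> pverts G \<Longrightarrow> v \<in> pverts G \<Longrightarrow> u \<noteq> v \<Longrightarrow>
      c + m1 * (W1 (l u) * W1 (l v)) + m2 * (W2 (l u) * W2 (l v)) = (if adj G u v then 1 else 2)"
  shows "G \<in> graphs_with_mult n (n - 3)"
proof -
  interpret pair_graph G by fact
  have fin: "finite (pverts G)" by (rule pair_finite_verts)
  have ne: "pverts G \<noteq> {}" using n by auto
  have conn: "Digraph_Component.connected (with_proj G)"
    using nb by (intro connected_if_common_neighbours[OF G ne]) blast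
  interpret connected_pair_graph G by unfold_locales (rule conn)
  have diam: "walk_dist G u v \<le> 2" if uv: "u \<in> pverts G" "v \<in> pverts G" for u v
  proof -
    consider "u = v" | "adj G u v" | w where "w \<in> pverts G" "adj G u w" "adj G w v"
      using nb[OF uv] by blast
    then show ?thesis
    proof cases
      case 1
      then show ?thesis using walk_dist_eq_0[OF uv] by simp
    next
      case 2
      then show ?thesis using walk_dist_eq_1[OF uv] by simp
    next
      case (3 w)
      then show ?thesis
        using walk_dist_eq_1[OF uv(1), of w] walk_dist_eq_1[OF _ uv(2), of w] walk_dist_triangle[OF uv(1) _ uv(2), of w]
        by simp
    qed
  qed
  have sum_eq: "(\<Sum>v\<in>pverts G. h (l v)) = (\<Sum>i<N. real (s i) * h i)" for h :: "nat \<Rightarrow> real"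
    using sum_over_classes[OF fin l, of "\<lambda>v. v" h] s by simp
  have "max_eigenvalue_mult (distance_laplacian G vs) = n - 3" if "distinct vs" "set vs = pverts G" for vs
    using max_eigenvalue_mult_if_weights[OF _ diam that pos, of "\<lambda>v. W1 (l v)" "\<lambda>v. W2 (l v)"]
      sum_eq[of W1] sum_eq[of W2] sum_eq[of "\<lambda>i. W1 i * W2 i"] sum_eq[of "\<lambda>i. W1 i * W1 i"]
      sum_eq[of "\<lambda>i. W2 i * W2 i"] sums off_diag n by simp
  then show ?thesis using G conn n by (simp add: graphs_with_mult_def)
qed


section \<open>Explicit eigenvectors for the six families\<close>

locale large_pair_graph = pair_graph +
  fixes n :: nat
  assumes card_verts: "card (pverts G) = n" and n_ge_6: "n \<ge> 6"
begin

text \<open>W1 is antisymmetric on the two centres, W2 separates them from the rest and is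
  orthogonal to the all-ones vector. The three kinds of pairs give linear equations for the
  coefficients: c + 4 m2 = 2, c - 2 (n - 2) m2 = 1 and c - m1 + (n - 2)^2 m2 = 1.\<close>

lemma double_cone_graphs_with_mult:
  assumes "double_cone_on (pverts G) (adj G)"
  shows "G \<in> graphs_with_mult n (n - 3)"
proof -
  obtain S where S: "S \<subseteq> pverts G" "card S = 2"
    and E: "\<And>v w. v \<in> pverts G \<Longrightarrow> w \<in> pverts G \<Longrightarrow> adj G v w \<longleftrightarrow> v \<noteq> w \<and> (v \<in> S \<or> w \<in> S)"
    using assms unfolding double_cone_on_def by blast
  obtain p q where pq: "S = {p, q}" "p \<noteq> q" using S(2) by (auto simp: card_2_iff)
  then have V: "p \<in> pverts G" "q \<in> pverts G" using S(1) by auto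
  define l where "l v = (if v = p then 0 else if v = q then 1 else 2 :: nat)" for v
  define W1 W2 :: "nat \<Rightarrow> real" where "W1 i = (if i = 0 then 1 else if i = 1 then - 1 else 0)"
    and "W2 i = (if i = 2 then - 2 else real n - 2)" for i
  have c: "{v \<in> pverts G. l v = 0} = {p}" "{v \<in> pverts G. l v = 1} = {q}"
    "{v \<in> pverts G. l v = 2} = pverts G - {p, q}"
    using pq V by (auto simp: l_def)
  have three: "{..<3::nat} = {0, 1, 2}" by auto
  show ?thesis
  proof (rule graphs_with_mult_if_class_weights[where l = l and N = 3 and ?W1.0 = W1 and ?W2.0 = W2
        and s = "\<lambda>i. if i = 2 then n - 2 else 1" and c = "2 - 2 / real n"
        and ?m1.0 = "(real n - 2) / 2" and ?m2.0 = "1 / (2 * real n)"])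
    show "pair_graph G" ..
    show "card {v \<in> pverts G. l v = i} = (if i = 2 then n - 2 else 1)" if "i < 3" for i
    proof -
      have "i = 0 \<or> i = 1 \<or> i = 2" using that by auto
      then show ?thesis using c pq V card_verts by (auto simp: card_Diff_subset)
    qed
    show "\<exists>w\<in>pverts G. adj G u w \<and> adj G w v"
      if "u \<in> pverts G" "v \<in> pverts G" "u \<noteq> v" "\<not> adj G u v" for u v
      using that E V pq by (intro bexI[of _ p]) auto
    show "2 - 2 / real n + (real n - 2) / 2 * (W1 (l u) * W1 (l v)) + 1 / (2 * real n) * (W2 (l u) * W2 (l v))
        = (if adj G u v then 1 else 2)"
      if "u \<in> pverts G" "v \<in> pverts G" "u \<noteq> v" for u v
      using that E[OF that(1,2)] pq n_ge_6 by (auto simp: l_def W1_def W2_def field_simps)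
    have "0 < real n * real n" using n_ge_6 by simp
    show "(\<Sum>i<3. real (if i = 2 then n - 2 else 1) * (W2 i * W2 i)) \<noteq> 0"
    proof -
      have "(\<Sum>i<3. real (if i = 2 then n - 2 else 1) * (W2 i * W2 i)) = 2 * ((real n - 2) * (real n - 2)) + (real n - 2) * 4"
        using n_ge_6 unfolding three by (simp add: W2_def of_nat_diff)
      moreover have "\<dots> > 0" using n_ge_6 by (intro add_pos_pos mult_pos_pos) auto
      ultimately show ?thesis by simp
    qed
  qed (use n_ge_6 card_verts in \<open>auto simp: three l_def W1_def W2_def of_nat_diff field_simps\<close>)
qed

text \<open>Compared with the double cone only the distance between the two special vertices
  changes, from 1 to 2. The same eigenvectors therefore work, with m1 lowered by 1.\<close>

lemma bipartite_2_graphs_with_mult: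
  assumes "multipartite_on (pverts G) (adj G) [2, n - 2]"
  shows "G \<in> graphs_with_mult n (n - 3)"
proof -
  obtain k where k: "\<And>i. i < length [2, n - 2] \<Longrightarrow> card {v \<in> pverts G. k v = i} = [2, n - 2] ! i"
    and E: "\<And>v w. v \<in> pverts G \<Longrightarrow> w \<in> pverts G \<Longrightarrow> adj G v w \<longleftrightarrow> k v \<noteq> k w"
    and len: "\<And>v. v \<in> pverts G \<Longrightarrow> k v < length [2, n - 2]"
    using assms unfolding multipartite_on_def by blast
  have k2: "k v < 2" if "v \<in> pverts G" for v using len[OF that] by simp
  obtain p q where pq: "{v \<in> pverts G. k v = 0} = {p, q}" "p \<noteq> q" using k[of 0] by (auto simp: card_2_iff)
  have "{v \<in> pverts G. k v = 1} \<noteq> {}"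
  proof
    assume empty: "{v \<in> pverts G. k v = 1} = {}"
    have "card {v \<in> pverts G. k v = 1} = n - 2" using k[of 1] by simp
    then show False unfolding empty using n_ge_6 by simp
  qed
  then obtain r where r: "r \<in> pverts G" "k r = 1" by blast
  have V: "p \<in> pverts G" "q \<in> pverts G" using pq(1) by blast+
  have k0: "k v = 0 \<longleftrightarrow> v = p \<or> v = q" if "v \<in> pverts G" for v
  proof -
    have "v \<in> {v \<in> pverts G. k v = 0} \<longleftrightarrow> v \<in> {p, q}" unfolding pq(1) ..
    then show ?thesis using that by simp
  qed
  have k1: "k v = 1" if "v \<in> pverts G" "v \<noteq> p" "v \<noteq> q" for v using k0[OF that(1)] k2[OF that(1)] that by simp
  define l where "l v = (if v = p then 0 else if v = q then 1 else 2 :: nat)" for v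
  define W1 W2 :: "nat \<Rightarrow> real" where "W1 i = (if i = 0 then 1 else if i = 1 then - 1 else 0)"
    and "W2 i = (if i = 2 then - 2 else real n - 2)" for i
  have c: "{v \<in> pverts G. l v = 0} = {p}" "{v \<in> pverts G. l v = 1} = {q}"
    "{v \<in> pverts G. l v = 2} = pverts G - {p, q}"
    using pq V by (auto simp: l_def)
  have three: "{..<3::nat} = {0, 1, 2}" by auto
  show ?thesis
  proof (rule graphs_with_mult_if_class_weights[where l = l and N = 3 and ?W1.0 = W1 and ?W2.0 = W2
        and s = "\<lambda>i. if i = 2 then n - 2 else 1" and c = "2 - 2 / real n"
        and ?m1.0 = "(real n - 4) / 2" and ?m2.0 = "1 / (2 * real n)"])
    show "pair_graph G" ..
    show "card {v \<in> pverts G. l v = i} = (if i = 2 then n - 2 else 1)" if "i < 3" for i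
    proof -
      have "i = 0 \<or> i = 1 \<or> i = 2" using that by auto
      then show ?thesis using c pq V card_verts by (auto simp: card_Diff_subset)
    qed
    show "\<exists>w\<in>pverts G. adj G u w \<and> adj G w v"
      if uv: "u \<in> pverts G" "v \<in> pverts G" "u \<noteq> v" "\<not> adj G u v" for u v
    proof (cases "k u = 0")
      case True
      then show ?thesis using uv E V r by (intro bexI[of _ r]) auto
    next
      case False
      then show ?thesis using uv E V k0[OF V(1)] by (intro bexI[of _ p]) auto
    qed
    show "2 - 2 / real n + (real n - 4) / 2 * (W1 (l u) * W1 (l v)) + 1 / (2 * real n) * (W2 (l u) * W2 (l v))
        = (if adj G u v then 1 else 2)"
      if uv: "u \<in> pverts G" "v \<in> pverts G" "u \<noteq> v" for u v
    proof -
      have w2: "W2 (l v) = (if v = p \<or> v = q then real n - 2 else - 2)" for v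
        by (auto simp: l_def W2_def)
      have w1: "W1 (l u) * W1 (l v) = (if {u, v} = {p, q} then - 1 else 0)"
        using uv(3) pq(2) by (auto simp: l_def W1_def doubleton_eq_iff)
      have adj: "adj G u v \<longleftrightarrow> (u = p \<or> u = q) \<noteq> (v = p \<or> v = q)"
        using E[OF uv(1,2)] k0[OF uv(1)] k0[OF uv(2)] k1[OF uv(1)] k1[OF uv(2)] by auto
      show ?thesis
      proof (cases "u = p \<or> u = q"; cases "v = p \<or> v = q")
        assume pq': "u = p \<or> u = q" "v = p \<or> v = q"
        then have "{u, v} = {p, q}" using uv(3) by auto
        then show ?thesis unfolding w1 w2 adj using pq' n_ge_6 by (simp add: field_simps)
      next
        assume pq': "u = p \<or> u = q" "\<not> (v = p \<or> v = q)"
        then have "{u, v} \<noteq> {p, q}" by (auto simp: doubleton_eq_iff)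
        then show ?thesis unfolding w1 w2 adj using pq' n_ge_6 by (simp add: field_simps)
      next
        assume pq': "\<not> (u = p \<or> u = q)" "v = p \<or> v = q"
        then have "{u, v} \<noteq> {p, q}" by (auto simp: doubleton_eq_iff)
        then show ?thesis unfolding w1 w2 adj using pq' n_ge_6 by (simp add: field_simps)
      next
        assume pq': "\<not> (u = p \<or> u = q)" "\<not> (v = p \<or> v = q)"
        then have "{u, v} \<noteq> {p, q}" by (auto simp: doubleton_eq_iff)
        then show ?thesis unfolding w1 w2 adj using pq' n_ge_6 by (simp add: field_simps)
      qed
    qed
    show "(\<Sum>i<3. real (if i = 2 then n - 2 else 1) * (W2 i * W2 i)) \<noteq> 0"
    proof -
      have "(\<Sum>i<3. real (if i = 2 then n - 2 else 1) * (W2 i * W2 i)) = 2 * ((real n - 2) * (real n - 2)) + (real n - 2) * 4"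
        using n_ge_6 unfolding three by (simp add: W2_def of_nat_diff)
      moreover have "\<dots> > 0" using n_ge_6 by (intro add_pos_pos mult_pos_pos) auto
      ultimately show ?thesis by simp
    qed
  qed (use n_ge_6 card_verts in \<open>auto simp: three l_def W1_def W2_def of_nat_diff field_simps\<close>)
qed

text \<open>W1 with coefficient 1 lowers the distance between a and b from 2 to 1; W2 belongs to the
  bipartition. The pairs across and outside \<open>K\<close> fix c and m2; a pair inside
  \<open>K\<close> then requires (n - k)^2 = k^2, so either n = 2k or there is no such pair.\<close>

lemma bipartite_plus_edge_graphs_with_mult:
  assumes "bipartite_plus_edge_on (pverts G) (adj G) k" "k = 1 \<or> n = 2 * k"
  shows "G \<in> graphs_with_mult n (n - 3)"
proof -
  obtain K a b where K: "K \<subseteq> pverts G" "card K = k" "a \<in> pverts G - K" "b \<in> pverts G - K" "a \<noteq> b"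
    and E: "\<And>v w. v \<in> pverts G \<Longrightarrow> w \<in> pverts G \<Longrightarrow> adj G v w \<longleftrightarrow> (v \<in> K) \<noteq> (w \<in> K) \<or> {v, w} = {a, b}"
    using assms(1) unfolding bipartite_plus_edge_on_def by blast
  have fin: "finite K" using K(1) pair_finite_verts finite_subset by blast
  have k: "k > 0" "k + 2 < n" using assms(2) n_ge_6 by auto
  then obtain r where r: "r \<in> K" using K(2) by fastforce
  have single: "v = w" if "v \<in> K" "w \<in> K" "k = 1" for v w
    using K(2) that by (auto simp: card_1_singleton_iff)
  define l where "l v = (if v = a then 0 else if v = b then 1 else if v \<in> K then 2 else 3 :: nat)" for v
  define W1 W2 :: "nat \<Rightarrow> real" where "W1 i = (if i = 0 then 1 else if i = 1 then - 1 else 0)"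
    and "W2 i = (if i = 2 then real n - real k else - real k)" for i
  have c: "{v \<in> pverts G. l v = 0} = {a}" "{v \<in> pverts G. l v = 1} = {b}"
    "{v \<in> pverts G. l v = 2} = K" "{v \<in> pverts G. l v = 3} = pverts G - insert a (insert b K)"
    using K by (auto simp: l_def)
  have four: "{..<4::nat} = {0, 1, 2, 3}" by auto
  show ?thesis
  proof (rule graphs_with_mult_if_class_weights[where l = l and N = 4 and ?W1.0 = W1 and ?W2.0 = W2
        and s = "\<lambda>i. if i = 2 then k else if i = 3 then n - k - 2 else 1" and c = "2 - real k / real n"
        and ?m1.0 = 1 and ?m2.0 = "1 / (real k * real n)"])
    show "pair_graph G" ..
    show "card {v \<in> pverts G. l v = i} = (if i = 2 then k else if i = 3 then n - k - 2 else 1)" if "i < 4" for i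
    proof -
      have "card (pverts G - insert a (insert b K)) = n - k - 2"
        using K fin card_verts by (subst card_Diff_subset) auto
      moreover have "i = 0 \<or> i = 1 \<or> i = 2 \<or> i = 3" using that by auto
      ultimately show ?thesis using c K(2) by auto
    qed
    show "\<exists>w\<in>pverts G. adj G u w \<and> adj G w v"
      if uv: "u \<in> pverts G" "v \<in> pverts G" "u \<noteq> v" "\<not> adj G u v" for u v
    proof (cases "u \<in> K")
      case True
      then show ?thesis using uv E[of u v] E[of u a] E[of a v] K by (intro bexI[of _ a]) auto
    next
      case False
      then show ?thesis using uv E[of u v] E[of u r] E[of r v] K r by (intro bexI[of _ r]) auto
    qed
    show "2 - real k / real n + 1 * (W1 (l u) * W1 (l v)) + 1 / (real k * real n) * (W2 (l u) * W2 (l v))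
        = (if adj G u v then 1 else 2)"
      if uv: "u \<in> pverts G" "v \<in> pverts G" "u \<noteq> v" for u v
    proof -
      have w2: "W2 (l v) = (if v \<in> K then real n - real k else - real k)" for v
        using K by (auto simp: l_def W2_def)
      have w1: "W1 (l u) * W1 (l v) = (if {u, v} = {a, b} then - 1 else 0)"
        using uv(3) K(5) by (auto simp: l_def W1_def doubleton_eq_iff)
      consider "u \<in> K" "v \<in> K" | "u \<in> K \<longleftrightarrow> v \<notin> K" | "u \<notin> K" "v \<notin> K" by blast
      then show ?thesis
      proof cases
        case 1
        then have "n = 2 * k" using single uv(3) assms(2) by auto
        moreover have "{u, v} \<noteq> {a, b}" using 1 K by (auto simp: doubleton_eq_iff)
        ultimately show ?thesis unfolding w1 w2 using 1 E[OF uv(1,2)] k by (simp add: field_simps)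
      next
        case 2
        then have "{u, v} \<noteq> {a, b}" using K by (auto simp: doubleton_eq_iff)
        moreover have w22: "W2 (l u) * W2 (l v) = - real k * (real n - real k)" using 2 by (auto simp: w2)
        ultimately show ?thesis unfolding w1 w22 using 2 E[OF uv(1,2)] k by (simp add: field_simps)
      next
        case 3
        then show ?thesis unfolding w1 w2 using E[OF uv(1,2)] k by (simp add: field_simps)
      qed
    qed
    show "(\<Sum>i<4. real (if i = 2 then k else if i = 3 then n - k - 2 else 1) * (W2 i * W2 i)) \<noteq> 0"
    proof -
      have "(\<Sum>i<4. real (if i = 2 then k else if i = 3 then n - k - 2 else 1) * (W2 i * W2 i))
        \<ge> real (if (0::nat) = 2 then k else if (0::nat) = 3 then n - k - 2 else 1) * (W2 0 * W2 0)"
        by (rule member_le_sum) auto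
      moreover have "W2 0 * W2 0 > 0" using k by (simp add: W2_def)
      ultimately show ?thesis by simp
    qed
    show "(\<Sum>i<4. real (if i = 2 then k else if i = 3 then n - k - 2 else 1) * W2 i) = 0"
      using k unfolding four by (simp add: W2_def of_nat_diff algebra_simps)
    show "2 - real k / real n > 0" using k by (simp add: field_simps)
  qed (use n_ge_6 card_verts k in \<open>auto simp: four l_def W1_def W2_def\<close>)
qed

text \<open>W1 separates the two parts of size m, W2 separates the first part from them. All pairs
  except those inside the first part determine the coefficients; a pair inside it requires (2m + p)
  (m - p) = 0, so p = m, or p = 1 and there is no such pair.\<close>

lemma multipartite_3_graphs_with_mult:
  assumes "multipartite_on (pverts G) (adj G) [p, m, m]"
    and "p = 1 \<and> n = 2 * m + 1 \<or> p = m \<and> n = 3 * m"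
  shows "G \<in> graphs_with_mult n (n - 3)"
proof -
  have three: "{..<3::nat} = {0, 1, 2}" by auto
  obtain l where sizes: "\<And>i. i < length [p, m, m] \<Longrightarrow> card {v \<in> pverts G. l v = i} = [p, m, m] ! i"
    and E: "\<And>v w. v \<in> pverts G \<Longrightarrow> w \<in> pverts G \<Longrightarrow> adj G v w \<longleftrightarrow> l v \<noteq> l w"
    and len: "\<And>v. v \<in> pverts G \<Longrightarrow> l v < length [p, m, m]"
    using assms(1) unfolding multipartite_on_def by blast
  have s: "card {v \<in> pverts G. l v = i} = [p, m, m] ! i" if "i < 3" for i
    using sizes[of i] that by simp
  have l3: "l v < 3" if "v \<in> pverts G" for v using len[OF that] by simp
  have p: "p > 0" "m > 0" using assms(2) n_ge_6 by auto
  have l_cases: "l v = 0 \<or> l v = 1 \<or> l v = 2" if "v \<in> pverts G" for v using l3[OF that] by auto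
  have ex: "\<exists>w\<in>pverts G. l w = i" if "i < 3" for i
  proof -
    have "card {v \<in> pverts G. l v = i} \<noteq> 0" using s[OF that] that p by (auto simp: less_Suc_eq numeral_3_eq_3)
    then show ?thesis by (metis (mono_tags, lifting) Collect_empty_eq card.empty)
  qed
  have single: "v = w" if vw: "v \<in> pverts G" "w \<in> pverts G" "l v = 0" "l w = 0" "p = 1" for v w
  proof -
    obtain x where x: "{v \<in> pverts G. l v = 0} = {x}" using s[of 0] vw(5) by (auto simp: card_1_singleton_iff)
    have "v \<in> {v \<in> pverts G. l v = 0}" "w \<in> {v \<in> pverts G. l v = 0}" using vw by simp_all
    then show ?thesis unfolding x by simp
  qed
  define W1 W2 :: "nat \<Rightarrow> real" where "W1 i = (if i = 0 then 0 else if i = 1 then 1 else - 1)"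
    and "W2 i = (if i = 0 then 2 * real m else - real p)" for i
  show ?thesis
  proof (rule graphs_with_mult_if_class_weights[where l = l and N = 3 and ?W1.0 = W1 and ?W2.0 = W2
        and s = "\<lambda>i. [p, m, m] ! i" and c = "(3 * real m + real p) / real n"
        and ?m1.0 = "1 / 2" and ?m2.0 = "1 / (2 * real p * real n)"])
    show "pair_graph G" ..
    show "card {v \<in> pverts G. l v = i} = [p, m, m] ! i" if "i < 3" for i using s[OF that] .
    show "l v < 3" if "v \<in> pverts G" for v using l3[OF that] .
    show "\<exists>w\<in>pverts G. adj G u w \<and> adj G w v"
      if uv: "u \<in> pverts G" "v \<in> pverts G" "u \<noteq> v" "\<not> adj G u v" for u v
    proof -
      define i where "i = (if l u = 0 then 1 else 0 :: nat)"
      have "i < 3" by (simp add: i_def)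
      then obtain w where "w \<in> pverts G" "l w = i" using ex by blast
      then have "w \<in> pverts G" "l w \<noteq> l u" by (auto simp: i_def split: if_splits)
      then show ?thesis using E uv by metis
    qed
    show "(3 * real m + real p) / real n + 1 / 2 * (W1 (l u) * W1 (l v))
        + 1 / (2 * real p * real n) * (W2 (l u) * W2 (l v)) = (if adj G u v then 1 else 2)"
      if uv: "u \<in> pverts G" "v \<in> pverts G" "u \<noteq> v" for u v
    proof -
      have nr: "real n = 2 * real m + real p" using assms(2) by auto
      have n0: "real n > 0" using n_ge_6 by simp
      consider "l u = 0" "l v = 0" | "l u = 0 \<longleftrightarrow> l v \<noteq> 0" | "l u \<noteq> 0" "l v \<noteq> 0"
        by (cases "l u = 0"; cases "l v = 0") auto
      then show ?thesis
      proof cases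
        case 1
        then have "p \<noteq> 1" using single uv by blast
        then have "p = m" using assms(2) by auto
        moreover have "W1 (l u) * W1 (l v) = 0" "W2 (l u) * W2 (l v) = 4 * real m * real m"
          using 1 by (simp_all add: W1_def W2_def)
        ultimately show ?thesis using 1 E[OF uv(1,2)] p nr by simp
      next
        case 2
        then have uv_adj: "adj G u v" using E[OF uv(1,2)] by auto
        have w1: "W1 (l u) * W1 (l v) = 0" and w2: "W2 (l u) * W2 (l v) = - 2 * real m * real p"
          using 2 by (auto simp: W1_def W2_def)
        have w2': "1 / (2 * real p * real n) * (- 2 * real m * real p) = - real m / real n"
          using p n0 by (simp add: field_simps)
        have m: "3 * real m + real p = real n + real m" using nr by simp
        show ?thesis unfolding w1 w2 w2' m using uv_adj n0 by (simp add: field_simps)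
      next
        case 3
        then have w1: "W1 (l u) * W1 (l v) = (if l u = l v then 1 else - 1)"
          and w2: "W2 (l u) * W2 (l v) = real p * real p"
          using l_cases[OF uv(1)] l_cases[OF uv(2)] by (auto simp: W1_def W2_def)
        have w2': "1 / (2 * real p * real n) * (real p * real p) = (real p / 2) / real n"
          using p n0 by (simp add: field_simps)
        have m: "3 * real m + real p = 3 / 2 * real n - real p / 2" using nr by linarith
        have m': "(3 / 2 * real n - real p / 2) / real n = 3 / 2 - (real p / 2) / real n"
          using n0 by (simp add: field_simps)
        show ?thesis unfolding w1 w2 w2' m m' using E[OF uv(1,2)] by simp
      qed
    qed
    show "(\<Sum>i<3. real ([p, m, m] ! i) * (W2 i * W2 i)) \<noteq> 0"
    proof -
      have "(\<Sum>i<3. real ([p, m, m] ! i) * (W2 i * W2 i)) = real p * (2 * real m * (2 * real m)) + 2 * (real m * (real p * real p))"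
        unfolding three by (simp add: W2_def)
      moreover have "\<dots> > 0" using p by (intro add_pos_pos mult_pos_pos) auto
      ultimately show ?thesis by simp
    qed
    show "0 < (3 * real m + real p) / real n" using p n_ge_6 by (intro divide_pos_pos) auto
  qed (use n_ge_6 card_verts p in \<open>auto simp: three W1_def W2_def\<close>)
qed

theorem extremal_on_iff_graphs_with_mult:
  "extremal_on (pverts G) (adj G) \<longleftrightarrow> G \<in> graphs_with_mult n (n - 3)"
proof
  assume "extremal_on (pverts G) (adj G)"
  then show "G \<in> graphs_with_mult n (n - 3)"
    unfolding extremal_on_def card_verts
    using bipartite_2_graphs_with_mult double_cone_graphs_with_mult
      bipartite_plus_edge_graphs_with_mult[of 1] bipartite_plus_edge_graphs_with_mult[of "n div 2"]
      multipartite_3_graphs_with_mult[of 1 "(n - 1) div 2"]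
      multipartite_3_graphs_with_mult[of "n div 3" "n div 3"]
    by auto
next
  assume mult: "G \<in> graphs_with_mult n (n - 3)"
  then have "Digraph_Component.connected (with_proj G)" by (simp add: graphs_with_mult_def)
  then interpret connected_pair_graph G by unfold_locales
  obtain vs where vs: "set vs = pverts G" "distinct vs"
    using finite_distinct_list[OF pair_finite_verts] by blast
  have len: "length vs = n" using vs card_verts distinct_card by metis
  define A where "A = distance_laplacian G vs"
  have V: "vs ! i \<in> pverts G" if "i < n" for i using that len vs(1) nth_mem by blast
  have A: "A \<in> carrier_mat n n" using distance_laplacian_carrier[of G vs] len by (simp add: A_def)
  have off_diag: "- A $$ (i, j) = real (walk_dist G (vs ! i) (vs ! j))" if "i < n" "j < n" "i \<noteq> j" for i j
    using that len graph_dist_eq[OF V[OF that(1)] V[OF that(2)]] by (simp add: A_def distance_laplacian_index)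
  have row_sum: "(\<Sum>j<n. A $$ (i, j)) = 0" if "i < n" for i
    using distance_laplacian_row_sum[OF vs(2,1), of i] that len by (simp add: A_def)
  \<comment> \<open>By the zero row sum this entry is a sum of distances to other vertices. It
    ensures that the largest eigenvalue is positive.\<close>
  have pos: "A $$ (0, 0) > 0"
  proof -
    have "{..<n} = insert 0 {1..<n}" using n_ge_6 by auto
    then have "A $$ (0, 0) = (\<Sum>j\<in>{1..<n}. - A $$ (0, j))"
      using row_sum[of 0] n_ge_6 by (simp add: sum_negf)
    also have "\<dots> = (\<Sum>j\<in>{1..<n}. real (walk_dist G (vs ! 0) (vs ! j)))"
      using off_diag n_ge_6 by (intro sum.cong) auto
    also have "\<dots> > 0"
    proof (rule sum_pos)
      fix j assume j: "j \<in> {1..<n}"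
      then have "vs ! 0 \<noteq> vs ! j" using vs(2) len n_ge_6 by (subst nth_eq_iff_index_eq) auto
      then show "0 < real (walk_dist G (vs ! 0) (vs ! j))" using walk_dist_eq_0[OF V[of 0] V[of j]] j n_ge_6 by simp
    qed (use n_ge_6 in auto)
    finally show ?thesis .
  qed
  have symA: "A\<^sup>T = A" unfolding A_def using vs(1) by (rule distance_laplacian_symmetric)
  have multA: "max_eigenvalue_mult A = n - 3" using mult vs by (simp add: graphs_with_mult_def A_def)
  have n4: "4 \<le> n" "0 < n" using n_ge_6 by auto
  obtain c f g where
    gram: "\<And>i j. i < n \<Longrightarrow> j < n \<Longrightarrow> i \<noteq> j \<Longrightarrow> f i * f j + g i * g j = - A $$ (i, j) - c"
    and sums: "(\<Sum>i<n. f i) = 0" "(\<Sum>i<n. g i) = 0"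
    and span: "\<exists>i<n. \<exists>j<n. f i * g j - g i * f j \<noteq> 0"
    by (rule planar_vectors_if_max_eigenvalue_mult[OF A symA n4(1) _ n4(2) pos multA], erule row_sum) (rule that)
  \<comment> \<open>The planar vectors are indexed by positions in the enumeration; its inverse
    transports them to vertices.\<close>
  define idx where "idx = the_inv_into {..<n} ((!) vs)"
  have bij: "bij_betw ((!) vs) {..<n} (pverts G)" using bij_betw_nth[OF vs(2)] len vs(1) by simp
  have idx_nth: "idx (vs ! i) = i" if "i < n" for i
    using that bij by (simp add: idx_def bij_betw_def the_inv_into_f_f)
  have idx: "idx v < n" "vs ! idx v = v" if "v \<in> pverts G" for v
  proof -
    have "v \<in> (!) vs ` {..<n}" using that bij by (simp add: bij_betw_def)
    then obtain i where "i < n" "v = vs ! i" by blast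
    then show "idx v < n" "vs ! idx v = v" using idx_nth by auto
  qed
  have sum_idx: "(\<Sum>v\<in>pverts G. h (idx v)) = (\<Sum>i<n. h i)" for h :: "nat \<Rightarrow> real"
    using sum.reindex_bij_betw[OF bij, of "\<lambda>v. h (idx v)"] idx_nth by simp
  interpret planar_metric "pverts G" "walk_dist G" c "\<lambda>v. f (idx v)" "\<lambda>v. g (idx v)"
  proof
    show "f (idx u) * f (idx v) + g (idx u) * g (idx v) = real (walk_dist G u v) - c"
      if "u \<in> pverts G" "v \<in> pverts G" "u \<noteq> v" for u v
      using gram[of "idx u" "idx v"] off_diag[of "idx u" "idx v"] idx that by metis
    show "(\<Sum>v\<in>pverts G. f (idx v)) = 0" "(\<Sum>v\<in>pverts G. g (idx v)) = 0"
      using sums sum_idx by simp_all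
    show "\<exists>u\<in>pverts G. \<exists>v\<in>pverts G. f (idx u) * g (idx v) - g (idx u) * f (idx v) \<noteq> 0"
      using span V idx_nth by metis
  qed (use n_ge_6 card_verts pair_finite_verts walk_dist_eq_0 walk_dist_commute walk_dist_triangle
      walk_dist_step in auto)
  show "extremal_on (pverts G) (adj G)"
    using extremal extremal_on_cong[of "pverts G" "\<lambda>u v. walk_dist G u v = 1" "adj G"] walk_dist_eq_1
    by simp
qed

end


section \<open>From the listed graphs to conditions on adjacency\<close>

lemma pair_wf_complete_multipartite: "pair_wf_digraph (complete_multipartite as)"
  by unfold_locales (auto simp: parcs_complete_multipartite)

lemma card_complete_multipartite: "card (pverts (complete_multipartite as)) = sum_list as"
proof -
  have "pverts (complete_multipartite as) = (SIGMA i:{..<length as}. {..<as ! i})"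
    by (auto simp: pverts_complete_multipartite)
  then have "card (pverts (complete_multipartite as)) = (\<Sum>i<length as. as ! i)" by simp
  then show ?thesis by (simp add: sum_list_sum_nth lessThan_atLeast0)
qed

lemma plus_edge_verts: "H \<in> plus_edge M \<Longrightarrow> pverts H = pverts M"
  by (auto simp: plus_edge_def add_edge_def)

lemma pair_wf_plus_edge:
  assumes "H \<in> plus_edge M" "pair_wf_digraph M"
  shows "pair_wf_digraph H"
proof -
  obtain u v where "u \<in> pverts M" "v \<in> pverts M" "H = add_edge M u v"
    using assms(1) unfolding plus_edge_def by blast
  then show ?thesis
    using pair_wf_digraph.arc_fst_in_verts[OF assms(2)] pair_wf_digraph.arc_snd_in_verts[OF assms(2)]
    by unfold_locales (auto simp: add_edge_def)
qed

lemma pair_wf_double_cone: "pair_wf_digraph (complete_graph 2 \<nabla> copies k (complete_graph 1))"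
  by unfold_locales (auto simp: join_graph_def complete_graph_def copies_def)

lemma double_cone_verts:
  "finite (pverts (complete_graph 2 \<nabla> copies k (complete_graph 1)))"
  "card (pverts (complete_graph 2 \<nabla> copies k (complete_graph 1))) = k + 2"
  by (simp_all add: join_graph_def complete_graph_def copies_def card_Plus card_cartesian_product)

lemma pair_wf_cone: "pair_wf_digraph (complete_graph 1 \<nabla> complete_multipartite as)"
  by unfold_locales
    (auto simp: join_graph_def complete_graph_def parcs_complete_multipartite)

text \<open>Isomorphism to a listed graph only hands over well-formedness and finiteness. Symmetry
  and the absence of loops are read off the shape of the adjacency relation, which is symmetric and
  irreflexive in every family.\<close>

lemma pair_graphI_extremal_on:
  assumes wf: "pair_wf_digraph G" and fin: "finite (pverts G)" and ext: "extremal_on (pverts G) (adj G)"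
  shows "pair_graph G"
proof -
  have "(adj G u v \<longrightarrow> adj G v u) \<and> \<not> adj G u u" if "u \<in> pverts G" "v \<in> pverts G" for u v
  proof -
    have "(E u v \<longrightarrow> E v u) \<and> \<not> E u u" if "multipartite_on V E as" "u \<in> V" "v \<in> V"
      for V :: "'a set" and E as u v using that by (auto simp: multipartite_on_def)
    moreover have "(E u v \<longrightarrow> E v u) \<and> \<not> E u u" if "bipartite_plus_edge_on V E k" "u \<in> V" "v \<in> V"
      for V :: "'a set" and E k u v
      using that unfolding bipartite_plus_edge_on_def by (auto simp: insert_commute doubleton_eq_iff)
    moreover have "(E u v \<longrightarrow> E v u) \<and> \<not> E u u" if "double_cone_on V E" "u \<in> V" "v \<in> V"
      for V :: "'a set" and E u v using that unfolding double_cone_on_def by auto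
    ultimately show ?thesis using ext that unfolding extremal_on_def by meson
  qed
  then have sym: "\<And>u v. adj G u v \<Longrightarrow> adj G v u" and irrefl: "\<And>u. \<not> adj G u u"
    using pair_wf_digraph.in_arcsD1[OF wf] pair_wf_digraph.in_arcsD2[OF wf] by blast+
  interpret pair_wf_digraph G by fact
  have "parcs G \<subseteq> pverts G \<times> pverts G" by (auto dest: in_arcsD1 in_arcsD2)
  then have "finite (parcs G)" using fin finite_subset by blast
  then show ?thesis
    using fin sym irrefl
    by unfold_locales (auto simp: symmetric_def sym_def prod_eq_iff)
qed

lemma iso_complete_multipartite_iff:
  "G \<simeq>\<^sub>G complete_multipartite as \<longleftrightarrow> pair_wf_digraph G \<and> finite (pverts G) \<and>
    card (pverts G) = sum_list as \<and> multipartite_on (pverts G) (adj G) as"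
  using adj_iso_finite[OF _ finite_complete_multipartite, of G as] adj_iso_complete_multipartite[of G as]
  by (auto simp: iso_graph_iff_adj_iso[OF pair_wf_complete_multipartite] card_complete_multipartite)

lemma iso_plus_edge_iff:
  assumes "k = 1 \<or> k = m"
  shows "(\<exists>H \<in> plus_edge (complete_multipartite [k, m]). G \<simeq>\<^sub>G H) \<longleftrightarrow>
    pair_wf_digraph G \<and> finite (pverts G) \<and> card (pverts G) = k + m \<and>
    bipartite_plus_edge_on (pverts G) (adj G) k" (is "?L \<longleftrightarrow> ?R")
proof
  assume ?L
  then obtain H where H: "H \<in> plus_edge (complete_multipartite [k, m])" "G \<simeq>\<^sub>G H" by blast
  then have G: "pair_wf_digraph G" "adj_iso G H"
    using iso_graph_iff_adj_iso[OF pair_wf_plus_edge[OF H(1) pair_wf_complete_multipartite]] by auto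
  have "finite (pverts H)" "card (pverts H) = k + m"
    unfolding plus_edge_verts[OF H(1)]
    by (simp_all add: finite_complete_multipartite card_complete_multipartite)
  then show ?R
    using G adj_iso_finite[OF G(2)] bipartite_plus_edge_if[OF H(1) G(2) assms] by simp
next
  assume R: ?R
  then obtain H where H: "H \<in> plus_edge (complete_multipartite [k, m])" "adj_iso G H"
    using adj_iso_plus_edge_if[of G k] by auto
  then show ?L
    using R iso_graph_iff_adj_iso[OF pair_wf_plus_edge[OF H(1) pair_wf_complete_multipartite]] by blast
qed

lemma iso_double_cone_iff:
  assumes "n \<ge> 2"
  shows "G \<simeq>\<^sub>G complete_graph 2 \<nabla> copies (n - 2) (complete_graph 1) \<longleftrightarrow>
    pair_wf_digraph G \<and> finite (pverts G) \<and> card (pverts G) = n \<and> double_cone_on (pverts G) (adj G)"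
proof -
  have "card (pverts (complete_graph 2 \<nabla> copies (n - 2) (complete_graph 1))) = n"
    unfolding double_cone_verts using assms by simp
  then show ?thesis
    using adj_iso_finite[OF _ double_cone_verts(1), of G "n - 2"] adj_iso_double_cone[of G n] assms
    unfolding iso_graph_iff_adj_iso[OF pair_wf_double_cone] by metis
qed

lemma iso_cone_iff:
  "G \<simeq>\<^sub>G complete_graph 1 \<nabla> complete_multipartite [m, m] \<longleftrightarrow> G \<simeq>\<^sub>G complete_multipartite [1, m, m]"
  unfolding iso_graph_iff_adj_iso[OF pair_wf_cone] iso_graph_iff_adj_iso[OF pair_wf_complete_multipartite]
  using adj_iso_cone adj_iso_sym adj_iso_trans by metis

theorem theorem3p3:
  fixes n :: nat
  assumes "n \<ge> 6"
  shows "(graphs_with_mult n (n - 3) :: 'a pair_pre_digraph set) =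
    {G. G \<simeq>\<^sub>G complete_multipartite [2, n - 2]
      \<or> (\<exists>H \<in> plus_edge (complete_multipartite [1, n - 1]). G \<simeq>\<^sub>G H)
      \<or> (even n \<and> (\<exists>H \<in> plus_edge (complete_multipartite [n div 2, n div 2]). G \<simeq>\<^sub>G H))
      \<or> G \<simeq>\<^sub>G complete_graph 2 \<nabla> copies (n - 2) (complete_graph 1)
      \<or> (odd n \<and>
          G \<simeq>\<^sub>G complete_graph 1 \<nabla> complete_multipartite [(n - 1) div 2, (n - 1) div 2])
      \<or> (3 dvd n \<and> G \<simeq>\<^sub>G complete_multipartite [n div 3, n div 3, n div 3])}"
    (is "_ = Collect ?rhs")
proof -
  have sizes: "2 + (n - 2) = n" "1 + (n - 1) = n" "even n \<Longrightarrow> n div 2 + n div 2 = n"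
    "odd n \<Longrightarrow> 1 + ((n - 1) div 2 + (n - 1) div 2) = n" "3 dvd n \<Longrightarrow> n div 3 + (n div 3 + n div 3) = n"
    using assms by (auto elim!: oddE dvdE)
  \<comment> \<open>Each isomorphism statement carries its own vertex count; under the divisibility
    conditions all of them equal n, which lets the common part be factored out.\<close>
  have rhs: "?rhs G \<longleftrightarrow> pair_wf_digraph G \<and> finite (pverts G) \<and> card (pverts G) = n \<and>
      extremal_on (pverts G) (adj G)" for G :: "'a pair_pre_digraph"
  proof -
    have "2 \<le> n" using assms by simp
    show ?thesis
      unfolding iso_cone_iff iso_complete_multipartite_iff iso_double_cone_iff[OF \<open>2 \<le> n\<close>]
        iso_plus_edge_iff[OF disjI1[OF refl]] iso_plus_edge_iff[OF disjI2[OF refl]] extremal_on_def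
      using sizes by (auto simp del: One_nat_def)
  qed
  have "G \<in> graphs_with_mult n (n - 3) \<longleftrightarrow> ?rhs G" for G :: "'a pair_pre_digraph"
  proof
    assume G: "G \<in> graphs_with_mult n (n - 3)"
    then have "pair_graph G" "card (pverts G) = n" by (simp_all add: graphs_with_mult_def)
    then interpret large_pair_graph G n
      using assms by (intro large_pair_graph.intro large_pair_graph_axioms.intro)
    show "?rhs G"
      unfolding rhs using G extremal_on_iff_graphs_with_mult card_verts pair_finite_verts by blast
  next
    assume "?rhs G"
    then have G: "pair_wf_digraph G" "finite (pverts G)" "card (pverts G) = n" "extremal_on (pverts G) (adj G)"
      unfolding rhs by blast+
    then interpret large_pair_graph G n
      using assms by (intro large_pair_graph.intro large_pair_graph_axioms.intro pair_graphI_extremal_on)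
    show "G \<in> graphs_with_mult n (n - 3)" using G(4) extremal_on_iff_graphs_with_mult by blast
  qed
  then show ?thesis by blast
qed

end
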